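(* Let $\nu>0$, $f\in H^{-1}(\Omega)$, and assume $\alpha := M\nu^{-2}\|f\|_{-1}<1$. Let $u\in V$ be the (unique) solution of the weak steady Navier-Stokes equations $$\nu(\nabla u,\nabla v)+b^*(u,u,v)=(f,v)\quad\forall v\in V.$$ Then the Picard-Newton iteration converges quadratically to $u$ provided the initial guess is sufficiently close to $u$; that is, there exist constants $r>0$ and $C\ge0$ such that for every $u_0\in V$ with $\|\nabla(u-u_0)\|<r$, the sequence $(u_k)_{k\ge0}$ generated from $u_0$ by the Picard-Newton iteration satisfies $\|\nabla(u-u_k)\|\to0$ as $k\to\infty$ and $$\|\nabla(u-u_{k+1})\|\le C\,\|\nabla(u-u_k)\|^2\quad\text{for all }k\ge0.$$
   Context: $\Omega\subset\mathbb{R}^d$, $d\in\{2,3\}$, is an open connected set. $(\cdot,\cdot)$ and $\|\cdot\|$ denote the $L^2(\Omega)$ inner product and norm. $Q=\{q\in L^2(\Omega):\int_\Omega q\,dx=0\}$; $X=\{v\in H^1(\Omega)^d: v=0 \text{ on }\partial\Omega\}$ (velocity fields); $V=\{v\in X: (\nabla\cdot v,q)=0\ \forall q\in Q\}$. It is a standing assumption that the Poincaré inequality holds: there is $C_P$ depending only on $\Omega$ with $\|\phi\|\le C_P\|\nabla\phi\|$ for all $\phi\in X$. $(\cdot,\cdot)$ also denotes the duality pairing between $H^{-1}$ and $X$, and $\|\cdot\|_{-1}$ is the norm on $H^{-1}$, dual to $v\mapsto\|\nabla v\|$, so $(f,v)\le\|f\|_{-1}\|\nabla v\|$ for $v \in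 X$. The skew-symmetric trilinear form is $b^*(v,w,z)=(v\cdot\nabla w,z)+\tfrac12((\nabla\cdot v)w,z)$ for $v,w,z\in X$; it satisfies $b^*(u,v,v)=0$ for all $u,v\in X$. $M$ is a constant depending only on $\Omega$ such that $b^*(v,w,z)\le M\|\nabla v\|\|\nabla w\|\|\nabla z\|$ for all $v,w,z\in X$. It is well known that the weak steady Navier-Stokes equations admit a solution for every $f\in H^{-1}(\Omega)$ and $\nu>0$, that every solution satisfies $\|\nabla u\|\le\nu^{-1}\|f\|_{-1}$, and that the solution is unique when $\alpha<1$. Picard-Newton iteration: given $u_k\in V$, (Step 1, Picard) find $\hat u_{k+1}\in V$ with $$\nu(\nabla\hat u_{k+1},\nabla v)+b^*(u_k,\hat u_{k+1},v)=(f,v)\quad\forall v\in V;$$ (Step 2, Newton) find $u_{k+1}\in V$ with $$\nu(\nabla u_{k+1},\nabla v)+b^*(\hat u_{k+1},u_{k+1},v)+b^*(u_{k+1},\hat u_{k+1},v)-b^*(\hat u_{k+1},\hat u_{k+1},v)=(f,v)\quad\forall v\in V.$$ *)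

theory Defs
  imports "HOL-Analysis.Analysis"
begin

section \<open>Test functions\<close>

definition partial_deriv :: "'n \<Rightarrow> (real^'n \<Rightarrow> real) \<Rightarrow> real^'n \<Rightarrow> real" where
  "partial_deriv j g x = frechet_derivative g (at x) (axis j 1)"

primrec C_k :: "nat \<Rightarrow> (real^'n \<Rightarrow> real) \<Rightarrow> bool" where
  "C_k 0 g \<longleftrightarrow> continuous_on UNIV g"
| "C_k (Suc k) g \<longleftrightarrow> g differentiable_on UNIV \<and> (\<forall>j. C_k k (partial_deriv j g))"

definition test_functions :: "(real^'n) set \<Rightarrow> (real^'n \<Rightarrow> real) set" where
  "test_functions \<Omega> = {g. (\<forall>k. C_k k g) \<and>
     compact (closure {x. g x \<noteq> 0}) \<and> closure {x. g x \<noteq> 0} \<subseteq> \<Omega>}"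

definition test_fields :: "(real^'n) set \<Rightarrow> (real^'n \<Rightarrow> real^'n) set" where
  "test_fields \<Omega> = {v. \<forall>i. (\<lambda>x. v x $ i) \<in> test_functions \<Omega>}"

section \<open>Lebesgue and Sobolev spaces\<close>

text \<open>Elements of all function spaces below are representatives, i.e. functions on the whole of
  \<open>real^'n\<close> of which only the values almost everywhere on \<open>\<Omega>\<close> matter.\<close>

definition L2_space :: "(real^'n) set \<Rightarrow> (real^'n \<Rightarrow> 'b::euclidean_space) set" where
  "L2_space \<Omega> = {g \<in> borel_measurable (lebesgue_on \<Omega>).
     integrable (lebesgue_on \<Omega>) (\<lambda>x. (norm (g x))\<^sup>2)}"

text \<open>On matrix-valued functions the pointwise inner product is the Frobenius product.\<close>

definition L2_inner ::
  "(real^'n) set \<Rightarrow> (real^'n \<Rightarrow> 'b::euclidean_space) \<Rightarrow> (real^'n \<Rightarrow> 'b) \<Rightarrow> real" where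
  "L2_inner \<Omega> g h = integral\<^sup>L (lebesgue_on \<Omega>) (\<lambda>x. g x \<bullet> h x)"

definition L2_norm :: "(real^'n) set \<Rightarrow> (real^'n \<Rightarrow> 'b::euclidean_space) \<Rightarrow> real" where
  "L2_norm \<Omega> g = sqrt (L2_inner \<Omega> g g)"

text \<open>The entry \<open>G x $ i $ j\<close> is the weak derivative of the \<open>i\<close>-th component in direction \<open>j\<close>.\<close>

definition has_weak_grad ::
  "(real^'n) set \<Rightarrow> (real^'n \<Rightarrow> real^'n) \<Rightarrow> (real^'n \<Rightarrow> real^'n^'n) \<Rightarrow> bool" where
  "has_weak_grad \<Omega> v G \<longleftrightarrow> (\<forall>\<phi>\<in>test_functions \<Omega>. \<forall>i j.
     L2_inner \<Omega> (\<lambda>x. v x $ i) (partial_deriv j \<phi>) = - L2_inner \<Omega> (\<lambda>x. G x $ i $ j) \<phi>)"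

definition H1_space :: "(real^'n) set \<Rightarrow> (real^'n \<Rightarrow> real^'n) set" where
  "H1_space \<Omega> = {v \<in> L2_space \<Omega>. \<exists>G\<in>L2_space \<Omega>. has_weak_grad \<Omega> v G}"

text \<open>The weak gradient is determined up to a null set of \<open>\<Omega>\<close>; choose any representative.\<close>

definition wgrad :: "(real^'n) set \<Rightarrow> (real^'n \<Rightarrow> real^'n) \<Rightarrow> real^'n \<Rightarrow> real^'n^'n" where
  "wgrad \<Omega> v = (SOME G. G \<in> L2_space \<Omega> \<and> has_weak_grad \<Omega> v G)"

definition wdiv :: "(real^'n) set \<Rightarrow> (real^'n \<Rightarrow> real^'n) \<Rightarrow> real^'n \<Rightarrow> real" where
  "wdiv \<Omega> v x = trace (wgrad \<Omega> v x)"

definition H1_norm :: "(real^'n) set \<Rightarrow> (real^'n \<Rightarrow> real^'n) \<Rightarrow> real" where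
  "H1_norm \<Omega> v = sqrt ((L2_norm \<Omega> v)\<^sup>2 + (L2_norm \<Omega> (wgrad \<Omega> v))\<^sup>2)"

text \<open>The open set \<open>\<Omega>\<close> need not have a boundary regular enough for a trace operator, so the
  condition \<open>v = 0\<close> on the boundary means membership in the \<open>H1\<close>-closure of the test fields.\<close>

definition X_space :: "(real^'n) set \<Rightarrow> (real^'n \<Rightarrow> real^'n) set" where
  "X_space \<Omega> = {v \<in> H1_space \<Omega>. \<exists>\<phi>::nat \<Rightarrow> real^'n \<Rightarrow> real^'n.
     (\<forall>n. \<phi> n \<in> test_fields \<Omega>) \<and> (\<lambda>n. H1_norm \<Omega> (\<lambda>x. v x - \<phi> n x)) \<longlonglongrightarrow> 0}"

text \<open>If \<open>\<Omega>\<close> has infinite measure, square integrable functions need not be integrable, and the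
  Bochner integral of a non-integrable function is \<open>0\<close>; hence the explicit integrability.\<close>

definition Q_space :: "(real^'n) set \<Rightarrow> (real^'n \<Rightarrow> real) set" where
  "Q_space \<Omega> = {q \<in> L2_space \<Omega>. integrable (lebesgue_on \<Omega>) q \<and> integral\<^sup>L (lebesgue_on \<Omega>) q = 0}"

definition V_space :: "(real^'n) set \<Rightarrow> (real^'n \<Rightarrow> real^'n) set" where
  "V_space \<Omega> = {v \<in> X_space \<Omega>. \<forall>q\<in>Q_space \<Omega>. L2_inner \<Omega> (wdiv \<Omega> v) q = 0}"

section \<open>The dual space\<close>

definition Hm1_space :: "(real^'n) set \<Rightarrow> ((real^'n \<Rightarrow> real^'n) \<Rightarrow> real) set" where
  "Hm1_space \<Omega> = {f.
     (\<forall>v\<in>X_space \<Omega>. \<forall>w\<in>X_space \<Omega>. \<forall>a b.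
        f (\<lambda>x. a *\<^sub>R v x + b *\<^sub>R w x) = a * f v + b * f w) \<and>
     (\<exists>K. \<forall>v\<in>X_space \<Omega>. \<bar>f v\<bar> \<le> K * L2_norm \<Omega> (wgrad \<Omega> v))}"

definition Hm1_norm :: "(real^'n) set \<Rightarrow> ((real^'n \<Rightarrow> real^'n) \<Rightarrow> real) \<Rightarrow> real" where
  "Hm1_norm \<Omega> f = (SUP v\<in>{v \<in> X_space \<Omega>. L2_norm \<Omega> (wgrad \<Omega> v) \<le> 1}. \<bar>f v\<bar>)"

section \<open>Navier-Stokes equations and the Picard-Newton iteration\<close>

text \<open>\<open>wgrad \<Omega> w x *v v x\<close> is the convective derivative of \<open>w\<close> along \<open>v\<close>.\<close>

definition bstar :: "(real^'n) set \<Rightarrow> (real^'n \<Rightarrow> real^'n) \<Rightarrow> (real^'n \<Rightarrow> real^'n) \<Rightarrow>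
    (real^'n \<Rightarrow> real^'n) \<Rightarrow> real" where
  "bstar \<Omega> v w z = L2_inner \<Omega> (\<lambda>x. wgrad \<Omega> w x *v v x) z
     + 1/2 * L2_inner \<Omega> (\<lambda>x. wdiv \<Omega> v x *\<^sub>R w x) z"

definition weak_NSE_solution :: "(real^'n) set \<Rightarrow> real \<Rightarrow> ((real^'n \<Rightarrow> real^'n) \<Rightarrow> real) \<Rightarrow>
    (real^'n \<Rightarrow> real^'n) \<Rightarrow> bool" where
  "weak_NSE_solution \<Omega> \<nu> f u \<longleftrightarrow> u \<in> V_space \<Omega> \<and>
     (\<forall>v\<in>V_space \<Omega>. \<nu> * L2_inner \<Omega> (wgrad \<Omega> u) (wgrad \<Omega> v) + bstar \<Omega> u u v = f v)"

text \<open>In the two steps, \<open>w\<close> is the current iterate, \<open>uh\<close> the intermediate Picard iterate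
  and \<open>w'\<close> the next iterate.\<close>

definition picard_step :: "(real^'n) set \<Rightarrow> real \<Rightarrow> ((real^'n \<Rightarrow> real^'n) \<Rightarrow> real) \<Rightarrow>
    (real^'n \<Rightarrow> real^'n) \<Rightarrow> (real^'n \<Rightarrow> real^'n) \<Rightarrow> bool" where
  "picard_step \<Omega> \<nu> f w uh \<longleftrightarrow> uh \<in> V_space \<Omega> \<and>
     (\<forall>v\<in>V_space \<Omega>. \<nu> * L2_inner \<Omega> (wgrad \<Omega> uh) (wgrad \<Omega> v) + bstar \<Omega> w uh v = f v)"

definition newton_step :: "(real^'n) set \<Rightarrow> real \<Rightarrow> ((real^'n \<Rightarrow> real^'n) \<Rightarrow> real) \<Rightarrow>
    (real^'n \<Rightarrow> real^'n) \<Rightarrow> (real^'n \<Rightarrow> real^'n) \<Rightarrow> bool" where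
  "newton_step \<Omega> \<nu> f uh w' \<longleftrightarrow> w' \<in> V_space \<Omega> \<and>
     (\<forall>v\<in>V_space \<Omega>. \<nu> * L2_inner \<Omega> (wgrad \<Omega> w') (wgrad \<Omega> v)
        + bstar \<Omega> uh w' v + bstar \<Omega> w' uh v - bstar \<Omega> uh uh v = f v)"

definition picard_newton_sequence :: "(real^'n) set \<Rightarrow> real \<Rightarrow> ((real^'n \<Rightarrow> real^'n) \<Rightarrow> real) \<Rightarrow>
    (real^'n \<Rightarrow> real^'n) \<Rightarrow> (nat \<Rightarrow> real^'n \<Rightarrow> real^'n) \<Rightarrow> bool" where
  "picard_newton_sequence \<Omega> \<nu> f u0 us \<longleftrightarrow> us 0 = u0 \<and>
     (\<forall>k. \<exists>uh. picard_step \<Omega> \<nu> f (us k) uh \<and> newton_step \<Omega> \<nu> f uh (us (Suc k)))"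

end

theory Submission
  imports Defs "HOL-Library.Function_Algebras"
begin

text \<open>
  The convergence argument takes place in the space \<open>V\<close> of solenoidal fields with inner product
  \<open>(\<nabla>v, \<nabla>w)\<close>, and it uses only four properties of the data: \<open>V\<close> is complete, \<open>b*\<close> is
  trilinear, \<open>b*\<close> is bounded with constant \<open>M\<close>, and \<open>b*(u, v, v) = 0\<close>. Write
  \<open>F\<close> for the dual norm of \<open>f\<close>, so that \<open>\<alpha> = M F / \<nu>\<^sup>2 < 1\<close>. Testing the Picard equation with
  its own solution \<open>uh\<close> gives \<open>\<nu> |\<nabla>uh| \<le> F\<close>, hence \<open>M |\<nabla>uh| \<le> \<nu> \<alpha>\<close>. Therefore the bilinear
  form of the Newton step is coercive with constant \<open>\<nu> (1 - \<alpha>)\<close>, and both steps are solvable by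
  the Lax-Milgram lemma. With \<open>d = u - u\<^sub>k\<close>, \<open>e = u - uh\<close> and \<open>E = u - u\<^sub>k\<^sub>+\<^sub>1\<close>, subtracting
  the equations leaves

    \<open>\<nu> (\<nabla>e, \<nabla>v) + b*(d, u, v) + b*(u\<^sub>k, e, v) = 0\<close>,

    \<open>\<nu> (\<nabla>E, \<nabla>v) + b*(e, e, v) + b*(uh, E, v) + b*(E, uh, v) = 0\<close>.

  The choices \<open>v = e\<close> and \<open>v = E\<close> yield \<open>|\<nabla>e| \<le> \<alpha> |\<nabla>d|\<close> and
  \<open>\<nu> (1 - \<alpha>) |\<nabla>E| \<le> M |\<nabla>e|\<^sup>2\<close>, which is the quadratic estimate; if \<open>C |\<nabla>d| \<le> 1/2\<close> the error
  is at least halved, and convergence follows. This is \<open>Picard_Newton\<close>.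

  The remaining work is to derive the four properties from the definitions by representatives.
  The weak gradient, chosen by Hilbert's operator, is linear almost everywhere because it is unique
  (\<open>weak_grad_unique\<close>); this rests on the fundamental lemma of the calculus of variations, for
  which smooth bumps are built from \<open>exp (- 1 / t)\<close>. Completeness of \<open>V\<close> (\<open>semi_hilbert_V\<close>)
  combines the completeness of the space of square integrable functions, the closedness of the weak
  gradient and the Poincare inequality. Since the integral of a non-integrable function is \<open>0\<close>,
  trilinearity of \<open>b*\<close> (\<open>bstar_linear\<close>) demands that the products under the integral be integrable,
  that is, that velocity fields have integrable fourth powers. This is where the dimension enters:
  the \<open>Ladyzhenskaya\<close> inequality bounds the fourth powers of test functions, and Fatou's lemma
  carries the bound to limits (\<open>X_space_L4\<close>). Finally \<open>b*(u, v, v) = 0\<close> holds when \<open>v\<close> is a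
  test field, by using its squared components as test functions in the definition of the weak
  gradient of \<open>u\<close>, and extends to all \<open>v\<close> by density and boundedness (\<open>bstar_skew\<close>).
\<close>

section \<open>Semi-inner product spaces and the Lax-Milgram lemma\<close>

text \<open>Linearity is relative to a carrier because the forms below are built from weak gradients, which
  mean nothing outside the Sobolev space.\<close>

definition linear_form :: "'v::real_vector set \<Rightarrow> ('v \<Rightarrow> real) \<Rightarrow> bool" where
  "linear_form V g \<longleftrightarrow>
     (\<forall>v\<in>V. \<forall>w\<in>V. g (v + w) = g v + g w) \<and> (\<forall>v\<in>V. \<forall>c. g (c *\<^sub>R v) = c * g v)"

lemma linear_form_add: "linear_form V g \<Longrightarrow> v \<in> V \<Longrightarrow> w \<in> V \<Longrightarrow> g (v + w) = g v + g w"
  and linear_form_scale: "linear_form V g \<Longrightarrow> v \<in> V \<Longrightarrow> g (c *\<^sub>R v) = c * g v"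
  by (auto simp: linear_form_def)

lemma linear_form_minus:
  assumes "linear_form V g" "v \<in> V"
  shows "g (- v) = - g v"
  using linear_form_scale[OF assms, of "-1"] by simp

lemma linear_form_diff:
  assumes "linear_form V g" "subspace V" "v \<in> V" "w \<in> V"
  shows "g (v - w) = g v - g w"
proof -
  have "g (v + - w) = g v + g (- w)"
    using assms by (intro linear_form_add) (auto simp: subspace_neg)
  then show ?thesis using linear_form_minus[OF assms(1,4)] by simp
qed

text \<open>Testing an equation with its own solution bounds the square of a norm by a multiple of the norm;
  this divides by the norm, which may vanish.\<close>

lemma cancel_quadratic:
  fixes x y z :: real
  assumes "x * y\<^sup>2 \<le> x * z * y" "0 < x" "0 \<le> y" "0 \<le> z"
  shows "y \<le> z"
  using assms by (cases "y = 0") (auto simp: power2_eq_square)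

text \<open>The first-order condition at a minimum: evaluate at \<open>t = - q / (p + 1)\<close>, where the positive
  denominator also covers \<open>p = 0\<close>.\<close>

lemma nonneg_quadratic_imp:
  fixes p q :: real
  assumes "0 \<le> p" "\<And>t. 0 \<le> t\<^sup>2 * p + 2 * t * q"
  shows "q = 0"
proof (rule ccontr)
  assume "q \<noteq> 0"
  have "0 \<le> (- q / (p + 1))\<^sup>2 * p + 2 * (- q / (p + 1)) * q" by (rule assms)
  also have "\<dots> = - (q\<^sup>2 * (p + 2) / (p + 1)\<^sup>2)"
    using assms(1) by (simp add: divide_simps power2_eq_square) (simp add: algebra_simps)
  also have "\<dots> < 0" using \<open>q \<noteq> 0\<close> assms(1) by simp
  finally show False by simp
qed

text \<open>Vectors are representatives of functions, so distinct vectors may have distance \<open>0\<close>: the form is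
  only semidefinite, and limits are not unique.\<close>

locale semi_inner =
  fixes V :: "'v::real_vector set" and ip :: "'v \<Rightarrow> 'v \<Rightarrow> real"
  assumes subspace: "subspace V"
    and ip_linear: "w \<in> V \<Longrightarrow> linear_form V (\<lambda>u. ip u w)"
    and ip_commute: "u \<in> V \<Longrightarrow> v \<in> V \<Longrightarrow> ip u v = ip v u"
    and ip_nonneg: "u \<in> V \<Longrightarrow> 0 \<le> ip u u"
begin

definition nrm :: "'v \<Rightarrow> real" where "nrm v = sqrt (ip v v)"

lemma zero_mem [simp, intro]: "0 \<in> V"
  and add_mem [simp, intro]: "u \<in> V \<Longrightarrow> v \<in> V \<Longrightarrow> u + v \<in> V"
  and diff_mem [simp, intro]: "u \<in> V \<Longrightarrow> v \<in> V \<Longrightarrow> u - v \<in> V"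
  and scale_mem [simp, intro]: "u \<in> V \<Longrightarrow> c *\<^sub>R u \<in> V"
  using subspace by (auto simp: subspace_0 subspace_add subspace_diff subspace_scale)

lemma ip_linear_right: "w \<in> V \<Longrightarrow> linear_form V (\<lambda>u. ip w u)"
  using ip_linear ip_commute by (auto simp: linear_form_def)

lemmas ip_simps =
  linear_form_add[OF ip_linear] linear_form_add[OF ip_linear_right]
  linear_form_scale[OF ip_linear] linear_form_scale[OF ip_linear_right]
  linear_form_diff[OF ip_linear subspace] linear_form_diff[OF ip_linear_right subspace]

lemma nrm_nonneg [simp]: "u \<in> V \<Longrightarrow> 0 \<le> nrm u"
  by (simp add: nrm_def ip_nonneg)

lemma nrm_sq: "u \<in> V \<Longrightarrow> (nrm u)\<^sup>2 = ip u u"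
  by (simp add: nrm_def ip_nonneg)

lemma nrm_scale: "u \<in> V \<Longrightarrow> nrm (c *\<^sub>R u) = \<bar>c\<bar> * nrm u"
  by (simp add: nrm_def ip_simps real_sqrt_mult flip: mult.assoc)

lemma nrm_zero [simp]: "nrm 0 = 0"
  using nrm_scale[OF zero_mem, of 0] by simp

lemma nrm_minus_commute: "u \<in> V \<Longrightarrow> v \<in> V \<Longrightarrow> nrm (u - v) = nrm (v - u)"
  using nrm_scale[of "u - v" "-1"] by simp

text \<open>The usual discriminant argument, with the case of a vector of length \<open>0\<close> treated separately.\<close>

lemma Cauchy_Schwarz:
  assumes u: "u \<in> V" and v: "v \<in> V"
  shows "\<bar>ip u v\<bar> \<le> nrm u * nrm v"
proof -
  have expand: "0 \<le> t\<^sup>2 * ip v v + 2 * t * ip u v + ip u u" for t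
  proof -
    have "0 \<le> ip (u + t *\<^sub>R v) (u + t *\<^sub>R v)" using u v by (intro ip_nonneg) auto
    also have "\<dots> = t\<^sup>2 * ip v v + 2 * t * ip u v + ip u u"
      using u v ip_commute[of v u]
      by (simp add: ip_simps algebra_simps power2_eq_square)
    finally show ?thesis .
  qed
  have "(ip u v)\<^sup>2 \<le> ip u u * ip v v"
  proof (cases "ip v v = 0")
    case True
    have "ip u v = 0"
    proof (rule ccontr)
      assume n: "ip u v \<noteq> 0"
      have "0 \<le> 2 * (- (ip u u + 1) / (2 * ip u v)) * ip u v + ip u u"
        using expand[of "- (ip u u + 1) / (2 * ip u v)"] True by simp
      then show False using n by (simp add: field_simps)
    qed
    then show ?thesis using True by simp
  next
    case False
    then have pos: "0 < ip v v" using ip_nonneg[OF v] by simp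
    have "0 \<le> (- ip u v / ip v v)\<^sup>2 * ip v v + 2 * (- ip u v / ip v v) * ip u v + ip u u"
      by (rule expand)
    also have "\<dots> = ip u u - (ip u v)\<^sup>2 / ip v v"
      using pos by (simp add: field_simps power2_eq_square)
    finally show ?thesis using pos by (simp add: field_simps)
  qed
  then have "sqrt ((ip u v)\<^sup>2) \<le> sqrt (ip u u * ip v v)" by (rule real_sqrt_le_mono)
  then show ?thesis by (simp add: nrm_def real_sqrt_mult)
qed

lemma nrm_triangle:
  assumes u: "u \<in> V" and v: "v \<in> V"
  shows "nrm (u + v) \<le> nrm u + nrm v"
proof (rule power2_le_imp_le)
  have "(nrm (u + v))\<^sup>2 = (nrm u)\<^sup>2 + 2 * ip u v + (nrm v)\<^sup>2"
    using u v ip_commute[of v u] by (simp add: nrm_sq ip_simps)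
  also have "\<dots> \<le> (nrm u + nrm v)\<^sup>2"
    using Cauchy_Schwarz[OF u v] by (simp add: power2_sum)
  finally show "(nrm (u + v))\<^sup>2 \<le> (nrm u + nrm v)\<^sup>2" .
qed (use u v in simp)

lemma nrm_triangle_diff:
  assumes "u \<in> V" "v \<in> V" "w \<in> V"
  shows "nrm (u - w) \<le> nrm (u - v) + nrm (v - w)"
  using nrm_triangle[of "u - v" "v - w"] assms by simp

lemma nrm_diff_le:
  assumes "u \<in> V" "v \<in> V"
  shows "\<bar>nrm u - nrm v\<bar> \<le> nrm (u - v)"
  using nrm_triangle[of "u - v" v] nrm_triangle[of "v - u" u] assms nrm_minus_commute[of u v]
  by simp

lemma parallelogram:
  assumes "u \<in> V" "v \<in> V"
  shows "(nrm (u + v))\<^sup>2 + (nrm (u - v))\<^sup>2 = 2 * (nrm u)\<^sup>2 + 2 * (nrm v)\<^sup>2"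
  using assms by (simp add: nrm_sq ip_simps)

lemma linear_form_tendsto:
  assumes g: "linear_form V g" "\<And>v. v \<in> V \<Longrightarrow> \<bar>g v\<bar> \<le> K * nrm v"
    and s: "\<And>n. s n \<in> V" "l \<in> V" "(\<lambda>n. nrm (s n - l)) \<longlonglongrightarrow> 0"
  shows "(\<lambda>n. g (s n)) \<longlonglongrightarrow> g l"
proof -
  have "(\<lambda>n. g (s n) - g l) \<longlonglongrightarrow> 0"
  proof (rule Lim_null_comparison)
    show "\<forall>\<^sub>F n in sequentially. norm (g (s n) - g l) \<le> K * nrm (s n - l)"
      using g(2)[of "s n - l" for n] s linear_form_diff[OF g(1) subspace s(1) s(2)] by simp
    show "(\<lambda>n. K * nrm (s n - l)) \<longlonglongrightarrow> 0"
      using tendsto_mult_right_zero[OF s(3)] .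
  qed
  then show ?thesis by (simp add: LIM_zero_iff)
qed

lemma ip_tendsto:
  assumes "\<And>n. s n \<in> V" "l \<in> V" "(\<lambda>n. nrm (s n - l)) \<longlonglongrightarrow> 0" "w \<in> V"
  shows "(\<lambda>n. ip (s n) w) \<longlonglongrightarrow> ip l w"
proof (rule linear_form_tendsto[OF ip_linear[OF assms(4)] _ assms(1-3)])
  show "\<bar>ip v w\<bar> \<le> nrm w * nrm v" if "v \<in> V" for v
    using Cauchy_Schwarz[OF that assms(4)] by (simp add: mult.commute)
qed

lemma nrm_tendsto:
  assumes "\<And>n. s n \<in> V" "l \<in> V" "(\<lambda>n. nrm (s n - l)) \<longlonglongrightarrow> 0"
  shows "(\<lambda>n. nrm (s n)) \<longlonglongrightarrow> nrm l"
proof -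
  have "(\<lambda>n. nrm (s n) - nrm l) \<longlonglongrightarrow> 0"
    by (rule Lim_null_comparison[OF _ assms(3)]) (simp add: nrm_diff_le assms)
  then show ?thesis by (simp add: LIM_zero_iff)
qed

end

locale semi_hilbert = semi_inner +
  assumes complete: "(\<And>n. s n \<in> V) \<Longrightarrow>
      (\<And>e. e > 0 \<Longrightarrow> \<exists>N::nat. \<forall>m\<ge>N. \<forall>n\<ge>N. nrm (s m - s n) < e) \<Longrightarrow>
      \<exists>l\<in>V. (\<lambda>n. nrm (s n - l)) \<longlonglongrightarrow> 0"
begin

text \<open>The representing vector minimises \<open>(nrm v)\<^sup>2 - 2 f v\<close>. The parallelogram law makes minimising
  sequences Cauchy.\<close>

lemma Riesz:
  assumes f: "linear_form V f" and bound: "\<And>v. v \<in> V \<Longrightarrow> \<bar>f v\<bar> \<le> K * nrm v"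
  obtains w where "w \<in> V" "\<And>v. v \<in> V \<Longrightarrow> ip w v = f v"
proof -
  define J where "J v = (nrm v)\<^sup>2 - 2 * f v" for v
  have below: "- K\<^sup>2 \<le> J v" if "v \<in> V" for v
  proof -
    have "0 \<le> (nrm v - K)\<^sup>2" by simp
    then show ?thesis using bound[OF that] unfolding J_def power2_diff by (simp add: mult.commute)
  qed
  define m where "m = Inf (J ` V)"
  have bdd: "bdd_below (J ` V)" using below by (intro bdd_belowI2)
  have m_le: "m \<le> J v" if "v \<in> V" for v
    unfolding m_def using bdd that by (intro cInf_lower) auto
  have "\<exists>v\<in>V. J v < m + 1 / real (Suc n)" for n
  proof -
    have ne: "J ` V \<noteq> {}" using zero_mem by blast
    have "Inf (J ` V) < m + 1 / real (Suc n)" unfolding m_def by simp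
    from cInf_lessD[OF ne this] show ?thesis by auto
  qed
  then obtain s where s: "\<And>n. s n \<in> V" and Js: "\<And>n. J (s n) < m + 1 / real (Suc n)"
    by metis
  have dist: "(nrm (s i - s j))\<^sup>2 \<le> 2 / real (Suc i) + 2 / real (Suc j)" for i j
  proof -
    let ?h = "(1/2) *\<^sub>R (s i + s j)"
    have "4 * (nrm ?h)\<^sup>2 = (nrm (s i + s j))\<^sup>2"
      using s by (simp add: nrm_scale power_mult_distrib power2_eq_square)
    moreover have "f ?h = (f (s i) + f (s j)) / 2"
      using s by (simp add: linear_form_scale[OF f] linear_form_add[OF f])
    ultimately have "(nrm (s i - s j))\<^sup>2 = 2 * J (s i) + 2 * J (s j) - 4 * J ?h"
      using parallelogram[OF s s, of i j] by (simp add: J_def)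
    moreover have "m \<le> J ?h" using s by (intro m_le) auto
    ultimately show ?thesis using Js[of i] Js[of j] by simp
  qed
  have "\<exists>N. \<forall>i\<ge>N. \<forall>j\<ge>N. nrm (s i - s j) < e" if "e > 0" for e
  proof -
    obtain N where N: "4 / e\<^sup>2 < real N" using reals_Archimedean2 by blast
    have "nrm (s i - s j) < e" if ij: "i \<ge> N" "j \<ge> N" for i j
    proof (rule power2_less_imp_less)
      have Npos: "0 < real N" using N \<open>e > 0\<close> by (smt (verit) divide_nonneg_nonneg zero_le_power2)
      have "2 / real (Suc k) \<le> 2 / real N" if "k \<ge> N" for k
        using that Npos by (intro divide_left_mono) auto
      from this[OF ij(1)] this[OF ij(2)] have "(nrm (s i - s j))\<^sup>2 \<le> 4 / real N"
        using dist[of i j] by simp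
      also have "\<dots> < e\<^sup>2" using N Npos \<open>e > 0\<close> by (simp add: field_simps)
      finally show "(nrm (s i - s j))\<^sup>2 < e\<^sup>2" .
    qed (use \<open>e > 0\<close> in simp)
    then show ?thesis by blast
  qed
  from complete[OF s this] obtain l where l: "l \<in> V" "(\<lambda>n. nrm (s n - l)) \<longlonglongrightarrow> 0"
    by blast
  have "(\<lambda>n. J (s n)) \<longlonglongrightarrow> J l" unfolding J_def
    by (intro tendsto_intros nrm_tendsto[OF s l] linear_form_tendsto[OF f bound s l]) auto
  moreover have "(\<lambda>n. m + 1 / real (Suc n)) \<longlonglongrightarrow> m + 0"
    using LIMSEQ_inverse_real_of_nat by (intro tendsto_intros) (simp add: inverse_eq_divide)
  ultimately have Jl: "J l \<le> m"
    using Js by (simp, intro LIMSEQ_le[of "\<lambda>n. J (s n)"]) (auto intro!: less_imp_le)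
  have "ip l v = f v" if v: "v \<in> V" for v
  proof -
    have "0 \<le> t\<^sup>2 * ip v v + 2 * t * (ip l v - f v)" for t
    proof -
      have "(nrm (l + t *\<^sub>R v))\<^sup>2 = ip (l + t *\<^sub>R v) (l + t *\<^sub>R v)"
        using l v by (intro nrm_sq) auto
      also have "\<dots> = (nrm l)\<^sup>2 + t\<^sup>2 * ip v v + 2 * t * ip l v"
        using l v ip_commute[OF l(1) v] unfolding nrm_sq[OF l(1)]
        by (simp add: ip_simps algebra_simps power2_eq_square)
      finally have "J (l + t *\<^sub>R v) = J l + t\<^sup>2 * ip v v + 2 * t * (ip l v - f v)"
        using l v by (simp add: J_def linear_form_add[OF f] linear_form_scale[OF f] algebra_simps)
      moreover have "m \<le> J (l + t *\<^sub>R v)" using l v by (intro m_le) auto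
      ultimately show ?thesis using Jl by simp
    qed
    from nonneg_quadratic_imp[OF ip_nonneg[OF v] this] show ?thesis by simp
  qed
  then show ?thesis using that l(1) by blast
qed

text \<open>The tail of the geometric series bounds the distance between any two members of the sequence.\<close>

lemma complete_geometric:
  assumes s: "\<And>n. s n \<in> V" and q: "0 \<le> q" "q < 1"
    and step: "\<And>n. nrm (s (Suc n) - s n) \<le> D * q ^ n"
  shows "\<exists>l\<in>V. (\<lambda>n. nrm (s n - l)) \<longlonglongrightarrow> 0"
proof (rule complete[OF s])
  have D: "0 \<le> D" using step[of 0] nrm_nonneg[of "s (Suc 0) - s 0"] s by fastforce
  have tail: "nrm (s (n + k) - s n) \<le> D * q ^ n * (1 - q ^ k) / (1 - q)" for n k
  proof (induction k)
    case (Suc k)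
    have "nrm (s (n + Suc k) - s n) \<le> nrm (s (Suc (n + k)) - s (n + k)) + nrm (s (n + k) - s n)"
      using nrm_triangle_diff[OF s s s] by simp
    also have "\<dots> \<le> D * q ^ (n + k) + D * q ^ n * (1 - q ^ k) / (1 - q)"
      using step Suc.IH by (intro add_mono) auto
    also have "\<dots> = D * q ^ n * (1 - q ^ Suc k) / (1 - q)"
      using q by (simp add: field_simps power_add)
    finally show ?case .
  qed simp
  have tail': "nrm (s m - s n) \<le> D * q ^ n / (1 - q)" if "n \<le> m" for m n
  proof -
    have "nrm (s m - s n) \<le> D * q ^ n * (1 - q ^ (m - n)) / (1 - q)"
      using tail[of n "m - n"] that by simp
    also have "\<dots> \<le> D * q ^ n * 1 / (1 - q)"
      using q D by (intro divide_right_mono mult_left_mono) auto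
    finally show ?thesis by simp
  qed
  fix e :: real assume e: "e > 0"
  have "(\<lambda>n. D * q ^ n / (1 - q)) \<longlonglongrightarrow> D * 0 / (1 - q)"
    using q by (intro tendsto_intros LIMSEQ_realpow_zero) auto
  then have "\<forall>\<^sub>F n in sequentially. D * q ^ n / (1 - q) < e" using e
    by (intro order_tendstoD) auto
  then obtain N where N: "\<And>n. n \<ge> N \<Longrightarrow> D * q ^ n / (1 - q) < e"
    by (auto simp: eventually_sequentially)
  have "nrm (s m - s n) < e" if "m \<ge> N" "n \<ge> N" for m n
  proof (cases "n \<le> m")
    case True
    then show ?thesis using tail'[of n m] N[of n] that by simp
  next
    case False
    then show ?thesis using tail'[of m n] N[of m] that nrm_minus_commute[OF s s, of m n] by simp
  qed
  then show "\<exists>N. \<forall>m\<ge>N. \<forall>n\<ge>N. nrm (s m - s n) < e" by blast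
qed

text \<open>Let \<open>T w\<close> represent the form \<open>a w\<close> and let \<open>g\<close> represent \<open>f\<close>. For \<open>\<rho> = c / L\<^sup>2\<close>, where \<open>L\<close>
  bounds \<open>a\<close>, the map \<open>w \<mapsto> w - \<rho> (T w - g)\<close> multiplies distances by at most
  \<open>q = sqrt (1 - (c / L)\<^sup>2) < 1\<close>, and a limit of its iterates satisfies \<open>T w = g\<close> up to a vector of
  length \<open>0\<close>.\<close>

lemma Lax_Milgram:
  assumes a_left: "\<And>v. v \<in> V \<Longrightarrow> linear_form V (\<lambda>w. a w v)"
    and a_right: "\<And>w. w \<in> V \<Longrightarrow> linear_form V (a w)"
    and a_bound: "\<And>w v. w \<in> V \<Longrightarrow> v \<in> V \<Longrightarrow> \<bar>a w v\<bar> \<le> K * nrm w * nrm v"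
    and coercive: "0 < c" "\<And>v. v \<in> V \<Longrightarrow> c * (nrm v)\<^sup>2 \<le> a v v"
    and f: "linear_form V f" "\<And>v. v \<in> V \<Longrightarrow> \<bar>f v\<bar> \<le> F * nrm v"
  shows "\<exists>w\<in>V. \<forall>v\<in>V. a w v = f v"
proof -
  \<comment> \<open>Enlarging the bound to at least \<open>c\<close> keeps \<open>1 - (c / L)\<^sup>2\<close> nonnegative.\<close>
  define L where "L = max \<bar>K\<bar> c"
  have L: "0 < L" "c \<le> L" using coercive(1) by (auto simp: L_def)
  have a_bound': "\<bar>a w v\<bar> \<le> L * nrm w * nrm v" if "w \<in> V" "v \<in> V" for w v
  proof -
    have "K * (nrm w * nrm v) \<le> L * (nrm w * nrm v)"
      using that by (intro mult_right_mono) (auto simp: L_def)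
    then show ?thesis using a_bound[OF that] by (simp add: mult.assoc)
  qed
  have "\<exists>t. t \<in> V \<and> (\<forall>v\<in>V. ip t v = a w v)" if "w \<in> V" for w
    using Riesz[OF a_right[OF that] a_bound'[OF that]] by metis
  then obtain T where T: "\<And>w. w \<in> V \<Longrightarrow> T w \<in> V"
    and ipT: "\<And>w v. w \<in> V \<Longrightarrow> v \<in> V \<Longrightarrow> ip (T w) v = a w v"
    by metis
  obtain g where g: "g \<in> V" and ipg: "\<And>v. v \<in> V \<Longrightarrow> ip g v = f v"
    using Riesz[OF f] by metis
  define \<rho> where "\<rho> = c / L\<^sup>2"
  define q where "q = sqrt (1 - (c / L)\<^sup>2)"
  have cL: "0 < c / L" "c / L \<le> 1" using L coercive(1) by auto
  have rat: "0 \<le> 1 - (c / L)\<^sup>2" using cL by (simp add: power_le_one)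
  have q: "0 \<le> q" "q < 1" "q\<^sup>2 = 1 - (c / L)\<^sup>2"
    using rat cL by (auto simp: q_def)
  define s where "s = rec_nat 0 (\<lambda>_ w. w - \<rho> *\<^sub>R (T w - g))"
  have s0: "s 0 = 0" and sSuc: "\<And>n. s (Suc n) = s n - \<rho> *\<^sub>R (T (s n) - g)"
    by (simp_all add: s_def)
  have s: "s n \<in> V" for n by (induction n) (auto simp: s0 sSuc T g)
  have contr: "nrm (s (Suc (Suc n)) - s (Suc n)) \<le> q * nrm (s (Suc n) - s n)" for n
  proof (rule power2_le_imp_le)
    define d where "d = s (Suc n) - s n"
    define e where "e = T (s (Suc n)) - T (s n)"
    have d: "d \<in> V" and e: "e \<in> V" by (auto simp: d_def e_def s T)
    have ipe: "ip e v = a d v" if "v \<in> V" for v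
      using that by (simp add: e_def d_def ip_simps T s ipT linear_form_diff[OF a_left subspace])
    have "1 * (nrm e)\<^sup>2 \<le> 1 * (L * nrm d) * nrm e"
      using a_bound'[OF d e] ipe[OF e] nrm_sq[OF e] by simp
    then have "nrm e \<le> L * nrm d"
      by (rule cancel_quadratic) (use L d e in simp_all)
    then have ne: "(nrm e)\<^sup>2 \<le> L\<^sup>2 * (nrm d)\<^sup>2"
      using power_mono[of "nrm e" "L * nrm d" 2] e by (simp add: power_mult_distrib)
    have "s (Suc (Suc n)) - s (Suc n) = d - \<rho> *\<^sub>R e"
      by (simp add: d_def e_def sSuc[of "Suc n"] sSuc[of n] algebra_simps)
    then have "(nrm (s (Suc (Suc n)) - s (Suc n)))\<^sup>2 = ip (d - \<rho> *\<^sub>R e) (d - \<rho> *\<^sub>R e)"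
      using d e by (simp add: nrm_sq)
    also have "\<dots> = (nrm d)\<^sup>2 - 2 * \<rho> * a d d + \<rho>\<^sup>2 * (nrm e)\<^sup>2"
      using d e ipe[OF d] ip_commute[OF d e] unfolding nrm_sq[OF d] nrm_sq[OF e]
      by (simp add: ip_simps algebra_simps power2_eq_square)
    also have "\<dots> \<le> (nrm d)\<^sup>2 - 2 * \<rho> * (c * (nrm d)\<^sup>2) + \<rho>\<^sup>2 * (L\<^sup>2 * (nrm d)\<^sup>2)"
      using coercive(2)[OF d] coercive(1) L ne
      by (intro add_mono diff_mono mult_left_mono) (auto simp: \<rho>_def)
    also have "\<dots> = (1 - (c / L)\<^sup>2) * (nrm d)\<^sup>2"
    proof -
      have "\<rho> * c = (c / L)\<^sup>2" "\<rho>\<^sup>2 * L\<^sup>2 = (c / L)\<^sup>2"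
        using L(1) by (simp_all add: \<rho>_def power2_eq_square)
      then have "2 * \<rho> * (c * x) = 2 * ((c / L)\<^sup>2 * x)" "\<rho>\<^sup>2 * (L\<^sup>2 * x) = (c / L)\<^sup>2 * x" for x
        by (metis mult.assoc)+
      then show ?thesis by (simp only: left_diff_distrib)
    qed
    also have "\<dots> = q\<^sup>2 * (nrm d)\<^sup>2" by (simp only: q(3))
    finally show "(nrm (s (Suc (Suc n)) - s (Suc n)))\<^sup>2 \<le> (q * nrm (s (Suc n) - s n))\<^sup>2"
      by (simp add: power_mult_distrib d_def)
  qed (use q s in simp)
  have "nrm (s (Suc n) - s n) \<le> nrm (s 1 - s 0) * q ^ n" for n
  proof (induction n)
    case (Suc n)
    have "nrm (s (Suc (Suc n)) - s (Suc n)) \<le> q * (nrm (s 1 - s 0) * q ^ n)"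
      using contr[of n] mult_left_mono[OF Suc.IH q(1)] by linarith
    then show ?case by (simp add: mult_ac)
  qed simp
  from complete_geometric[OF s q(1,2) this]
  obtain l where l: "l \<in> V" "(\<lambda>n. nrm (s n - l)) \<longlonglongrightarrow> 0" by blast
  have "a l v = f v" if v: "v \<in> V" for v
  proof -
    have lim_ip: "(\<lambda>n. ip (s n) v) \<longlonglongrightarrow> ip l v"
      by (rule ip_tendsto[OF s l v])
    have lim_a: "(\<lambda>n. a (s n) v) \<longlonglongrightarrow> a l v"
    proof (rule linear_form_tendsto[OF a_left[OF v] _ s l])
      show "\<bar>a w v\<bar> \<le> (L * nrm v) * nrm w" if "w \<in> V" for w
        using a_bound'[OF that v] by (simp add: mult_ac)
    qed
    have "(\<lambda>n. ip (s (Suc n)) v) \<longlonglongrightarrow> ip l v - \<rho> * (a l v - f v)"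
    proof -
      have eq: "ip (s (Suc n)) v = ip (s n) v - \<rho> * (a (s n) v - f v)" for n
        using s v g T by (simp add: sSuc ip_simps ipT ipg)
      show ?thesis unfolding eq by (intro tendsto_intros lim_ip lim_a)
    qed
    moreover have "(\<lambda>n. ip (s (Suc n)) v) \<longlonglongrightarrow> ip l v"
      using lim_ip by (rule LIMSEQ_Suc)
    ultimately have "ip l v - \<rho> * (a l v - f v) = ip l v"
      by (rule LIMSEQ_unique)
    then show ?thesis using L(1) coercive(1) by (simp add: \<rho>_def)
  qed
  then show ?thesis by (intro bexI[OF _ l(1)] ballI)
qed

section \<open>The Picard-Newton iteration in a Hilbert space\<close>

text \<open>Lax-Milgram provides one sequence of iterates. The estimates are proved for arbitrary solutions of
  the two steps, hence for every sequence that the iteration may generate; this matters because in a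
  semidefinite space the iterates are determined only up to vectors of length \<open>0\<close>.\<close>

theorem Picard_Newton:
  assumes b1: "\<And>v w. v \<in> V \<Longrightarrow> w \<in> V \<Longrightarrow> linear_form V (\<lambda>u. b u v w)"
    and b2: "\<And>v w. v \<in> V \<Longrightarrow> w \<in> V \<Longrightarrow> linear_form V (\<lambda>u. b v u w)"
    and b3: "\<And>v w. v \<in> V \<Longrightarrow> w \<in> V \<Longrightarrow> linear_form V (b v w)"
    and skew: "\<And>u v. u \<in> V \<Longrightarrow> v \<in> V \<Longrightarrow> b u v v = 0"
    and bound: "\<And>u v w. u \<in> V \<Longrightarrow> v \<in> V \<Longrightarrow> w \<in> V \<Longrightarrow>
      \<bar>b u v w\<bar> \<le> M * nrm u * nrm v * nrm w"
    and M: "0 \<le> M"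
    and f: "linear_form V f" "\<And>v. v \<in> V \<Longrightarrow> \<bar>f v\<bar> \<le> F * nrm v" "0 \<le> F"
    and nu: "0 < \<nu>"
    and small: "M * F / \<nu>\<^sup>2 < 1"
    and u: "u \<in> V" "\<And>v. v \<in> V \<Longrightarrow> \<nu> * ip u v + b u u v = f v"
  defines "picard \<equiv> \<lambda>w uh. uh \<in> V \<and> (\<forall>v\<in>V. \<nu> * ip uh v + b w uh v = f v)"
    and "newton \<equiv> \<lambda>uh w'. w' \<in> V \<and>
      (\<forall>v\<in>V. \<nu> * ip w' v + b uh w' v + b w' uh v - b uh uh v = f v)"
  shows "\<exists>r>0. \<exists>C\<ge>0. \<forall>u0\<in>V. nrm (u - u0) < r \<longrightarrow>
    (\<exists>us. us 0 = u0 \<and> (\<forall>k. \<exists>uh. picard (us k) uh \<and> newton uh (us (Suc k)))) \<and>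
    (\<forall>us. us 0 = u0 \<and> (\<forall>k. \<exists>uh. picard (us k) uh \<and> newton uh (us (Suc k))) \<longrightarrow>
      (\<lambda>k. nrm (u - us k)) \<longlonglongrightarrow> 0 \<and>
      (\<forall>k. nrm (u - us (Suc k)) \<le> C * (nrm (u - us k))\<^sup>2))"
proof -
  define \<alpha> where "\<alpha> = M * F / \<nu>\<^sup>2"
  have \<alpha>: "0 \<le> \<alpha>" "\<alpha> < 1" using M f(3) small by (auto simp: \<alpha>_def)
  \<comment> \<open>Picard contributes the factor \<open>\<alpha>\<^sup>2\<close>, Newton the factor \<open>M / (\<nu> (1 - \<alpha>))\<close>.\<close>
  define C where "C = M * \<alpha>\<^sup>2 / (\<nu> * (1 - \<alpha>))"
  have C: "0 \<le> C" using M nu \<alpha> by (auto simp: C_def)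
  have MF: "M * (F / \<nu>) = \<nu> * \<alpha>" using nu by (simp add: \<alpha>_def power2_eq_square)
  have b_le: "b x y z \<le> M * nrm x * nrm y * nrm z" if "x \<in> V" "y \<in> V" "z \<in> V" for x y z
    using bound[OF that] by simp
  \<comment> \<open>The energy estimate: the convection term disappears when the equation is tested with \<open>w\<close>.\<close>
  have energy: "nrm w \<le> F / \<nu>" if "w \<in> V" "x \<in> V" "\<nu> * ip w w + b x w w = f w" for w x
  proof (rule cancel_quadratic[OF _ nu])
    have "\<nu> * (nrm w)\<^sup>2 \<le> F * nrm w" using that skew f(2)[of w] by (simp add: nrm_sq)
    then show "\<nu> * (nrm w)\<^sup>2 \<le> \<nu> * (F / \<nu>) * nrm w" using nu by simp
  qed (use that f(3) nu in auto)
  have Mnrm: "M * nrm w \<le> \<nu> * \<alpha>" if "nrm w \<le> F / \<nu>" for w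
    using mult_left_mono[OF that M] MF by simp
  have u_le: "nrm u \<le> F / \<nu>" using energy[OF u(1) u(1)] u by auto
  have picard_le: "nrm uh \<le> F / \<nu>" if "w \<in> V" "picard w uh" for w uh
    using energy[of uh w] that by (auto simp: picard_def)
  have picard_ex: "\<exists>uh. picard w uh" if w: "w \<in> V" for w
  proof -
    have "\<exists>uh\<in>V. \<forall>v\<in>V. \<nu> * ip uh v + b w uh v = f v"
    proof (rule Lax_Milgram[of "\<lambda>x v. \<nu> * ip x v + b w x v" "\<nu> + M * nrm w" \<nu> f F])
      fix v assume v: "v \<in> V"
      show "linear_form V (\<lambda>x. \<nu> * ip x v + b w x v)"
        using ip_linear[OF v] b2[OF w v] by (auto simp: linear_form_def algebra_simps)
      show "linear_form V (\<lambda>x. \<nu> * ip v x + b w v x)"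
        using ip_linear_right[OF v] b3[OF w v] by (auto simp: linear_form_def algebra_simps)
      show "\<nu> * (nrm v)\<^sup>2 \<le> \<nu> * ip v v + b w v v" using v w by (simp add: skew nrm_sq)
      fix x assume x: "x \<in> V"
      have "\<bar>\<nu> * ip x v\<bar> \<le> \<nu> * (nrm x * nrm v)"
        using Cauchy_Schwarz[OF x v] nu by (simp add: abs_mult)
      then show "\<bar>\<nu> * ip x v + b w x v\<bar> \<le> (\<nu> + M * nrm w) * nrm x * nrm v"
        using bound[OF w x v] by (simp add: algebra_simps)
    qed (use f nu in auto)
    then show ?thesis by (auto simp: picard_def)
  qed
  have newton_ex: "\<exists>w'. newton uh w'" if uh: "uh \<in> V" "nrm uh \<le> F / \<nu>" for uh
  proof -
    have "\<exists>w'\<in>V. \<forall>v\<in>V. \<nu> * ip w' v + b uh w' v + b w' uh v = f v + b uh uh v"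
    proof (rule Lax_Milgram[of "\<lambda>x v. \<nu> * ip x v + b uh x v + b x uh v" "\<nu> + 2 * M * nrm uh"
          "\<nu> * (1 - \<alpha>)" "\<lambda>v. f v + b uh uh v" "F + M * nrm uh * nrm uh"])
      show "0 < \<nu> * (1 - \<alpha>)" using nu \<alpha> by simp
      show "linear_form V (\<lambda>v. f v + b uh uh v)"
        using f(1) b3[OF uh(1) uh(1)] by (auto simp: linear_form_def algebra_simps)
      fix v assume v: "v \<in> V"
      show "linear_form V (\<lambda>x. \<nu> * ip x v + b uh x v + b x uh v)"
        using ip_linear[OF v] b2[OF uh(1) v] b1[OF uh(1) v] by (auto simp: linear_form_def algebra_simps)
      show "linear_form V (\<lambda>x. \<nu> * ip v x + b uh v x + b v uh x)"
        using ip_linear_right[OF v] b3[OF uh(1) v] b3[OF v uh(1)]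
        by (auto simp: linear_form_def algebra_simps)
      show "\<bar>f v + b uh uh v\<bar> \<le> (F + M * nrm uh * nrm uh) * nrm v"
        using f(2)[OF v] bound[OF uh(1) uh(1) v] by (simp add: algebra_simps)
      have "\<bar>b v uh v\<bar> \<le> (M * nrm uh) * (nrm v)\<^sup>2"
        using bound[OF v uh(1) v] by (simp add: algebra_simps power2_eq_square)
      also have "\<dots> \<le> \<nu> * \<alpha> * (nrm v)\<^sup>2" using Mnrm[OF uh(2)] by (intro mult_right_mono) auto
      finally show "\<nu> * (1 - \<alpha>) * (nrm v)\<^sup>2 \<le> \<nu> * ip v v + b uh v v + b v uh v"
        using v uh skew by (simp add: nrm_sq[symmetric] algebra_simps)
      fix x assume x: "x \<in> V"
      have "\<bar>\<nu> * ip x v\<bar> \<le> \<nu> * (nrm x * nrm v)"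
        using Cauchy_Schwarz[OF x v] nu by (simp add: abs_mult)
      then show "\<bar>\<nu> * ip x v + b uh x v + b x uh v\<bar> \<le> (\<nu> + 2 * M * nrm uh) * nrm x * nrm v"
        using bound[OF uh(1) x v] bound[OF x uh(1) v] by (simp add: algebra_simps)
    qed
    then show ?thesis by (auto simp: newton_def)
  qed
  have step: "nrm (u - w') \<le> C * (nrm (u - w))\<^sup>2"
    if w: "w \<in> V" and P: "picard w uh" and N: "newton uh w'" for w uh w'
  proof -
    have uh: "uh \<in> V" and w': "w' \<in> V" using P N by (auto simp: picard_def newton_def)
    define e where "e = u - uh"
    define E where "E = u - w'"
    define d where "d = u - w"
    have V: "e \<in> V" "E \<in> V" "d \<in> V" using u(1) uh w' w by (auto simp: e_def E_def d_def)
    have pic: "\<nu> * ip uh v + b w uh v = f v" if "v \<in> V" for v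
      using P that by (auto simp: picard_def)
    have newt: "\<nu> * ip w' v + b uh w' v + b w' uh v - b uh uh v = f v" if "v \<in> V" for v
      using N that by (auto simp: newton_def)
    have eqe: "\<nu> * ip e v + b d u v + b w e v = 0" if v: "v \<in> V" for v
    proof -
      have "b d u v = b u u v - b w u v" unfolding d_def
        by (rule linear_form_diff[OF b1 subspace]) (use u w v in auto)
      moreover have "b w e v = b w u v - b w uh v" unfolding e_def
        by (rule linear_form_diff[OF b2 subspace]) (use u w v uh in auto)
      moreover have "\<nu> * ip e v = \<nu> * ip u v - \<nu> * ip uh v"
        using u uh v by (simp add: e_def ip_simps algebra_simps)
      ultimately show ?thesis using u(2)[OF v] pic[OF v] by linarith
    qed
    have e_le: "nrm e \<le> \<alpha> * nrm d"
    proof (rule cancel_quadratic[OF _ nu])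
      have "\<nu> * (nrm e)\<^sup>2 = - b d u e" using eqe[of e] V w skew by (simp add: nrm_sq)
      also have "\<dots> \<le> (M * nrm u) * (nrm d * nrm e)" using bound[OF V(3) u(1) V(1)] by (simp add: mult_ac)
      also have "\<dots> \<le> (\<nu> * \<alpha>) * (nrm d * nrm e)" using V by (intro mult_right_mono Mnrm u_le) auto
      finally show "\<nu> * (nrm e)\<^sup>2 \<le> \<nu> * (\<alpha> * nrm d) * nrm e" by (simp add: mult_ac)
    qed (use V \<alpha> in auto)
    have eqE: "\<nu> * ip E v + b e e v + b uh E v + b E uh v = 0" if v: "v \<in> V" for v
    proof -
      have 1: "b e x v = b u x v - b uh x v" if "x \<in> V" for x unfolding e_def
        by (rule linear_form_diff[OF b1 subspace]) (use u v uh that in auto)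
      have 2: "b x e v = b x u v - b x uh v" if "x \<in> V" for x unfolding e_def
        by (rule linear_form_diff[OF b2 subspace]) (use u v uh that in auto)
      have 3: "b uh E v = b uh u v - b uh w' v" unfolding E_def
        by (rule linear_form_diff[OF b2 subspace]) (use u v uh w' in auto)
      have 4: "b E uh v = b u uh v - b w' uh v" unfolding E_def
        by (rule linear_form_diff[OF b1 subspace]) (use u v uh w' in auto)
      have "b e e v = b u u v - b uh u v - (b u uh v - b uh uh v)"
        using 1 2 V u uh by simp
      moreover have "\<nu> * ip E v = \<nu> * ip u v - \<nu> * ip w' v"
        using u w' v by (simp add: E_def ip_simps algebra_simps)
      ultimately show ?thesis using 3 4 u(2)[OF v] newt[OF v] by linarith
    qed
    have c: "0 < \<nu> * (1 - \<alpha>)" using nu \<alpha> by simp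
    have "nrm E \<le> M * (nrm e)\<^sup>2 / (\<nu> * (1 - \<alpha>))"
    proof (rule cancel_quadratic[OF _ c])
      have "\<nu> * (nrm E)\<^sup>2 = - b e e E - b E uh E" using eqE[of E] V uh skew by (simp add: nrm_sq)
      also have "\<dots> \<le> M * (nrm e)\<^sup>2 * nrm E + (M * nrm uh) * (nrm E)\<^sup>2"
        using bound[OF V(1,1,2)] bound[OF V(2) uh V(2)] by (simp add: mult_ac power2_eq_square)
      also have "(M * nrm uh) * (nrm E)\<^sup>2 \<le> \<nu> * \<alpha> * (nrm E)\<^sup>2"
        by (intro mult_right_mono Mnrm picard_le[OF w P]) auto
      finally have "\<nu> * (1 - \<alpha>) * (nrm E)\<^sup>2 \<le> M * (nrm e)\<^sup>2 * nrm E"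
        by (simp add: algebra_simps)
      also have "M * (nrm e)\<^sup>2 = \<nu> * (1 - \<alpha>) * (M * (nrm e)\<^sup>2 / (\<nu> * (1 - \<alpha>)))"
        using c by (metis less_irrefl nonzero_mult_div_cancel_left times_divide_eq_right)
      finally show "\<nu> * (1 - \<alpha>) * (nrm E)\<^sup>2
          \<le> \<nu> * (1 - \<alpha>) * (M * (nrm e)\<^sup>2 / (\<nu> * (1 - \<alpha>))) * nrm E" .
      show "0 \<le> nrm E" using V by simp
      show "0 \<le> M * (nrm e)\<^sup>2 / (\<nu> * (1 - \<alpha>))" using c M by (intro divide_nonneg_pos mult_nonneg_nonneg) auto
    qed
    also have "\<dots> \<le> M * (\<alpha> * nrm d)\<^sup>2 / (\<nu> * (1 - \<alpha>))"
    proof -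
      have "(nrm e)\<^sup>2 \<le> (\<alpha> * nrm d)\<^sup>2" using e_le V by (intro power_mono) auto
      then show ?thesis using c M by (intro divide_right_mono mult_left_mono) auto
    qed
    finally show ?thesis by (simp add: E_def d_def C_def power_mult_distrib)
  qed
  \<comment> \<open>The summand \<open>1\<close> keeps the radius finite when \<open>C = 0\<close>.\<close>
  define r where "r = 1 / (2 * C + 1)"
  have r: "0 < r" "C * r \<le> 1 / 2" using C by (auto simp: r_def field_simps)
  show ?thesis
  proof (rule exI[of _ r], rule conjI[OF r(1)], rule exI[of _ C], rule conjI[OF C],
      intro ballI impI conjI allI)
    fix u0 assume u0: "u0 \<in> V" "nrm (u - u0) < r"
    have "\<exists>w'. w' \<in> V \<and> (\<exists>uh. picard w uh \<and> newton uh w')" if "w \<in> V" for w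
    proof -
      obtain uh where uh: "picard w uh" using picard_ex[OF \<open>w \<in> V\<close>] by blast
      then have "uh \<in> V" by (simp add: picard_def)
      then obtain w' where "newton uh w'" using newton_ex picard_le[OF \<open>w \<in> V\<close> uh] by blast
      then show ?thesis using uh by (auto simp: newton_def)
    qed
    then obtain nxt where nxt: "\<And>w. w \<in> V \<Longrightarrow> nxt w \<in> V"
      "\<And>w. w \<in> V \<Longrightarrow> \<exists>uh. picard w uh \<and> newton uh (nxt w)" by metis
    define us where "us = rec_nat u0 (\<lambda>_. nxt)"
    have us: "us 0 = u0" "us (Suc k) = nxt (us k)" for k by (simp_all add: us_def)
    have "us k \<in> V" for k by (induction k) (auto simp: us u0 nxt)
    then show "\<exists>us. us 0 = u0 \<and> (\<forall>k. \<exists>uh. picard (us k) uh \<and> newton uh (us (Suc k)))"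
      using us nxt(2) by metis
  next
    fix u0 us k
    assume u0: "u0 \<in> V" "nrm (u - u0) < r"
      and us: "us 0 = u0 \<and> (\<forall>k. \<exists>uh. picard (us k) uh \<and> newton uh (us (Suc k)))"
    have usV: "us k \<in> V" for k
    proof (cases k)
      case (Suc j)
      then obtain uh where "newton uh (us k)" using us by blast
      then show ?thesis by (simp add: newton_def)
    qed (use us u0 in simp)
    have quad: "nrm (u - us (Suc k)) \<le> C * (nrm (u - us k))\<^sup>2" for k
      using us step[OF usV] by blast
    then show "nrm (u - us (Suc k)) \<le> C * (nrm (u - us k))\<^sup>2" .
    have half: "nrm (u - us k) \<le> r * (1 / 2) ^ k" for k
    proof (induction k)
      case (Suc k)
      have nn: "0 \<le> nrm (u - us k)" using u usV by auto
      have "(1 / 2 :: real) ^ k \<le> 1" by (simp add: power_le_one)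
      then have "nrm (u - us k) \<le> r"
        using Suc.IH r(1) by (smt (verit) mult_left_le)
      then have "C * nrm (u - us k) \<le> 1 / 2" using r(2) C by (smt (verit) mult_left_mono)
      then have "C * nrm (u - us k) * nrm (u - us k) \<le> 1 / 2 * (r * (1 / 2) ^ k)"
        using Suc.IH nn by (intro mult_mono) auto
      then show ?case using quad[of k] by (simp add: power2_eq_square mult_ac)
    qed (use us u0 in simp)
    have "(\<lambda>k. r * (1 / 2) ^ k) \<longlonglongrightarrow> r * 0"
      by (intro tendsto_intros LIMSEQ_realpow_zero) auto
    then have lim: "(\<lambda>k. r * (1 / 2) ^ k) \<longlonglongrightarrow> 0" by simp
    show "(\<lambda>k. nrm (u - us k)) \<longlonglongrightarrow> 0"
    proof (rule Lim_null_comparison[OF _ lim])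
      show "\<forall>\<^sub>F k in sequentially. norm (nrm (u - us k)) \<le> r * (1 / 2) ^ k"
        using half u(1) usV by (intro always_eventually) simp
    qed
  qed
qed

end

section \<open>The space of square integrable functions\<close>

text \<open>Pointwise scalar multiplication turns functions into a real vector space, so that the abstract
  results apply to function spaces directly.\<close>

instantiation "fun" :: (type, scaleR) scaleR
begin
definition scaleR_fun_def: "c *\<^sub>R g = (\<lambda>x. c *\<^sub>R g x)"
instance ..
end

instance "fun" :: (type, real_vector) real_vector
  by standard (auto simp: fun_eq_iff scaleR_fun_def algebra_simps)

lemma scaleR_fun_apply [simp]: "(c *\<^sub>R g) x = c *\<^sub>R g x"
  by (simp add: scaleR_fun_def)

lemma L2_space_measurable: "g \<in> L2_space \<Omega> \<Longrightarrow> g \<in> borel_measurable (lebesgue_on \<Omega>)"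
  and L2_space_integrable_sq: "g \<in> L2_space \<Omega> \<Longrightarrow> integrable (lebesgue_on \<Omega>) (\<lambda>x. (norm (g x))\<^sup>2)"
  by (auto simp: L2_space_def)

lemma L2_space_dominated:
  fixes h :: "real^'n \<Rightarrow> 'c::euclidean_space"
  assumes "h \<in> borel_measurable (lebesgue_on \<Omega>)" "integrable (lebesgue_on \<Omega>) k"
    and "AE x in lebesgue_on \<Omega>. (norm (h x))\<^sup>2 \<le> k x"
  shows "h \<in> L2_space \<Omega>"
  unfolding L2_space_def using assms
  by (auto intro!: Bochner_Integration.integrable_bound[OF assms(2)])

lemma L2_inner_integrable:
  fixes g h :: "real^'n \<Rightarrow> 'b::euclidean_space"
  assumes "g \<in> L2_space \<Omega>" "h \<in> L2_space \<Omega>"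
  shows "integrable (lebesgue_on \<Omega>) (\<lambda>x. g x \<bullet> h x)"
proof (rule Bochner_Integration.integrable_bound)
  show "integrable (lebesgue_on \<Omega>) (\<lambda>x. (norm (g x))\<^sup>2 + (norm (h x))\<^sup>2)"
    using assms by (intro Bochner_Integration.integrable_add L2_space_integrable_sq)
  have "norm (a \<bullet> b) \<le> (norm a)\<^sup>2 + (norm b)\<^sup>2" for a b :: 'b
  proof -
    have "norm (a \<bullet> b) \<le> norm a * norm b" by (simp add: Cauchy_Schwarz_ineq2)
    moreover have "2 * (norm a * norm b) \<le> (norm a)\<^sup>2 + (norm b)\<^sup>2"
      using sum_squares_bound[of "norm a" "norm b"] by (simp add: mult.assoc)
    moreover have "0 \<le> norm a * norm b" by simp
    ultimately show ?thesis by linarith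
  qed
  then show "AE x in lebesgue_on \<Omega>. norm (g x \<bullet> h x) \<le> norm ((norm (g x))\<^sup>2 + (norm (h x))\<^sup>2)"
    by (intro AE_I2) (simp add: abs_of_nonneg)
qed (use assms[THEN L2_space_measurable] in measurable)

lemma subspace_L2_space: "subspace (L2_space \<Omega> :: (real^'n \<Rightarrow> 'b::euclidean_space) set)"
proof (rule subspaceI)
  show "0 \<in> L2_space \<Omega>" by (simp add: L2_space_def zero_fun_def)
  show "c *\<^sub>R g \<in> L2_space \<Omega>" if "g \<in> L2_space \<Omega>" for c g
    using that by (auto simp: L2_space_def scaleR_fun_def power_mult_distrib)
  show "g + h \<in> L2_space \<Omega>" if g: "g \<in> L2_space \<Omega>" and h: "h \<in> L2_space \<Omega>"
    for g h :: "real^'n \<Rightarrow> 'b"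
  proof (rule L2_space_dominated)
    show "g + h \<in> borel_measurable (lebesgue_on \<Omega>)"
      using g h unfolding plus_fun_def by (auto simp: L2_space_def)
    show "integrable (lebesgue_on \<Omega>) (\<lambda>x. 2 * (norm (g x))\<^sup>2 + 2 * (norm (h x))\<^sup>2)"
      using g h by (auto simp: L2_space_def)
    have "(norm (a + b))\<^sup>2 \<le> 2 * (norm a)\<^sup>2 + 2 * (norm b)\<^sup>2" for a b :: 'b
      using power_mono[OF norm_triangle_ineq[of a b], of 2] sum_squares_bound[of "norm a" "norm b"]
      by (simp add: power2_sum)
    then show "AE x in lebesgue_on \<Omega>. (norm ((g + h) x))\<^sup>2 \<le> 2 * (norm (g x))\<^sup>2 + 2 * (norm (h x))\<^sup>2"
      unfolding plus_fun_apply by (intro AE_I2)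
  qed
qed

lemma semi_inner_L2:
  "semi_inner (L2_space \<Omega> :: (real^'n \<Rightarrow> 'b::euclidean_space) set) (L2_inner \<Omega>)"
proof (standard, rule subspace_L2_space)
    fix g h :: "real^'n \<Rightarrow> 'b" assume gh: "g \<in> L2_space \<Omega>" 
    show "linear_form (L2_space \<Omega>) (\<lambda>u. L2_inner \<Omega> u g)"
      using gh by (auto simp: linear_form_def L2_inner_def inner_add_left L2_inner_integrable)
    show "L2_inner \<Omega> g h = L2_inner \<Omega> h g"
      by (simp add: L2_inner_def inner_commute)
    show "0 \<le> L2_inner \<Omega> g g"
      by (simp add: L2_inner_def)
  qed

interpretation L2: semi_inner "L2_space \<Omega> :: (real^'n \<Rightarrow> 'b::euclidean_space) set" "L2_inner \<Omega>"
  rewrites "semi_inner.nrm (L2_inner \<Omega> :: (real^'n \<Rightarrow> 'b) \<Rightarrow> _) = L2_norm \<Omega>"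
  for \<Omega> :: "(real^'n) set"
  by (rule semi_inner_L2) (simp add: fun_eq_iff semi_inner.nrm_def[OF semi_inner_L2] L2_norm_def)

lemma L2_norm_sq_nn_integral:
  assumes "g \<in> L2_space \<Omega>"
  shows "(\<integral>\<^sup>+x. ennreal ((norm (g x))\<^sup>2) \<partial>lebesgue_on \<Omega>) = ennreal ((L2_norm \<Omega> g)\<^sup>2)"
  using assms by (subst nn_integral_eq_integral)
    (auto simp: L2_space_def L2.nrm_sq L2_inner_def power2_norm_eq_inner)

lemma L2_space_nn_integral:
  assumes "g \<in> borel_measurable (lebesgue_on \<Omega>)"
    and "(\<integral>\<^sup>+x. ennreal ((norm (g x))\<^sup>2) \<partial>lebesgue_on \<Omega>) \<le> ennreal B" "0 \<le> B"
  shows "g \<in> L2_space \<Omega>" "(L2_norm \<Omega> g)\<^sup>2 \<le> B"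
proof -
  show g: "g \<in> L2_space \<Omega>"
    using assms le_less_trans[OF assms(2) ennreal_less_top] unfolding L2_space_def
    by (auto intro!: integrableI_bounded)
  show "(L2_norm \<Omega> g)\<^sup>2 \<le> B"
    using L2_norm_sq_nn_integral[OF g] assms by simp
qed

lemma L2_inner_cong_AE:
  assumes "g \<in> L2_space \<Omega>" "h \<in> L2_space \<Omega>" "g' \<in> L2_space \<Omega>" "h' \<in> L2_space \<Omega>"
    and "AE x in lebesgue_on \<Omega>. g x = g' x" "AE x in lebesgue_on \<Omega>. h x = h' x"
  shows "L2_inner \<Omega> g h = L2_inner \<Omega> g' h'"
  unfolding L2_inner_def
  by (intro integral_cong_AE borel_measurable_inner L2_space_measurable assms)
     (use assms(5,6) in eventually_elim, simp)

text \<open>Convergence in the mean of order two is convergence of the squared distances in the mean, and the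
  latter has an almost everywhere convergent subsequence.\<close>

lemma L2_AE_subseq:
  assumes s: "\<And>n. s n \<in> L2_space \<Omega>" "l \<in> L2_space \<Omega>" "(\<lambda>n. L2_norm \<Omega> (s n - l)) \<longlonglongrightarrow> 0"
  obtains r :: "nat \<Rightarrow> nat" where "strict_mono r"
    "AE x in lebesgue_on \<Omega>. (\<lambda>n. s (r n) x) \<longlonglongrightarrow> l x"
proof -
  have d: "s n - l \<in> L2_space \<Omega>" for n using s by auto
  have "(\<lambda>n. (L2_norm \<Omega> (s n - l))\<^sup>2) \<longlonglongrightarrow> 0\<^sup>2" by (intro tendsto_intros s)
  moreover have "(L2_norm \<Omega> (s n - l))\<^sup>2 = (\<integral>x. norm ((norm ((s n - l) x))\<^sup>2) \<partial>lebesgue_on \<Omega>)" for n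
    using d[of n] by (simp add: L2.nrm_sq L2_inner_def power2_norm_eq_inner del: minus_apply)
  ultimately have "\<exists>r::nat \<Rightarrow> nat. strict_mono r \<and>
      (AE x in lebesgue_on \<Omega>. (\<lambda>n. (norm ((s (r n) - l) x))\<^sup>2) \<longlonglongrightarrow> 0)"
    using d by (intro tendsto_L1_AE_subseq) (auto simp: L2_space_def simp del: minus_apply)
  then obtain r where r: "strict_mono r"
    "AE x in lebesgue_on \<Omega>. (\<lambda>n. (norm ((s (r n) - l) x))\<^sup>2) \<longlonglongrightarrow> 0" by blast
  have "AE x in lebesgue_on \<Omega>. (\<lambda>n. s (r n) x) \<longlonglongrightarrow> l x"
    using r(2)
  proof eventually_elim
    fix x assume "(\<lambda>n. (norm ((s (r n) - l) x))\<^sup>2) \<longlonglongrightarrow> 0"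
    from tendsto_real_sqrt[OF this] have "(\<lambda>n. norm (s (r n) x - l x)) \<longlonglongrightarrow> 0" by simp
    then show "(\<lambda>n. s (r n) x) \<longlonglongrightarrow> l x"
      by (rule LIM_zero_cancel[OF tendsto_norm_zero_cancel])
  qed
  then show ?thesis using that r(1) by blast
qed

text \<open>Riesz-Fischer. Along a subsequence whose successive distances are below \<open>4\<close> to the power \<open>-k\<close>,
  the integral of \<open>\<Sum>\<^sub>k 4\<^sup>k D\<^sub>k\<close> is finite, where \<open>D\<^sub>k\<close> is the squared pointwise step. So almost
  everywhere the steps are at most a constant times \<open>2\<close> to the power \<open>-k\<close>, and the subsequence
  converges there. Fatou's lemma estimates the distance to the pointwise limit.\<close>

lemma L2_complete:
  fixes s :: "nat \<Rightarrow> real^'n \<Rightarrow> 'b::euclidean_space"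
  assumes s: "\<And>n. s n \<in> L2_space \<Omega>"
    and cauchy: "\<And>e. e > 0 \<Longrightarrow> \<exists>N::nat. \<forall>m\<ge>N. \<forall>n\<ge>N. L2_norm \<Omega> (s m - s n) < e"
  obtains l where "l \<in> L2_space \<Omega>" "(\<lambda>n. L2_norm \<Omega> (s n - l)) \<longlonglongrightarrow> 0"
proof -
  have meas [measurable]: "s n \<in> borel_measurable (lebesgue_on \<Omega>)" for n
    by (rule L2_space_measurable[OF s])
  have "\<exists>N. \<forall>m\<ge>N. \<forall>n\<ge>N. L2_norm \<Omega> (s m - s n) < (1/4) ^ k" for k
    by (rule cauchy) simp
  then obtain N where N: "\<And>k m n. N k \<le> m \<Longrightarrow> N k \<le> n \<Longrightarrow> L2_norm \<Omega> (s m - s n) < (1/4) ^ k"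
    by metis
  \<comment> \<open>The sum makes \<open>p\<close> exceed the thresholds needed for both members of a step, and the summand \<open>k\<close> sends it to infinity.\<close>
  define p where "p k = k + (\<Sum>i\<le>k. N i)" for k
  have p: "N k \<le> p k" "N k \<le> p (Suc k)" "k \<le> p k" for k
    using member_le_sum[of k "{..k}" N] by (auto simp: p_def)
  define D where "D k x = (norm (s (p (Suc k)) x - s (p k) x))\<^sup>2" for k x
  have D_meas [measurable]: "D k \<in> borel_measurable (lebesgue_on \<Omega>)" for k
    unfolding D_def by measurable
  have intD: "(\<integral>\<^sup>+x. ennreal (D k x) \<partial>lebesgue_on \<Omega>) \<le> ennreal ((1/16) ^ k)" for k
  proof -
    have "(\<integral>\<^sup>+x. ennreal (D k x) \<partial>lebesgue_on \<Omega>) = ennreal ((L2_norm \<Omega> (s (p (Suc k)) - s (p k)))\<^sup>2)"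
      using L2_norm_sq_nn_integral[of "s (p (Suc k)) - s (p k)" \<Omega>] s by (simp add: D_def L2.diff_mem)
    also have "\<dots> \<le> ennreal (((1/4) ^ k)\<^sup>2)"
      using N[OF p(2) p(1)] L2.nrm_nonneg[OF L2.diff_mem[OF s s]]
      by (intro ennreal_leI power_mono) (auto intro: less_imp_le)
    also have "((1/4::real) ^ k)\<^sup>2 = (1/16) ^ k"
      by (simp add: power_divide power2_eq_square flip: power_mult_distrib)
    finally show ?thesis .
  qed
  have "(\<integral>\<^sup>+x. (\<Sum>k. ennreal (4 ^ k * D k x)) \<partial>lebesgue_on \<Omega>)
      = (\<Sum>k. \<integral>\<^sup>+x. ennreal (4 ^ k * D k x) \<partial>lebesgue_on \<Omega>)"
    by (intro nn_integral_suminf) measurable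
  also have "\<dots> \<le> (\<Sum>k. ennreal ((1/4) ^ k))"
  proof (intro suminf_le allI)
    fix k
    have "(\<integral>\<^sup>+x. ennreal (4 ^ k * D k x) \<partial>lebesgue_on \<Omega>)
        = ennreal (4 ^ k) * (\<integral>\<^sup>+x. ennreal (D k x) \<partial>lebesgue_on \<Omega>)"
      by (subst nn_integral_cmult[symmetric]) (auto simp: D_def ennreal_mult)
    also have "\<dots> \<le> ennreal (4 ^ k) * ennreal ((1/16) ^ k)"
      by (intro mult_left_mono intD) simp
    also have "\<dots> = ennreal ((1/4) ^ k)"
      by (simp add: ennreal_mult[symmetric] flip: power_mult_distrib)
    finally show "(\<integral>\<^sup>+x. ennreal (4 ^ k * D k x) \<partial>lebesgue_on \<Omega>) \<le> ennreal ((1/4) ^ k)" .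
  qed auto
  also have "\<dots> = ennreal (\<Sum>k. (1/4) ^ k)"
    by (intro suminf_ennreal2) (auto intro: summable_geometric)
  finally have "(\<integral>\<^sup>+x. (\<Sum>k. ennreal (4 ^ k * D k x)) \<partial>lebesgue_on \<Omega>) \<noteq> \<infinity>"
    using le_less_trans[OF _ ennreal_less_top] by fastforce
  then have AE_fin: "AE x in lebesgue_on \<Omega>. (\<Sum>k. ennreal (4 ^ k * D k x)) \<noteq> \<infinity>"
    by (intro nn_integral_PInf_AE) auto
  have AE_conv: "AE x in lebesgue_on \<Omega>. convergent (\<lambda>k. s (p k) x)"
    using AE_fin
  proof eventually_elim
    fix x assume "(\<Sum>k. ennreal (4 ^ k * D k x)) \<noteq> \<infinity>"
    then have "summable (\<lambda>k. 4 ^ k * D k x)"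
      by (intro summable_suminf_not_top) (auto simp: D_def)
    then have "(\<lambda>k. 4 ^ k * D k x) \<longlonglongrightarrow> 0" by (rule summable_LIMSEQ_zero)
    then have "Bseq (\<lambda>k. 4 ^ k * D k x)" using convergentI convergent_imp_Bseq by blast
    then obtain B where B: "0 < B" "\<And>k. norm (4 ^ k * D k x) \<le> B" by (auto elim: BseqE)
    have step: "norm (s (p (Suc k)) x - s (p k) x) \<le> sqrt B * (1/2) ^ k" for k
    proof -
      have "D k x \<le> B * (1/4) ^ k"
        using B(2)[of k] by (simp add: D_def field_simps power_divide)
      from real_sqrt_le_mono[OF this] have
        "norm (s (p (Suc k)) x - s (p k) x) \<le> sqrt B * sqrt ((1/4) ^ k)"
        by (simp add: D_def real_sqrt_mult)
      also have "sqrt ((1/4) ^ k) = (1/2) ^ k"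
        by (simp add: real_sqrt_power real_sqrt_divide)
      finally show ?thesis .
    qed
    have "summable (\<lambda>k. s (p (Suc k)) x - s (p k) x)"
      by (rule summable_comparison_test[OF _ summable_mult[OF summable_geometric]])
         (use step in auto)
    then have "convergent (\<lambda>n. \<Sum>k<n. s (p (Suc k)) x - s (p k) x)"
      by (simp add: summable_iff_convergent)
    then have "convergent (\<lambda>n. (s (p n) x - s (p 0) x) + s (p 0) x)"
      by (subst (asm) sum_lessThan_telescope) (intro convergent_add convergent_const)
    then show "convergent (\<lambda>k. s (p k) x)" by simp
  qed
  define l where "l x = lim (\<lambda>k. s (p k) x)" for x
  have l_meas [measurable]: "l \<in> borel_measurable (lebesgue_on \<Omega>)"
    unfolding l_def by measurable
  have diff_meas: "s n - l \<in> borel_measurable (lebesgue_on \<Omega>)" for n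
    unfolding fun_diff_def by measurable
  have dist: "s n - l \<in> L2_space \<Omega> \<and> (L2_norm \<Omega> (s n - l))\<^sup>2 \<le> e\<^sup>2"
    if e: "e > 0" and n: "\<forall>m\<ge>K. L2_norm \<Omega> (s n - s m) < e" for n e K
  proof -
    have "(\<integral>\<^sup>+x. ennreal ((norm ((s n - l) x))\<^sup>2) \<partial>lebesgue_on \<Omega>)
        \<le> (\<integral>\<^sup>+x. liminf (\<lambda>k. ennreal ((norm ((s n - s (p k)) x))\<^sup>2)) \<partial>lebesgue_on \<Omega>)"
    proof (intro nn_integral_mono_AE, use AE_conv in eventually_elim)
      fix x assume "convergent (\<lambda>k. s (p k) x)"
      then have "(\<lambda>k. s (p k) x) \<longlonglongrightarrow> l x" by (simp add: l_def convergent_LIMSEQ_iff)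
      then have "(\<lambda>k. ennreal ((norm ((s n - s (p k)) x))\<^sup>2)) \<longlonglongrightarrow> ennreal ((norm ((s n - l) x))\<^sup>2)"
        unfolding minus_apply by (intro tendsto_intros)
      then show "ennreal ((norm ((s n - l) x))\<^sup>2) \<le> liminf (\<lambda>k. ennreal ((norm ((s n - s (p k)) x))\<^sup>2))"
        using lim_imp_Liminf[OF trivial_limit_sequentially] by (metis order_refl)
    qed
    also have "\<dots> \<le> liminf (\<lambda>k. \<integral>\<^sup>+x. ennreal ((norm ((s n - s (p k)) x))\<^sup>2) \<partial>lebesgue_on \<Omega>)"
      unfolding minus_apply by (intro nn_integral_liminf) measurable
    also have "\<dots> = liminf (\<lambda>k. ennreal ((L2_norm \<Omega> (s n - s (p k)))\<^sup>2))"
      using L2_norm_sq_nn_integral[OF L2.diff_mem[OF s s]] by (simp only:)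
    also have "\<dots> \<le> limsup (\<lambda>k. ennreal ((L2_norm \<Omega> (s n - s (p k)))\<^sup>2))"
      by (rule Liminf_le_Limsup) simp
    also have "\<dots> \<le> ennreal (e\<^sup>2)"
    proof (rule Limsup_bounded)
      have "ennreal ((L2_norm \<Omega> (s n - s (p k)))\<^sup>2) \<le> ennreal (e\<^sup>2)" if "K \<le> p k" for k
        using n that L2.nrm_nonneg[OF L2.diff_mem[OF s s], of n "p k"]
        by (intro ennreal_leI power_mono) (auto intro: less_imp_le)
      moreover have "\<forall>\<^sub>F k in sequentially. K \<le> p k"
        using p(3) by (auto simp: eventually_sequentially intro: le_trans)
      ultimately show "\<forall>\<^sub>F k in sequentially. ennreal ((L2_norm \<Omega> (s n - s (p k)))\<^sup>2) \<le> ennreal (e\<^sup>2)"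
        by (auto elim: eventually_mono)
    qed
    finally show ?thesis
      using L2_space_nn_integral[of "s n - l" \<Omega> "e\<^sup>2"] diff_meas by simp
  qed
  show ?thesis
  proof (rule that)
    obtain K where "\<forall>m\<ge>K. \<forall>n\<ge>K. L2_norm \<Omega> (s m - s n) < 1" using cauchy[of 1] by auto
    then have "s K - l \<in> L2_space \<Omega>" using dist[of 1 K K] by simp
    then have "s K - (s K - l) \<in> L2_space \<Omega>" by (rule L2.diff_mem[OF s])
    moreover have "s K - (s K - l) = l" by simp
    ultimately show "l \<in> L2_space \<Omega>" by (simp only:)
    show "(\<lambda>n. L2_norm \<Omega> (s n - l)) \<longlonglongrightarrow> 0"
    proof (rule LIMSEQ_I)
      fix r :: real assume "r > 0"
      then obtain K where K: "\<forall>m\<ge>K. \<forall>n\<ge>K. L2_norm \<Omega> (s m - s n) < r / 2"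
        using cauchy[of "r / 2"] by auto
      have "norm (L2_norm \<Omega> (s n - l) - 0) < r" if "n \<ge> K" for n
      proof -
        have d: "s n - l \<in> L2_space \<Omega>" "(L2_norm \<Omega> (s n - l))\<^sup>2 \<le> (r / 2)\<^sup>2"
          using dist[of "r / 2" K n] K that \<open>r > 0\<close> by auto
        then have "L2_norm \<Omega> (s n - l) \<le> r / 2" using \<open>r > 0\<close> by (intro power2_le_imp_le[OF d(2)]) simp
        then show ?thesis using L2.nrm_nonneg[OF d(1)] \<open>r > 0\<close> by simp
      qed
      then show "\<exists>no. \<forall>n\<ge>no. norm (L2_norm \<Omega> (s n - l) - 0) < r" by blast
    qed
  qed
qed


text \<open>Applied to projections onto components and matrix entries, and to the trace.\<close>

lemma L2_bounded_linear:
  fixes T :: "'b::euclidean_space \<Rightarrow> 'c::euclidean_space"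
  assumes g: "g \<in> L2_space \<Omega>" and T: "bounded_linear T" "\<And>y. norm (T y) \<le> K * norm y"
  shows "(\<lambda>x. T (g x)) \<in> L2_space \<Omega>" "L2_norm \<Omega> (\<lambda>x. T (g x)) \<le> K * L2_norm \<Omega> g"
proof -
  have K: "0 \<le> K"
    using T(2)[of "SOME i. i \<in> Basis"] norm_ge_zero[of "T (SOME i. i \<in> Basis)"]
    by (simp add: some_in_eq norm_Basis del: norm_ge_zero)
  have sq: "(norm (T (g x)))\<^sup>2 \<le> K\<^sup>2 * (norm (g x))\<^sup>2" for x
    using power_mono[OF T(2), of "g x" 2] by (simp add: power_mult_distrib)
  have meas: "(\<lambda>x. T (g x)) \<in> borel_measurable (lebesgue_on \<Omega>)"
    using borel_measurable_continuous_on[OF linear_continuous_on[OF T(1)] L2_space_measurable[OF g]]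
    by simp
  have int: "integrable (lebesgue_on \<Omega>) (\<lambda>x. K\<^sup>2 * (norm (g x))\<^sup>2)"
    using L2_space_integrable_sq[OF g] by simp
  show Tg: "(\<lambda>x. T (g x)) \<in> L2_space \<Omega>"
    by (rule L2_space_dominated[OF meas int]) (use sq in auto)
  have "(L2_norm \<Omega> (\<lambda>x. T (g x)))\<^sup>2 = (\<integral>x. (norm (T (g x)))\<^sup>2 \<partial>lebesgue_on \<Omega>)"
    using L2.nrm_sq[OF Tg] by (simp add: L2_inner_def power2_norm_eq_inner)
  also have "\<dots> \<le> (\<integral>x. K\<^sup>2 * (norm (g x))\<^sup>2 \<partial>lebesgue_on \<Omega>)"
    using sq L2_space_integrable_sq[OF Tg] int by (intro integral_mono) auto
  also have "\<dots> = (K * L2_norm \<Omega> g)\<^sup>2"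
    using L2.nrm_sq[OF g] by (simp add: L2_inner_def power2_norm_eq_inner power_mult_distrib)
  finally show "L2_norm \<Omega> (\<lambda>x. T (g x)) \<le> K * L2_norm \<Omega> g"
    by (rule power2_le_imp_le) (use K L2.nrm_nonneg[OF g] in simp)
qed

lemma vec_component_norm_le: "norm (y $ i) \<le> norm y" for y :: "'a::real_normed_vector^'m"
  unfolding norm_vec_def by (rule member_le_L2_set) simp_all

lemma L2_component:
  fixes v :: "real^'n \<Rightarrow> real^'m"
  assumes "v \<in> L2_space \<Omega>"
  shows "(\<lambda>x. v x $ i) \<in> L2_space \<Omega>"
  by (rule L2_bounded_linear(1)[OF assms bounded_linear_vec_nth, of _ 1])
    (simp only: mult_1 vec_component_norm_le)

lemma L2_entry:
  fixes G :: "real^'n \<Rightarrow> real^'m^'k"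
  assumes "G \<in> L2_space \<Omega>"
  shows "(\<lambda>x. G x $ i $ j) \<in> L2_space \<Omega>"
proof -
  have "(\<lambda>x. G x $ i) \<in> L2_space \<Omega>"
    by (rule L2_bounded_linear(1)[OF assms bounded_linear_vec_nth, of _ 1])
    (simp only: mult_1 vec_component_norm_le)
  then show ?thesis by (rule L2_component)
qed

lemma L2_space_vec:
  fixes v :: "real^'n \<Rightarrow> 'b::euclidean_space^'m"
  assumes "\<And>i. (\<lambda>x. v x $ i) \<in> L2_space \<Omega>"
  shows "v \<in> L2_space \<Omega>"
proof (rule L2_space_dominated)
  show "v \<in> borel_measurable (lebesgue_on \<Omega>)"
  proof (rule borel_measurable_euclidean_space[THEN iffD2], rule ballI)
    fix b :: "'b^'m" assume "b \<in> Basis"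
    then obtain i c where b: "b = axis i c" by (auto simp: Basis_vec_def)
    have "(\<lambda>x. v x $ i \<bullet> c) \<in> borel_measurable (lebesgue_on \<Omega>)"
      using L2_space_measurable[OF assms, of i] by measurable
    then show "(\<lambda>x. v x \<bullet> b) \<in> borel_measurable (lebesgue_on \<Omega>)"
      by (simp add: b inner_axis)
  qed
  show "integrable (lebesgue_on \<Omega>) (\<lambda>x. \<Sum>i\<in>UNIV. (norm (v x $ i))\<^sup>2)"
    using assms by (intro Bochner_Integration.integrable_sum) (auto intro: L2_space_integrable_sq)
qed (simp add: norm_vec_def L2_set_def sum_nonneg)

section \<open>Smooth functions and bumps on boxes\<close>

text \<open>Uniqueness of the Frechet derivative lets any derivative that has been found compute the partial
  derivatives.\<close>

lemma partial_deriv_eqI: "(g has_derivative D) (at x) \<Longrightarrow> partial_deriv j g x = D (axis j 1)"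
  unfolding partial_deriv_def using frechet_derivative_at by metis

lemma C_k_differentiable: "C_k (Suc k) g \<Longrightarrow> g differentiable (at x)"
  by (simp add: differentiable_on_def)

lemma has_partial_deriv: "g differentiable (at x) \<Longrightarrow> (g has_derivative frechet_derivative g (at x)) (at x)"
  using frechet_derivative_works by blast

lemma C_k_SucD: "C_k (Suc k) g \<Longrightarrow> C_k k g"
proof (induction k arbitrary: g)
  case 0
  then show ?case by (auto intro: differentiable_imp_continuous_on)
next
  case (Suc k)
  then show ?case by (metis C_k.simps(2))
qed

lemma C_k_const: "C_k k (\<lambda>x. c)"
proof (induction k arbitrary: c)
  case (Suc k)
  have "partial_deriv j (\<lambda>x. c) = (\<lambda>x. 0)" for j :: 'a
    by (rule ext, subst partial_deriv_eqI[of _ "\<lambda>_. 0"]) auto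
  then show ?case using Suc by simp
qed simp

lemma partial_deriv_add:
  assumes "g differentiable (at x)" "h differentiable (at x)"
  shows "partial_deriv j (\<lambda>x. g x + h x) x = partial_deriv j g x + partial_deriv j h x"
  by (subst partial_deriv_eqI[OF has_derivative_add[OF assms[THEN has_partial_deriv]]])
     (simp add: partial_deriv_def)

lemma partial_deriv_mult:
  assumes "g differentiable (at x)" "h differentiable (at x)"
  shows "partial_deriv j (\<lambda>x. g x * h x) x = g x * partial_deriv j h x + partial_deriv j g x * h x"
  by (subst partial_deriv_eqI[OF has_derivative_mult[OF assms[THEN has_partial_deriv]]])
     (simp add: partial_deriv_def)

lemma C_k_add: "C_k k g \<Longrightarrow> C_k k h \<Longrightarrow> C_k k (\<lambda>x. g x + h x)"
proof (induction k arbitrary: g h)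
  case 0
  then show ?case by (auto intro: continuous_intros)
next
  case (Suc k)
  have "partial_deriv j (\<lambda>x. g x + h x) = (\<lambda>x. partial_deriv j g x + partial_deriv j h x)" for j
    using Suc.prems by (intro ext partial_deriv_add C_k_differentiable)
  then show ?case using Suc by (auto intro!: Suc.IH simp: differentiable_on_def)
qed

lemma C_k_mult: "C_k k g \<Longrightarrow> C_k k h \<Longrightarrow> C_k k (\<lambda>x. g x * h x)"
proof (induction k arbitrary: g h)
  case 0
  then show ?case by (auto intro: continuous_intros)
next
  case (Suc k)
  have "partial_deriv j (\<lambda>x. g x * h x) = (\<lambda>x. g x * partial_deriv j h x + partial_deriv j g x * h x)" for j
    using Suc.prems by (intro ext partial_deriv_mult C_k_differentiable)
  moreover have "C_k k (\<lambda>x. g x * partial_deriv j h x + partial_deriv j g x * h x)" for j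
    using Suc.prems by (intro C_k_add Suc.IH C_k_SucD[OF Suc.prems(1)] C_k_SucD[OF Suc.prems(2)]) auto
  ultimately show ?case using Suc.prems by (auto simp: differentiable_on_def)
qed

lemma C_k_prod: "finite I \<Longrightarrow> (\<And>i. i \<in> I \<Longrightarrow> C_k k (g i)) \<Longrightarrow> C_k k (\<lambda>x. \<Prod>i\<in>I. g i x)"
  by (induction I rule: finite_induct) (auto intro: C_k_mult C_k_const)

text \<open>A function of one variable is given together with the sequence \<open>h\<close> of its derivatives, which
  makes the induction on \<open>k\<close> a shift of that sequence.\<close>

lemma C_k_compose_coordinate:
  fixes h :: "nat \<Rightarrow> real \<Rightarrow> real"
  assumes deriv: "\<And>m t. (h m has_real_derivative h (Suc m) t) (at t)"
  shows "C_k k (\<lambda>x::real^'n. h m (c * (x $ i - a)))"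
proof (induction k arbitrary: m)
  case 0
  have "continuous_on UNIV (h m)"
    using deriv by (intro DERIV_continuous_on) (auto simp: has_field_derivative_at_within)
  then have "continuous_on UNIV (\<lambda>x::real^'n. h m (c * (x $ i - a)))"
    by (rule continuous_on_compose2) (auto intro!: continuous_intros)
  then show ?case by simp
next
  case (Suc k)
  have der: "((\<lambda>x::real^'n. h m (c * (x $ i - a))) has_derivative
      (\<lambda>v. h (Suc m) (c * (x $ i - a)) * (c * (v $ i)))) (at x)" for x
  proof -
    have inner: "((\<lambda>x::real^'n. c * (x $ i - a)) has_derivative (\<lambda>v. c * (v $ i))) (at x)"
      by (auto intro!: derivative_eq_intros bounded_linear_imp_has_derivative bounded_linear_vec_nth)
    have outer: "(h m has_derivative (\<lambda>t. h (Suc m) (c * (x $ i - a)) * t)) (at (c * (x $ i - a)))"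
      using deriv has_field_derivative_def by blast
    show ?thesis using has_derivative_compose[OF inner outer] .
  qed
  have "partial_deriv j (\<lambda>x::real^'n. h m (c * (x $ i - a)))
      = (\<lambda>x. (c * (if i = j then 1 else 0)) * h (Suc m) (c * (x $ i - a)))" for j
    by (rule ext, subst partial_deriv_eqI[OF der]) (simp add: axis_def)
  moreover have "C_k k (\<lambda>x::real^'n. (c * (if i = j then 1 else 0)) * h (Suc m) (c * (x $ i - a)))" for j
    by (intro C_k_mult C_k_const Suc)
  moreover have "(\<lambda>x::real^'n. h m (c * (x $ i - a))) differentiable_on UNIV"
    using der by (auto simp: differentiable_on_def differentiable_def)
  ultimately show ?case by simp
qed

text \<open>The family \<open>p (1 / t) exp (- 1 / t)\<close>, flat at the origin, is closed under differentiation; this is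
  the standard source of smooth functions that vanish on a half line. The next definition is the
  effect of differentiation on the polynomial, read off from
  \<open>d/dt (p (1 / t) exp (- 1 / t)) = (p (1 / t) - p' (1 / t)) exp (- 1 / t) / t\<^sup>2\<close>.\<close>

definition exp_flat :: "real poly \<Rightarrow> real \<Rightarrow> real" where
  "exp_flat p t = (if t > 0 then poly p (1 / t) * exp (- 1 / t) else 0)"

definition exp_flat_deriv :: "real poly \<Rightarrow> real poly" where
  "exp_flat_deriv p = monom 1 2 * (p - pderiv p)"

lemma poly_exp_decay: "((\<lambda>s. poly p s * exp (- s)) \<longlongrightarrow> 0) at_top" for p :: "real poly"
proof -
  have "((\<lambda>s. \<Sum>i\<le>degree p. coeff p i * (s ^ i / exp s)) \<longlongrightarrow> (\<Sum>i\<le>degree p. coeff p i * 0)) at_top"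
    by (intro tendsto_intros tendsto_power_div_exp_0)
  moreover have "(\<Sum>i\<le>degree p. coeff p i * (s ^ i / exp s)) = poly p s * exp (- s)" for s
    by (simp add: poly_altdef exp_minus divide_inverse sum_distrib_right mult.assoc)
  ultimately show ?thesis by simp
qed

text \<open>Only the origin needs an argument. From the right the difference quotient is
  \<open>s p (s) exp (- s)\<close> with \<open>s = 1 / t \<rightarrow> \<infinity>\<close>, which tends to \<open>0\<close>.\<close>

lemma exp_flat_has_derivative:
  "(exp_flat p has_real_derivative exp_flat (exp_flat_deriv p) t) (at t)"
proof (cases t "0::real" rule: linorder_cases)
  case less
  have "((\<lambda>_. 0) has_real_derivative 0) (at t)" by simp
  moreover have "\<forall>\<^sub>F x in nhds t. exp_flat p x = 0"
    using eventually_nhds_in_open[of "{..<0}" t] less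
    by (auto simp: exp_flat_def elim!: eventually_mono)
  ultimately have "(exp_flat p has_real_derivative 0) (at t)"
    by (subst DERIV_cong_ev[OF refl _ refl]) auto
  then show ?thesis using less by (simp add: exp_flat_def)
next
  case greater
  have "((\<lambda>t. poly p (1 / t) * exp (- 1 / t)) has_real_derivative
      exp_flat (exp_flat_deriv p) t) (at t)"
    using greater
    by (auto intro!: derivative_eq_intros DERIV_chain2[OF poly_DERIV]
        simp: exp_flat_def exp_flat_deriv_def poly_monom field_simps power2_eq_square)
  moreover have "\<forall>\<^sub>F x in nhds t. exp_flat p x = poly p (1 / x) * exp (- 1 / x)"
    using eventually_nhds_in_open[of "{0<..}" t] greater
    by (auto simp: exp_flat_def elim!: eventually_mono)
  ultimately show ?thesis
    by (subst DERIV_cong_ev[OF refl _ refl]) auto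
next
  case equal
  have right: "((\<lambda>y. exp_flat p y / y) \<longlongrightarrow> 0) (at_right 0)"
  proof -
    have "((\<lambda>y. poly (pCons 0 p) (inverse y) * exp (- inverse y)) \<longlongrightarrow> 0) (at_right (0::real))"
      by (rule filterlim_compose[OF poly_exp_decay filterlim_inverse_at_top_right])
    then show ?thesis
    proof (rule Lim_transform_eventually)
      show "\<forall>\<^sub>F y in at_right 0. poly (pCons 0 p) (inverse y) * exp (- inverse y) = exp_flat p y / y"
        by (auto simp: eventually_at_right_less exp_flat_def divide_inverse
            intro!: eventually_at_right_less[THEN eventually_mono])
    qed
  qed
  have left: "((\<lambda>y. exp_flat p y / y) \<longlongrightarrow> 0) (at_left 0)"
    by (rule Lim_transform_eventually[OF tendsto_const])
       (auto simp: eventually_at_filter exp_flat_def)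
  have "((\<lambda>y. exp_flat p y / y) \<longlongrightarrow> 0) (at 0)"
    using left right by (simp add: filterlim_at_split)
  then show ?thesis using equal
    by (simp add: has_field_derivative_iff exp_flat_def)
qed

lemma exp_flat_iterate_deriv:
  "(exp_flat ((exp_flat_deriv ^^ m) 1) has_real_derivative exp_flat ((exp_flat_deriv ^^ Suc m) 1) t) (at t)"
  using exp_flat_has_derivative by simp

text \<open>Scaling the argument by \<open>n\<close> pushes the values on the open box towards \<open>1\<close> while the support
  stays in the closed box.\<close>

definition box_bump :: "real^'n \<Rightarrow> real^'n \<Rightarrow> nat \<Rightarrow> real^'n \<Rightarrow> real" where
  "box_bump a b n x =
     (\<Prod>i\<in>UNIV. exp_flat 1 (real n * (x $ i - a $ i)) * exp_flat 1 (- real n * (x $ i - b $ i)))"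

lemma exp_flat_1_bounds: "0 \<le> exp_flat 1 t" "exp_flat 1 t \<le> 1" "exp_flat 1 t \<noteq> 0 \<longleftrightarrow> 0 < t"
  by (auto simp: exp_flat_def)

lemma box_bump_nonzero:
  assumes "box_bump a b n x \<noteq> 0"
  shows "x \<in> box a b"
proof -
  have "0 < real n * (x $ i - a $ i)" "0 < - real n * (x $ i - b $ i)" for i
    using assms by (auto simp: box_bump_def exp_flat_1_bounds(3))
  then have "0 < x $ i - a $ i" "0 < b $ i - x $ i" for i
    by (simp_all add: zero_less_mult_iff mult_less_0_iff)
  then show ?thesis by (auto simp: mem_box_cart)
qed

lemma box_bump_le_1: "\<bar>box_bump a b n x\<bar> \<le> 1"
  unfolding box_bump_def
  by (simp add: abs_prod abs_mult exp_flat_1_bounds, intro prod_le_1)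
     (auto simp: exp_flat_1_bounds intro!: mult_le_one)

lemma box_bump_tendsto: "(\<lambda>n. box_bump a b n x) \<longlonglongrightarrow> indicator (box a b) x"
proof (cases "x \<in> box a b")
  case True
  have lim: "(\<lambda>n. exp_flat 1 (real n * s)) \<longlonglongrightarrow> 1" if "s > 0" for s
  proof -
    have "(\<lambda>n. exp (- (1 / s) * (1 / real n))) \<longlonglongrightarrow> exp (- (1 / s) * 0)"
      using lim_1_over_n by (intro tendsto_intros) 
    then have "(\<lambda>n. exp (- (1 / s) * (1 / real n))) \<longlonglongrightarrow> 1" by simp
    then show ?thesis
      by (rule Lim_transform_eventually)
         (rule eventually_mono[OF eventually_gt_at_top[of 0]], use that in \<open>simp add: exp_flat_def\<close>)
  qed
  have "(\<lambda>n. box_bump a b n x) \<longlonglongrightarrow> (\<Prod>i\<in>(UNIV::'a set). 1 * 1)"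
    unfolding box_bump_def
  proof (intro tendsto_intros)
    fix i
    show "(\<lambda>n. exp_flat 1 (real n * (x $ i - a $ i))) \<longlonglongrightarrow> 1"
      using True by (intro lim) (simp add: mem_box_cart)
    have "(\<lambda>n. exp_flat 1 (real n * (b $ i - x $ i))) \<longlonglongrightarrow> 1"
      using True by (intro lim) (simp add: mem_box_cart)
    then show "(\<lambda>n. exp_flat 1 (- real n * (x $ i - b $ i))) \<longlonglongrightarrow> 1"
      by (simp add: algebra_simps)
  qed
  then show ?thesis using True by simp
next
  case False
  then have "box_bump a b n x = 0" for n using box_bump_nonzero by blast
  then show ?thesis using False by simp
qed

lemma box_bump_test_function:
  fixes a b :: "real^'n"
  assumes "cbox a b \<subseteq> \<Omega>"
  shows "box_bump a b n \<in> test_functions \<Omega>"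
proof -
  have sub: "closure {x. box_bump a b n x \<noteq> 0} \<subseteq> cbox a b"
    using box_bump_nonzero[of a b n] box_subset_cbox[of a b]
    by (intro closure_minimal) (auto simp: subset_eq)
  then have "compact (closure {x. box_bump a b n x \<noteq> 0})"
    using bounded_subset[OF bounded_cbox] by (auto simp: compact_eq_bounded_closed)
  moreover have "C_k k (box_bump a b n)" for k
  proof -
    have smooth: "C_k k (\<lambda>x::real^'n. exp_flat 1 (c * (x $ i - s)))" for c i s
      using C_k_compose_coordinate[where h = "\<lambda>m. exp_flat ((exp_flat_deriv ^^ m) 1)" and m = 0,
          OF exp_flat_iterate_deriv] by simp
    then show ?thesis unfolding box_bump_def by (intro C_k_prod C_k_mult finite)
  qed
  ultimately show ?thesis using sub assms by (auto simp: test_functions_def)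
qed

section \<open>Test functions and the fundamental lemma of the calculus of variations\<close>

lemma test_functionI:
  assumes "\<And>k. C_k k g" "compact K" "K \<subseteq> \<Omega>" "\<And>x. x \<notin> K \<Longrightarrow> g x = 0"
  shows "g \<in> test_functions \<Omega>"
proof -
  have sub: "closure {x. g x \<noteq> 0} \<subseteq> K"
    using assms by (intro closure_minimal) (auto intro: compact_imp_closed)
  then have "compact (closure {x. g x \<noteq> 0})"
    using bounded_subset[OF compact_imp_bounded[OF assms(2)]] by (auto simp: compact_eq_bounded_closed)
  then show ?thesis using assms sub by (auto simp: test_functions_def)
qed

lemma test_function_support:
  assumes "g \<in> test_functions \<Omega>"
  shows "compact (closure {x. g x \<noteq> 0})" "closure {x. g x \<noteq> 0} \<subseteq> \<Omega>"
    "x \<notin> closure {x. g x \<noteq> 0} \<Longrightarrow> g x = 0"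
  using assms closure_subset[of "{x. g x \<noteq> 0}"]
  by (auto simp: test_functions_def simp del: compact_closure)

lemma test_function_C_k: "g \<in> test_functions \<Omega> \<Longrightarrow> C_k k g"
  by (simp add: test_functions_def)

lemma test_function_differentiable: "g \<in> test_functions \<Omega> \<Longrightarrow> g differentiable (at x)"
  using test_function_C_k[of g \<Omega> "Suc 0"] by (rule C_k_differentiable)

lemma test_function_continuous: "g \<in> test_functions \<Omega> \<Longrightarrow> continuous_on UNIV g"
  using test_function_C_k[of g \<Omega> 0] by simp

lemma test_function_add:
  assumes g: "g \<in> test_functions \<Omega>" and h: "h \<in> test_functions \<Omega>"
  shows "(\<lambda>x. g x + h x) \<in> test_functions \<Omega>"
proof -
  define K where "K = closure {x. g x \<noteq> 0}"
  note K = test_function_support[OF g, folded K_def]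
  define L where "L = closure {x. h x \<noteq> 0}"
  note L = test_function_support[OF h, folded L_def]
  show ?thesis
  proof (rule test_functionI)
    show "C_k k (\<lambda>x. g x + h x)" for k
      by (intro C_k_add test_function_C_k[OF g] test_function_C_k[OF h])
    show "compact (K \<union> L)" "K \<union> L \<subseteq> \<Omega>" using K(1,2) L(1,2) by auto
    show "g x + h x = 0" if "x \<notin> K \<union> L" for x using K(3) L(3) that by auto
  qed
qed

lemma test_function_mult:
  assumes g: "g \<in> test_functions \<Omega>" and h: "\<And>k. C_k k h"
  shows "(\<lambda>x. h x * g x) \<in> test_functions \<Omega>"
proof -
  define K where "K = closure {x. g x \<noteq> 0}"
  note K = test_function_support[OF g, folded K_def]
  show ?thesis
  proof (rule test_functionI[OF _ K(1,2)])
    show "C_k k (\<lambda>x. h x * g x)" for k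
      by (intro C_k_mult test_function_C_k[OF g] h)
    show "h x * g x = 0" if "x \<notin> K" for x using K(3) that by auto
  qed
qed

text \<open>Off the support the function vanishes on a neighbourhood, so its derivatives vanish too.\<close>

lemma test_function_partial_deriv:
  assumes g: "g \<in> test_functions \<Omega>"
  shows "partial_deriv j g \<in> test_functions \<Omega>"
proof -
  define K where "K = closure {x. g x \<noteq> 0}"
  note K = test_function_support[OF g, folded K_def]
  show ?thesis
  proof (rule test_functionI[OF _ K(1,2)])
    show "C_k k (partial_deriv j g)" for k
      using test_function_C_k[OF g, of "Suc k"] by simp
    fix x assume "x \<notin> K"
    have "(g has_derivative (\<lambda>_. 0)) (at x)"
      by (rule has_derivative_transform_within_open[of "\<lambda>_. 0" _ _ _ "- K"])
         (use K \<open>x \<notin> K\<close> in \<open>auto simp: compact_imp_closed open_Compl\<close>)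
    then show "partial_deriv j g x = 0" by (subst partial_deriv_eqI) auto
  qed
qed

lemma test_function_integrable_lborel:
  assumes "g \<in> test_functions \<Omega>"
  shows "integrable lborel g"
proof -
  define K where "K = closure {x. g x \<noteq> 0}"
  note K = test_function_support[OF assms, folded K_def]
  have "integrable lborel (\<lambda>x. indicator K x *\<^sub>R g x)"
    using test_function_continuous[OF assms]
    by (intro borel_integrable_compact K(1)) (auto intro: continuous_on_subset)
  moreover have "(\<lambda>x. indicator K x *\<^sub>R g x) = g"
    using K(3) by (auto simp: fun_eq_iff indicator_def)
  ultimately show ?thesis by simp
qed

lemma test_function_bounded:
  assumes "g \<in> test_functions \<Omega>"
  obtains B where "\<And>x. \<bar>g x\<bar> \<le> B"
proof -
  define K where "K = closure {x. g x \<noteq> 0}"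
  note K = test_function_support[OF assms, folded K_def]
  have "bounded (g ` K)"
    using test_function_continuous[OF assms] K(1)
    by (intro compact_imp_bounded compact_continuous_image) (auto intro: continuous_on_subset)
  then obtain B where "\<And>x. x \<in> K \<Longrightarrow> \<bar>g x\<bar> \<le> B" by (auto simp: bounded_iff)
  then have "\<bar>g x\<bar> \<le> max B 0" for x
    using K(3)[of x] by (cases "x \<in> K") (auto simp: le_max_iff_disj)
  then show ?thesis using that by blast
qed

text \<open>For functions supported in the domain, integrals over the domain may be computed over the whole
  space with Borel sets, where translations and iterated integrals are available.\<close>

lemma lebesgue_on_supported:
  fixes h :: "real^'n \<Rightarrow> real"
  assumes "open \<Omega>" "h \<in> borel_measurable borel" "\<And>x. x \<notin> \<Omega> \<Longrightarrow> h x = 0"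
  shows "integrable (lebesgue_on \<Omega>) h \<longleftrightarrow> integrable lborel h"
    and "integral\<^sup>L (lebesgue_on \<Omega>) h = integral\<^sup>L lborel h"
    and "(\<integral>\<^sup>+x. ennreal (h x) \<partial>lebesgue_on \<Omega>) = (\<integral>\<^sup>+x. ennreal (h x) \<partial>lborel)"
proof -
  have \<Omega>: "\<Omega> \<in> sets lebesgue" using assms(1) by simp
  have eq: "(\<lambda>x. indicator \<Omega> x * h x) = h" "(\<lambda>x. ennreal (h x) * indicator \<Omega> x) = (\<lambda>x. ennreal (h x))"
    using assms(3) by (auto simp: fun_eq_iff indicator_def)
  have h: "h \<in> borel_measurable lborel" using assms(2) by simp
  show "integrable (lebesgue_on \<Omega>) h \<longleftrightarrow> integrable lborel h"
    using \<Omega> h by (simp add: integrable_restrict_space eq integrable_completion)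
  show "integral\<^sup>L (lebesgue_on \<Omega>) h = integral\<^sup>L lborel h"
    using \<Omega> h by (simp add: integral_restrict_space eq integral_completion)
  show "(\<integral>\<^sup>+x. ennreal (h x) \<partial>lebesgue_on \<Omega>) = (\<integral>\<^sup>+x. ennreal (h x) \<partial>lborel)"
    using \<Omega> h by (simp add: nn_integral_restrict_space eq nn_integral_completion)
qed

lemma test_function_borel: "g \<in> test_functions \<Omega> \<Longrightarrow> g \<in> borel_measurable borel"
  by (intro borel_measurable_continuous_onI test_function_continuous)

lemma test_function_eq_0: "g \<in> test_functions \<Omega> \<Longrightarrow> x \<notin> \<Omega> \<Longrightarrow> g x = 0"
  using test_function_support(2)[of g \<Omega>] test_function_support(3)[of g \<Omega> x] by auto

lemma test_function_integrable:
  assumes "open \<Omega>" "g \<in> test_functions \<Omega>"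
  shows "integrable (lebesgue_on \<Omega>) g"
  using lebesgue_on_supported(1)[OF assms(1) test_function_borel[OF assms(2)] test_function_eq_0[OF assms(2)]]
    test_function_integrable_lborel[OF assms(2)] by simp

lemma test_function_L2:
  assumes "open \<Omega>" "g \<in> test_functions \<Omega>"
  shows "g \<in> L2_space \<Omega>"
proof (rule L2_space_dominated)
  show "g \<in> borel_measurable (lebesgue_on \<Omega>)"
    using test_function_integrable[OF assms] by auto
  show "integrable (lebesgue_on \<Omega>) (\<lambda>x. g x * g x)"
    by (rule test_function_integrable[OF assms(1) test_function_mult[OF assms(2) test_function_C_k[OF assms(2)]]])
qed (simp add: power2_eq_square)

lemma partial_deriv_line:
  fixes g :: "real^'n \<Rightarrow> real"
  assumes "\<And>x. g differentiable (at x)"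
  shows "((\<lambda>t. g (x + t *\<^sub>R axis j 1)) has_real_derivative partial_deriv j g (x + t *\<^sub>R axis j 1)) (at t)"
proof -
  have inner: "((\<lambda>t. x + t *\<^sub>R axis j 1) has_derivative (\<lambda>s. s *\<^sub>R axis j (1::real))) (at t)"
    by (auto intro!: derivative_eq_intros)
  have "((\<lambda>t. g (x + t *\<^sub>R axis j 1)) has_derivative
      (\<lambda>s. frechet_derivative g (at (x + t *\<^sub>R axis j 1)) (s *\<^sub>R axis j 1))) (at t)"
    by (rule has_derivative_compose[OF inner has_partial_deriv[OF assms]])
  moreover have "frechet_derivative g (at y) (s *\<^sub>R axis j 1) = partial_deriv j g y * s" for s y
    using linear_scale[OF has_derivative_linear[OF has_partial_deriv[OF assms]]]
    by (simp add: partial_deriv_def)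
  ultimately show ?thesis by (simp add: has_field_derivative_def)
qed

text \<open>Difference quotients have integral \<open>0\<close> by translation invariance. They converge to the derivative,
  dominated by a multiple of the indicator of a ball: by the mean value theorem near the support, and
  because both values vanish farther than a unit step away from it.\<close>

lemma integral_partial_deriv_eq_0:
  fixes g :: "real^'n \<Rightarrow> real"
  assumes g: "g \<in> test_functions \<Omega>"
  shows "integral\<^sup>L lborel (partial_deriv j g) = 0"
proof -
  let ?e = "axis j 1 :: real^'n"
  define q where "q n x = real (Suc n) * (g (x + (1 / real (Suc n)) *\<^sub>R ?e) - g x)" for n x
  define K where "K = closure {x. g x \<noteq> 0}"
  note K = test_function_support[OF g, folded K_def]
  obtain R where R: "\<And>x. x \<in> K \<Longrightarrow> norm x \<le> R"
    using compact_imp_bounded[OF K(1)] by (auto simp: bounded_iff)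
  obtain B where B: "\<And>x. \<bar>partial_deriv j g x\<bar> \<le> B"
    using test_function_bounded[OF test_function_partial_deriv[OF g]] by metis
  note line = partial_deriv_line[OF test_function_differentiable[OF g]]
  note [measurable] = test_function_borel[OF g] test_function_borel[OF test_function_partial_deriv[OF g]]
  have q_bound: "norm (q n x) \<le> B * indicator (cball 0 (R + 1)) x" for n x
  proof (cases "x \<in> cball 0 (R + 1)")
    case True
    obtain z where "g (x + (1 / real (Suc n)) *\<^sub>R ?e) - g (x + 0 *\<^sub>R ?e)
        = (1 / real (Suc n) - 0) * partial_deriv j g (x + z *\<^sub>R ?e)"
      using MVT2[of 0 "1 / real (Suc n)" "\<lambda>t. g (x + t *\<^sub>R ?e)"] line by fastforce
    then have "q n x = partial_deriv j g (x + z *\<^sub>R ?e)" by (simp add: q_def)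
    then show ?thesis using B True by simp
  next
    case False
    define c where "c = (1 / real (Suc n)) *\<^sub>R ?e"
    have "norm c \<le> 1" by (simp add: c_def norm_axis_1)
    moreover have "R + 1 < norm x" using False by simp
    moreover have "norm x \<le> norm (x + c) + norm c" using norm_triangle_ineq4[of "x + c" c] by simp
    ultimately have "\<not> norm x \<le> R" "\<not> norm (x + c) \<le> R" using norm_ge_zero[of c] by linarith+
    then have "x \<notin> K" "x + c \<notin> K" using R by blast+
    then have "g x = 0" "g (x + c) = 0" using K(3) by auto
    then show ?thesis using False by (simp add: q_def c_def)
  qed
  have "(\<lambda>n. integral\<^sup>L lborel (q n)) \<longlonglongrightarrow> integral\<^sup>L lborel (partial_deriv j g)"
  proof (rule integral_dominated_convergence)
    show "partial_deriv j g \<in> borel_measurable lborel" by measurable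
    show "q n \<in> borel_measurable lborel" for n unfolding q_def by measurable
    show "integrable lborel (\<lambda>x. B * indicator (cball 0 (R + 1)) x)"
      by (intro integrable_mult_right integrable_real_indicator emeasure_bounded_finite bounded_cball) simp
    have "(\<lambda>n. q n x) \<longlonglongrightarrow> partial_deriv j g x" for x
    proof -
      have "((\<lambda>h. (g (x + (0 + h) *\<^sub>R ?e) - g (x + 0 *\<^sub>R ?e)) / h) \<longlongrightarrow> partial_deriv j g (x + 0 *\<^sub>R ?e)) (at 0)"
        using line[of x j 0] by (simp add: DERIV_def)
      moreover have "filterlim (\<lambda>n. 1 / real (Suc n)) (at 0) sequentially"
        using LIMSEQ_inverse_real_of_nat by (auto simp: filterlim_at inverse_eq_divide)
      ultimately have "(\<lambda>n. (g (x + (0 + 1 / real (Suc n)) *\<^sub>R ?e) - g (x + 0 *\<^sub>R ?e)) / (1 / real (Suc n)))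
          \<longlonglongrightarrow> partial_deriv j g (x + 0 *\<^sub>R ?e)"
        by (rule filterlim_compose)
      then show ?thesis by (simp add: q_def mult.commute)
    qed
    then show "AE x in lborel. (\<lambda>n. q n x) \<longlonglongrightarrow> partial_deriv j g x" by simp
    show "AE x in lborel. norm (q n x) \<le> B * indicator (cball 0 (R + 1)) x" for n
      using q_bound by simp
  qed
  moreover have "integral\<^sup>L lborel (q n) = 0" for n
  proof -
    define c where "c = (1 / real (Suc n)) *\<^sub>R ?e"
    have distr: "distr lborel borel (\<lambda>x. c + x) = lborel"
      by (rule lborel_distr_plus)
    have "integrable (distr lborel borel (\<lambda>x. c + x)) g" "integral\<^sup>L (distr lborel borel (\<lambda>x. c + x)) g = integral\<^sup>L lborel g"
      unfolding distr using test_function_integrable_lborel[OF g] by auto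
    then have "integrable lborel (\<lambda>x. g (x + c))" "(\<integral>x. g (x + c) \<partial>lborel) = integral\<^sup>L lborel g"
      by (simp_all add: integrable_distr_eq integral_distr add.commute)
    moreover have "q n = (\<lambda>x. real (Suc n) * (g (x + c) - g x))"
      by (simp add: fun_eq_iff q_def c_def)
    ultimately show ?thesis
      using test_function_integrable_lborel[OF g] by simp
  qed
  ultimately show ?thesis by (simp add: LIMSEQ_const_iff)
qed

text \<open>Bumps on boxes show that the integral of \<open>g\<close> vanishes over every open box whose closure lies in the
  domain. Inside a fixed such box, open boxes form an intersection-stable generator of the Borel sets,
  so the integral over every Borel set vanishes, and \<open>g\<close> is null on the box. Countably many closed
  boxes cover the domain.\<close>

lemma fundamental_lemma:
  fixes g :: "real^'n \<Rightarrow> real"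
  assumes \<Omega>: "open \<Omega>" and g: "g \<in> L2_space \<Omega>"
    and orth: "\<And>\<phi>. \<phi> \<in> test_functions \<Omega> \<Longrightarrow> L2_inner \<Omega> g \<phi> = 0"
  shows "AE x in lebesgue_on \<Omega>. g x = 0"
proof -
  have \<Omega>s: "\<Omega> \<in> sets lebesgue" using \<Omega> by simp
  have id_meas [measurable]: "(\<lambda>x. x) \<in> borel_measurable (lebesgue_on \<Omega>)"
    by (intro measurable_restrict_space1 measurable_completion) simp
  have g_meas [measurable]: "g \<in> borel_measurable (lebesgue_on \<Omega>)" by (rule L2_space_measurable[OF g])
  have int_box: "integrable (lebesgue_on \<Omega>) (\<lambda>x. g x * indicator (cbox a b) x)" for a b
  proof -
    have "integrable lebesgue (\<lambda>x. indicator \<Omega> x *\<^sub>R (indicator (cbox a b) x :: real))"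
      using \<Omega>s emeasure_lborel_cbox_finite[of a b]
      by (intro integrable_mult_indicator) auto
    then have int: "integrable (lebesgue_on \<Omega>) (indicator (cbox a b) :: _ \<Rightarrow> real)"
      using \<Omega>s by (simp add: integrable_restrict_space)
    have "(indicator (cbox a b) :: _ \<Rightarrow> real) \<in> L2_space \<Omega>"
      by (rule L2_space_dominated[OF borel_measurable_integrable[OF int] int]) (simp add: indicator_def)
    from L2_inner_integrable[OF g this] show ?thesis by simp
  qed
  have box0: "(\<integral>x. g x * indicator (box a b) x \<partial>lebesgue_on \<Omega>) = 0" if sub: "cbox a b \<subseteq> \<Omega>" for a b
  proof -
    have "(\<lambda>n. \<integral>x. g x * box_bump a b n x \<partial>lebesgue_on \<Omega>)
        \<longlonglongrightarrow> (\<integral>x. g x * indicator (box a b) x \<partial>lebesgue_on \<Omega>)"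
    proof (rule integral_dominated_convergence)
      show "integrable (lebesgue_on \<Omega>) (\<lambda>x. norm (g x * indicator (cbox a b) x))"
        using int_box by (rule integrable_norm)
      show "(\<lambda>x. g x * indicator (box a b) x) \<in> borel_measurable (lebesgue_on \<Omega>)"
        by measurable
      show "(\<lambda>x. g x * box_bump a b n x) \<in> borel_measurable (lebesgue_on \<Omega>)" for n
        using L2_space_measurable[OF test_function_L2[OF \<Omega> box_bump_test_function[OF sub]]]
        by measurable
      show "AE x in lebesgue_on \<Omega>. (\<lambda>n. g x * box_bump a b n x) \<longlonglongrightarrow> g x * indicator (box a b) x"
        by (intro AE_I2 tendsto_intros box_bump_tendsto)
      show "AE x in lebesgue_on \<Omega>. norm (g x * box_bump a b n x) \<le> norm (g x * indicator (cbox a b) x)" for n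
      proof (rule AE_I2)
        fix x
        show "norm (g x * box_bump a b n x) \<le> norm (g x * indicator (cbox a b) x)"
        proof (cases "box_bump a b n x = 0")
          case False
          then have "x \<in> cbox a b" using box_bump_nonzero box_subset_cbox by blast
          then show ?thesis using box_bump_le_1[of a b n x] by (simp add: abs_mult mult_left_le)
        qed simp
      qed
    qed
    moreover have "(\<integral>x. g x * box_bump a b n x \<partial>lebesgue_on \<Omega>) = 0" for n
      using orth[OF box_bump_test_function[OF sub]] by (simp add: L2_inner_def)
    ultimately show ?thesis by (simp add: LIMSEQ_const_iff)
  qed
  have AE_box: "AE x in lebesgue. x \<in> box c d \<longrightarrow> g x = 0" if cd: "cbox c d \<subseteq> \<Omega>" for c d
  proof -
    define h where "h x = g x * indicator (box c d) x" for x
    have sub: "box c d \<subseteq> \<Omega>" using cd box_subset_cbox by blast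
    have ind: "indicator \<Omega> x * h x = h x" "indicator \<Omega> x * (h x * k) = h x * k" for x k
      using sub by (auto simp: h_def indicator_def)
    have h_int: "integrable lebesgue h"
    proof -
      have "h \<in> borel_measurable (lebesgue_on \<Omega>)" unfolding h_def by measurable
      then have "integrable (lebesgue_on \<Omega>) h"
        by (rule Bochner_Integration.integrable_bound[OF int_box[of c d]])
           (use box_subset_cbox[of c d] in \<open>auto simp: h_def indicator_def\<close>)
      then show ?thesis using \<Omega>s by (simp add: integrable_restrict_space ind)
    qed
    \<comment> \<open>The generator argument needs a Borel representative; \<open>g\<close> itself is only Lebesgue measurable.\<close>
    obtain h' where h'm: "h' \<in> borel_measurable lborel" and hh': "AE x in lborel. h x = h' x"
      using completion_ex_borel_measurable_real[of h lborel] h_int by auto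
    have hh'': "AE x in lebesgue. h x = h' x" using hh' by (rule AE_completion)
    have h'm_l: "h' \<in> borel_measurable lebesgue" using h'm by (simp add: measurable_completion)
    have "integrable lebesgue h'"
      using h_int h'm_l hh'' by (subst integrable_cong_AE[where g = h]) auto
    then have h'_int: "integrable lborel h'" using h'm by (simp add: integrable_completion)
    have box_h': "(\<integral>x. h' x * indicator (box a b) x \<partial>lborel) = 0" for a b
    proof -
      have [measurable]: "indicator (box a b) \<in> borel_measurable lebesgue" for a b :: "real^'n"
        by (intro borel_measurable_indicator) simp
      note [measurable] = h'm_l borel_measurable_integrable[OF h_int]
      have "(\<integral>x. h' x * indicator (box a b) x \<partial>lborel) = (\<integral>x. h' x * indicator (box a b) x \<partial>lebesgue)"
        using h'm by (subst integral_completion) auto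
      also have "\<dots> = (\<integral>x. h x * indicator (box a b) x \<partial>lebesgue)"
        using hh'' by (intro integral_cong_AE) (measurable, auto)
      also have "\<dots> = (\<integral>x. h x * indicator (box a b) x \<partial>lebesgue_on \<Omega>)"
        using \<Omega>s by (simp add: integral_restrict_space ind)
      also have "\<dots> = (\<integral>x. g x * indicator (box c d \<inter> box a b) x \<partial>lebesgue_on \<Omega>)"
        by (intro Bochner_Integration.integral_cong) (auto simp: h_def indicator_def)
      also have "\<dots> = 0"
      proof (cases "box c d \<inter> box a b = {}")
        case False
        obtain p q where pq: "box c d \<inter> box a b = box p q" by (auto simp: box_Int_box)
        then have "cbox p q = closure (box c d \<inter> box a b)" using False closure_box[of p q] by auto
        also have "\<dots> \<subseteq> cbox c d"
          using box_subset_cbox[of c d] by (intro closure_minimal) auto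
        finally show ?thesis using box0[of p q] cd pq by auto
      qed simp
      finally show ?thesis .
    qed
    have box_Int_stable: "Int_stable (range (\<lambda>(a, b). box a b :: (real^'n) set))"
      by (auto simp: Int_stable_def box_Int_box)
    have box_Pow: "range (\<lambda>(a, b). box a b :: (real^'n) set) \<subseteq> Pow UNIV" by simp
    have "AE x in lborel. h' x = 0"
    proof (rule sigma_finite_measure.density_zero[OF sigma_finite_lborel h'_int])
      fix A :: "(real^'n) set" assume "A \<in> sets lborel"
      then have "A \<in> sigma_sets UNIV (range (\<lambda>(a, b). box a b))"
        by (simp add: borel_eq_box)
      then show "set_lebesgue_integral lborel A h' = 0"
      proof (induction rule: sigma_sets_induct_disjoint[OF box_Int_stable box_Pow,
            consumes 1, case_names basic empty compl union])
        case (basic A)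
        then show ?case using box_h' by (auto simp: set_lebesgue_integral_def mult.commute)
      next
        case empty
        show ?case by (simp add: set_lebesgue_integral_def)
      next
        case (compl A)
        then have A: "A \<in> sets borel" by (simp add: borel_eq_box)
        have "integral\<^sup>L lborel h' = (\<integral>x. h' x * indicator (box c d) x \<partial>lborel)"
          using hh' h'm by (intro integral_cong_AE) (auto simp: h_def indicator_def elim!: eventually_mono split: if_splits)
        then have "integral\<^sup>L lborel h' = 0" using box_h' by simp
        moreover have "set_lebesgue_integral lborel (UNIV - A) h'
            = integral\<^sup>L lborel h' - set_lebesgue_integral lborel A h'"
        proof -
          have "integrable lborel (\<lambda>x. indicator A x *\<^sub>R h' x)"
            using A h'_int by (intro integrable_mult_indicator) auto
          from Bochner_Integration.integral_diff[OF h'_int this]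
          have "(\<integral>x. h' x - indicator A x *\<^sub>R h' x \<partial>lborel)
              = integral\<^sup>L lborel h' - set_lebesgue_integral lborel A h'"
            by (simp only: set_lebesgue_integral_def)
          moreover have "h' x - indicator A x *\<^sub>R h' x = indicator (UNIV - A) x *\<^sub>R h' x" for x
            by (simp add: indicator_def)
          ultimately show ?thesis by (simp only: set_lebesgue_integral_def)
        qed
        ultimately show ?case using compl by simp
      next
        case (union A)
        have meas: "A i \<in> sets lborel" for i using union(2) by (auto simp: borel_eq_box)
        have "set_integrable lborel (\<Union>i. A i) h'"
          unfolding set_integrable_def using meas h'_int by (intro integrable_mult_indicator) auto
        then have "set_lebesgue_integral lborel (\<Union>i. A i) h' = (\<Sum>i. set_lebesgue_integral lborel (A i) h')"
          using union(1) meas by (intro lebesgue_integral_countable_add) (auto simp: disjoint_family_on_def)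
        then show ?case using union by simp
      qed
    qed
    then have "AE x in lebesgue. h' x = 0" by (rule AE_completion)
    with hh'' show ?thesis by eventually_elim (auto simp: h_def)
  qed
  have AE_cbox: "AE x in lebesgue. x \<in> cbox c d \<longrightarrow> g x = 0" if cd: "cbox c d \<subseteq> \<Omega>" for c d
  proof -
    have "cbox c d - box c d \<in> null_sets lebesgue"
      using negligible_frontier_interval[of c d] by (simp add: negligible_iff_null_sets)
    then have "AE x in lebesgue. x \<notin> cbox c d - box c d" by (rule AE_not_in)
    with AE_box[OF cd] show ?thesis by eventually_elim auto
  qed
  obtain \<D> where D: "countable \<D>" "\<D> \<subseteq> Pow \<Omega>" "\<And>X. X \<in> \<D> \<Longrightarrow> \<exists>a b. X = cbox a b" "\<Union>\<D> = \<Omega>"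
    using open_countable_Union_open_cbox[OF \<Omega>] by metis
  have "AE x in lebesgue. \<forall>X\<in>\<D>. x \<in> X \<longrightarrow> g x = 0"
    using D(2,3) AE_cbox by (subst AE_ball_countable[OF D(1)]) blast
  then have "AE x in lebesgue. x \<in> \<Omega> \<longrightarrow> g x = 0"
    using D(4) by (auto elim: eventually_mono)
  then show ?thesis using \<Omega>s by (simp add: AE_restrict_space_iff)
qed

section \<open>Weak gradients and the completeness of the Sobolev space\<close>

lemma has_weak_grad_combination:
  assumes v: "v \<in> L2_space \<Omega>" "G \<in> L2_space \<Omega>" "has_weak_grad \<Omega> v G"
    and w: "w \<in> L2_space \<Omega>" "H \<in> L2_space \<Omega>" "has_weak_grad \<Omega> w H"
    and \<Omega>: "open \<Omega>"
  shows "has_weak_grad \<Omega> (a *\<^sub>R v + b *\<^sub>R w) (a *\<^sub>R G + b *\<^sub>R H)"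
  unfolding has_weak_grad_def
proof (intro ballI allI)
  fix \<phi> i j assume \<phi>: "\<phi> \<in> test_functions \<Omega>"
  have test: "\<phi> \<in> L2_space \<Omega>" "partial_deriv j \<phi> \<in> L2_space \<Omega>"
    using test_function_L2[OF \<Omega>] \<phi> test_function_partial_deriv by blast+
  have lin: "L2_inner \<Omega> (a *\<^sub>R p + b *\<^sub>R q) \<psi> = a * L2_inner \<Omega> p \<psi> + b * L2_inner \<Omega> q \<psi>"
    if "p \<in> L2_space \<Omega>" "q \<in> L2_space \<Omega>" "\<psi> \<in> L2_space \<Omega>" for p q \<psi> :: "real^'a \<Rightarrow> real"
    using that by (simp add: L2.ip_simps L2.scale_mem)
  have "(\<lambda>x. (a *\<^sub>R v + b *\<^sub>R w) x $ i) = a *\<^sub>R (\<lambda>x. v x $ i) + b *\<^sub>R (\<lambda>x. w x $ i)"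
    "(\<lambda>x. (a *\<^sub>R G + b *\<^sub>R H) x $ i $ j) = a *\<^sub>R (\<lambda>x. G x $ i $ j) + b *\<^sub>R (\<lambda>x. H x $ i $ j)"
    by (simp_all add: fun_eq_iff)
  then show "L2_inner \<Omega> (\<lambda>x. (a *\<^sub>R v + b *\<^sub>R w) x $ i) (partial_deriv j \<phi>)
      = - L2_inner \<Omega> (\<lambda>x. (a *\<^sub>R G + b *\<^sub>R H) x $ i $ j) \<phi>"
    using v(3) w(3) \<phi> test L2_component[OF v(1), of i] L2_component[OF w(1), of i]
      L2_entry[OF v(2), of i j] L2_entry[OF w(2), of i j]
    by (simp add: lin has_weak_grad_def)
qed

text \<open>The difference of two weak gradients is orthogonal to all test functions, entry by entry.\<close>

lemma weak_grad_unique: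
  assumes \<Omega>: "open \<Omega>"
    and G: "G \<in> L2_space \<Omega>" "has_weak_grad \<Omega> v G" and H: "H \<in> L2_space \<Omega>" "has_weak_grad \<Omega> v H"
  shows "AE x in lebesgue_on \<Omega>. G x = H x"
proof -
  have "AE x in lebesgue_on \<Omega>. G x $ i $ j - H x $ i $ j = 0" for i j
  proof (rule fundamental_lemma[OF \<Omega>])
    have eq: "(\<lambda>x. G x $ i $ j - H x $ i $ j) = (\<lambda>x. G x $ i $ j) - (\<lambda>x. H x $ i $ j)"
      by (simp add: fun_eq_iff)
    note mem = L2_entry[OF G(1), of i j] L2_entry[OF H(1), of i j]
    show "(\<lambda>x. G x $ i $ j - H x $ i $ j) \<in> L2_space \<Omega>"
      unfolding eq using mem by (rule L2.diff_mem)
    fix \<phi> assume \<phi>: "\<phi> \<in> test_functions \<Omega>"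
    have "L2_inner \<Omega> (\<lambda>x. G x $ i $ j) \<phi> = L2_inner \<Omega> (\<lambda>x. H x $ i $ j) \<phi>"
      using G(2) H(2) \<phi> unfolding has_weak_grad_def by (metis neg_equal_iff_equal)
    then show "L2_inner \<Omega> (\<lambda>x. G x $ i $ j - H x $ i $ j) \<phi> = 0"
      unfolding eq using mem test_function_L2[OF \<Omega> \<phi>] by (simp add: L2.ip_simps)
  qed
  then have "AE x in lebesgue_on \<Omega>. \<forall>i\<in>UNIV. \<forall>j\<in>UNIV. G x $ i $ j - H x $ i $ j = 0"
    by (intro AE_finite_allI[OF finite_class.finite_UNIV])
  then show ?thesis by eventually_elim (simp add: vec_eq_iff)
qed

lemma wgrad_props:
  assumes "v \<in> H1_space \<Omega>"
  shows "wgrad \<Omega> v \<in> L2_space \<Omega>" "has_weak_grad \<Omega> v (wgrad \<Omega> v)"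
proof -
  have "\<exists>G. G \<in> L2_space \<Omega> \<and> has_weak_grad \<Omega> v G" using assms by (auto simp: H1_space_def)
  from someI_ex[OF this] show "wgrad \<Omega> v \<in> L2_space \<Omega>" "has_weak_grad \<Omega> v (wgrad \<Omega> v)"
    by (simp_all add: wgrad_def)
qed

lemma H1_space_L2: "v \<in> H1_space \<Omega> \<Longrightarrow> v \<in> L2_space \<Omega>"
  by (simp add: H1_space_def)

lemma wgrad_AE_eq:
  assumes "open \<Omega>" "v \<in> L2_space \<Omega>" "G \<in> L2_space \<Omega>" "has_weak_grad \<Omega> v G"
  shows "v \<in> H1_space \<Omega>" "AE x in lebesgue_on \<Omega>. wgrad \<Omega> v x = G x"
proof -
  show v: "v \<in> H1_space \<Omega>" using assms by (auto simp: H1_space_def)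
  show "AE x in lebesgue_on \<Omega>. wgrad \<Omega> v x = G x"
    by (rule weak_grad_unique[OF assms(1) wgrad_props[OF v] assms(3,4)])
qed

lemma wgrad_combination:
  assumes \<Omega>: "open \<Omega>" and v: "v \<in> H1_space \<Omega>" and w: "w \<in> H1_space \<Omega>"
  shows "a *\<^sub>R v + b *\<^sub>R w \<in> H1_space \<Omega>"
    and "AE x in lebesgue_on \<Omega>. wgrad \<Omega> (a *\<^sub>R v + b *\<^sub>R w) x = (a *\<^sub>R wgrad \<Omega> v + b *\<^sub>R wgrad \<Omega> w) x"
proof -
  note v' = H1_space_L2[OF v] wgrad_props[OF v] and w' = H1_space_L2[OF w] wgrad_props[OF w]
  note props = wgrad_AE_eq[OF \<Omega> _ _ has_weak_grad_combination[OF v' w' \<Omega>], of a b]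
  show "a *\<^sub>R v + b *\<^sub>R w \<in> H1_space \<Omega>"
    "AE x in lebesgue_on \<Omega>. wgrad \<Omega> (a *\<^sub>R v + b *\<^sub>R w) x = (a *\<^sub>R wgrad \<Omega> v + b *\<^sub>R wgrad \<Omega> w) x"
    using v' w' by (intro props; auto simp: L2.scale_mem)+
qed

lemma subspace_H1_space: "open \<Omega> \<Longrightarrow> subspace (H1_space \<Omega>)"
proof (rule subspaceI)
  assume \<Omega>: "open \<Omega>"
  have "has_weak_grad \<Omega> 0 0" by (simp add: has_weak_grad_def L2_inner_def zero_fun_def)
  then show zero: "0 \<in> H1_space \<Omega>"
    by (auto simp: H1_space_def)
  show "v + w \<in> H1_space \<Omega>" if "v \<in> H1_space \<Omega>" "w \<in> H1_space \<Omega>" for v w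
    using wgrad_combination(1)[OF \<Omega> that, of 1 1] by simp
  show "c *\<^sub>R v \<in> H1_space \<Omega>" if "v \<in> H1_space \<Omega>" for c v
    using wgrad_combination(1)[OF \<Omega> that zero, of c 0] by simp
qed

lemma wgrad_linear_AE:
  assumes \<Omega>: "open \<Omega>" and v: "v \<in> H1_space \<Omega>" and w: "w \<in> H1_space \<Omega>"
  shows "AE x in lebesgue_on \<Omega>. wgrad \<Omega> (v + w) x = wgrad \<Omega> v x + wgrad \<Omega> w x"
    and "AE x in lebesgue_on \<Omega>. wgrad \<Omega> (c *\<^sub>R v) x = c *\<^sub>R wgrad \<Omega> v x"
    and "AE x in lebesgue_on \<Omega>. wgrad \<Omega> (v - w) x = wgrad \<Omega> v x - wgrad \<Omega> w x"
  using wgrad_combination(2)[OF \<Omega> v w, of 1 1] wgrad_combination(2)[OF \<Omega> v w, of c 0]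
    wgrad_combination(2)[OF \<Omega> v w, of 1 "-1"] by simp_all

text \<open>The choice of a representative destroys pointwise linearity of the weak gradient and of the weak
  divergence. What survives is linearity almost everywhere, which is enough for everything that is
  integrated afterwards.\<close>

definition AE_linear ::
  "(real^'n) set \<Rightarrow> 'v::real_vector set \<Rightarrow> ('v \<Rightarrow> real^'n \<Rightarrow> 'b::euclidean_space) \<Rightarrow> bool" where
  "AE_linear \<Omega> S D \<longleftrightarrow> subspace S \<and> (\<forall>v\<in>S. D v \<in> L2_space \<Omega>) \<and>
     (\<forall>v\<in>S. \<forall>w\<in>S. AE x in lebesgue_on \<Omega>. D (v + w) x = D v x + D w x) \<and>
     (\<forall>v\<in>S. \<forall>c. AE x in lebesgue_on \<Omega>. D (c *\<^sub>R v) x = c *\<^sub>R D v x)"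

lemma linear_form_AE_linear:
  assumes D: "AE_linear \<Omega> S D" and L: "linear_form (L2_space \<Omega>) L"
    and cong: "\<And>g h. g \<in> L2_space \<Omega> \<Longrightarrow> h \<in> L2_space \<Omega> \<Longrightarrow>
      AE x in lebesgue_on \<Omega>. g x = h x \<Longrightarrow> L g = L h"
  shows "linear_form S (\<lambda>v. L (D v))"
  unfolding linear_form_def
proof (intro conjI ballI allI)
  have S: "subspace S" and D2: "\<And>v. v \<in> S \<Longrightarrow> D v \<in> L2_space \<Omega>" using D by (auto simp: AE_linear_def)
  fix v assume v: "v \<in> S"
  show "L (D (v + w)) = L (D v) + L (D w)" if w: "w \<in> S" for w
  proof -
    have "L (D (v + w)) = L (D v + D w)"
      using D v w by (intro cong D2 L2.add_mem subspace_add[OF S]) (auto simp: AE_linear_def)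
    then show ?thesis using linear_form_add[OF L D2[OF v] D2[OF w]] by simp
  qed
  show "L (D (c *\<^sub>R v)) = c * L (D v)" for c
  proof -
    have "L (D (c *\<^sub>R v)) = L (c *\<^sub>R D v)"
      using D v by (intro cong D2 L2.scale_mem subspace_scale[OF S]) (auto simp: AE_linear_def)
    then show ?thesis using linear_form_scale[OF L D2[OF v]] by simp
  qed
qed

lemma AE_linear_wgrad: "open \<Omega> \<Longrightarrow> AE_linear \<Omega> (H1_space \<Omega>) (wgrad \<Omega>)"
  unfolding AE_linear_def
  by (intro conjI ballI allI subspace_H1_space wgrad_props(1) wgrad_linear_AE(1,2); assumption)

lemma linear_form_L2_inner:
  assumes "AE_linear \<Omega> S D" and g: "g \<in> L2_space \<Omega>"
  shows "linear_form S (\<lambda>v. L2_inner \<Omega> (D v) g)"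
  by (rule linear_form_AE_linear[OF assms(1) L2.ip_linear[OF g]])
     (rule L2_inner_cong_AE[OF _ g _ g]; simp)

text \<open>The first form is the inner product of the velocity space, the second that of the full Sobolev
  space.\<close>

definition grad_inner where "grad_inner \<Omega> v w = L2_inner \<Omega> (wgrad \<Omega> v) (wgrad \<Omega> w)"

definition H1_inner where "H1_inner \<Omega> v w = L2_inner \<Omega> v w + grad_inner \<Omega> v w"

lemma semi_inner_grad:
  assumes \<Omega>: "open \<Omega>" and S: "subspace S" "S \<subseteq> H1_space \<Omega>"
  shows "semi_inner S (grad_inner \<Omega>)"
proof
  show "linear_form S (\<lambda>u. grad_inner \<Omega> u w)" if "w \<in> S" for w
    using linear_form_L2_inner[OF AE_linear_wgrad[OF \<Omega>] wgrad_props(1), of w] that S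
    by (auto simp: linear_form_def grad_inner_def subset_eq)
  show "grad_inner \<Omega> u v = grad_inner \<Omega> v u" for u v
    by (simp add: grad_inner_def L2_inner_def inner_commute)
  show "0 \<le> grad_inner \<Omega> u u" for u by (simp add: grad_inner_def L2_inner_def)
qed (rule S)

lemma semi_inner_grad_nrm:
  assumes "semi_inner S (grad_inner \<Omega>)"
  shows "semi_inner.nrm (grad_inner \<Omega>) v = L2_norm \<Omega> (wgrad \<Omega> v)"
  by (simp add: semi_inner.nrm_def[OF assms] grad_inner_def L2_norm_def)

lemma semi_inner_H1:
  assumes \<Omega>: "open \<Omega>"
  shows "semi_inner (H1_space \<Omega>) (H1_inner \<Omega>)"
proof -
  interpret g: semi_inner "H1_space \<Omega>" "grad_inner \<Omega>"
    by (rule semi_inner_grad[OF \<Omega> subspace_H1_space[OF \<Omega>] order_refl])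
  show ?thesis
  proof
    show "linear_form (H1_space \<Omega>) (\<lambda>u. H1_inner \<Omega> u w)" if "w \<in> H1_space \<Omega>" for w
      using g.ip_linear[OF that] L2.ip_linear[OF H1_space_L2[OF that]]
      by (auto simp: linear_form_def H1_inner_def H1_space_L2 algebra_simps)
    show "H1_inner \<Omega> u v = H1_inner \<Omega> v u" if "u \<in> H1_space \<Omega>" "v \<in> H1_space \<Omega>" for u v
      using g.ip_commute[OF that] by (simp add: H1_inner_def L2.ip_commute that H1_space_L2)
    show "0 \<le> H1_inner \<Omega> u u" for u by (simp add: H1_inner_def grad_inner_def L2_inner_def)
  qed (rule g.subspace)
qed

lemma semi_inner_H1_nrm:
  assumes \<Omega>: "open \<Omega>" and v: "v \<in> H1_space \<Omega>"
  shows "semi_inner.nrm (H1_inner \<Omega>) v = H1_norm \<Omega> v"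
  using L2.nrm_sq[OF H1_space_L2[OF v]] L2.nrm_sq[OF wgrad_props(1)[OF v]]
  by (simp add: semi_inner.nrm_def[OF semi_inner_H1[OF \<Omega>]] H1_norm_def H1_inner_def grad_inner_def)

lemma H1_norm_tendsto_0_iff:
  fixes s :: "nat \<Rightarrow> real^'n \<Rightarrow> real^'n"
  assumes s: "\<And>n. s n \<in> H1_space \<Omega>"
  shows "(\<lambda>n. H1_norm \<Omega> (s n)) \<longlonglongrightarrow> 0 \<longleftrightarrow>
    (\<lambda>n. L2_norm \<Omega> (s n)) \<longlonglongrightarrow> 0 \<and> (\<lambda>n. L2_norm \<Omega> (wgrad \<Omega> (s n))) \<longlonglongrightarrow> 0"
proof (intro iffI conjI; (elim conjE)?)
  note nn = L2.nrm_nonneg[OF H1_space_L2[OF s]] L2.nrm_nonneg[OF wgrad_props(1)[OF s]]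
  {
    assume lim: "(\<lambda>n. H1_norm \<Omega> (s n)) \<longlonglongrightarrow> 0"
    show "(\<lambda>n. L2_norm \<Omega> (s n)) \<longlonglongrightarrow> 0"
      by (rule Lim_null_comparison[OF _ lim])
         (use nn in \<open>auto simp: H1_norm_def intro!: always_eventually real_le_rsqrt\<close>)
    show "(\<lambda>n. L2_norm \<Omega> (wgrad \<Omega> (s n))) \<longlonglongrightarrow> 0"
      by (rule Lim_null_comparison[OF _ lim])
         (use nn in \<open>auto simp: H1_norm_def intro!: always_eventually real_le_rsqrt\<close>)
  next
    assume "(\<lambda>n. L2_norm \<Omega> (s n)) \<longlonglongrightarrow> 0" "(\<lambda>n. L2_norm \<Omega> (wgrad \<Omega> (s n))) \<longlonglongrightarrow> 0"
    then have "(\<lambda>n. sqrt ((L2_norm \<Omega> (s n))\<^sup>2 + (L2_norm \<Omega> (wgrad \<Omega> (s n)))\<^sup>2)) \<longlonglongrightarrow> sqrt (0\<^sup>2 + 0\<^sup>2)"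
      by (intro tendsto_intros)
    then show "(\<lambda>n. H1_norm \<Omega> (s n)) \<longlonglongrightarrow> 0" by (simp add: H1_norm_def)
  }
qed

text \<open>Both sides of the defining identity are continuous in the mean of order two.\<close>

lemma has_weak_grad_limit:
  assumes \<Omega>: "open \<Omega>"
    and s: "\<And>n. s n \<in> H1_space \<Omega>" "v \<in> L2_space \<Omega>" "(\<lambda>n. L2_norm \<Omega> (s n - v)) \<longlonglongrightarrow> 0"
    and G: "G \<in> L2_space \<Omega>" "(\<lambda>n. L2_norm \<Omega> (wgrad \<Omega> (s n) - G)) \<longlonglongrightarrow> 0"
  shows "has_weak_grad \<Omega> v G"
  unfolding has_weak_grad_def
proof (intro ballI allI)
  fix \<phi> i j assume \<phi>: "\<phi> \<in> test_functions \<Omega>"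
  have pd: "partial_deriv j \<phi> \<in> L2_space \<Omega>" and \<phi>2: "\<phi> \<in> L2_space \<Omega>"
    using test_function_L2[OF \<Omega>] \<phi> test_function_partial_deriv by blast+
  have comp: "L2_norm \<Omega> ((\<lambda>x. s n x $ i) - (\<lambda>x. v x $ i)) \<le> L2_norm \<Omega> (s n - v)" for n
  proof -
    have "norm (y $ i) \<le> 1 * norm y" for y :: "real^'a"
      using vec_component_norm_le[of y i] by simp
    from L2_bounded_linear(2)[OF L2.diff_mem[OF H1_space_L2[OF s(1)] s(2)] bounded_linear_vec_nth this]
    show ?thesis by (simp add: fun_diff_def)
  qed
  have comp_lim: "(\<lambda>n. L2_norm \<Omega> ((\<lambda>x. s n x $ i) - (\<lambda>x. v x $ i))) \<longlonglongrightarrow> 0"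
    by (rule Lim_null_comparison[OF _ s(3)])
       (use comp L2.nrm_nonneg[OF L2.diff_mem[OF L2_component[OF H1_space_L2[OF s(1)]] L2_component[OF s(2)]]] in auto)
  have entry: "L2_norm \<Omega> ((\<lambda>x. wgrad \<Omega> (s n) x $ i $ j) - (\<lambda>x. G x $ i $ j)) \<le> L2_norm \<Omega> (wgrad \<Omega> (s n) - G)" for n
  proof -
    have "norm (Y $ i $ j) \<le> 1 * norm Y" for Y :: "real^'a^'a"
      using order_trans[OF vec_component_norm_le[of "Y $ i" j] vec_component_norm_le[of Y i]] by simp
    moreover have "bounded_linear (\<lambda>Y :: real^'a^'a. Y $ i $ j)"
      by (intro bounded_linear_compose[OF bounded_linear_vec_nth bounded_linear_vec_nth])
    ultimately have "L2_norm \<Omega> (\<lambda>x. (wgrad \<Omega> (s n) - G) x $ i $ j) \<le> 1 * L2_norm \<Omega> (wgrad \<Omega> (s n) - G)"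
      by (intro L2_bounded_linear(2)[OF L2.diff_mem[OF wgrad_props(1)[OF s(1)] G(1)]])
    then show ?thesis by (simp add: fun_diff_def)
  qed
  have entry_lim: "(\<lambda>n. L2_norm \<Omega> ((\<lambda>x. wgrad \<Omega> (s n) x $ i $ j) - (\<lambda>x. G x $ i $ j))) \<longlonglongrightarrow> 0"
    by (rule Lim_null_comparison[OF _ G(2)])
       (use entry L2.nrm_nonneg[OF L2.diff_mem[OF L2_entry[OF wgrad_props(1)[OF s(1)]] L2_entry[OF G(1)]]] in auto)
  have "(\<lambda>n. L2_inner \<Omega> (\<lambda>x. s n x $ i) (partial_deriv j \<phi>)) \<longlonglongrightarrow> L2_inner \<Omega> (\<lambda>x. v x $ i) (partial_deriv j \<phi>)"
    by (rule L2.ip_tendsto[OF L2_component[OF H1_space_L2[OF s(1)]] L2_component[OF s(2)] comp_lim pd])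
  moreover have "(\<lambda>n. - L2_inner \<Omega> (\<lambda>x. wgrad \<Omega> (s n) x $ i $ j) \<phi>) \<longlonglongrightarrow> - L2_inner \<Omega> (\<lambda>x. G x $ i $ j) \<phi>"
    by (rule tendsto_minus[OF L2.ip_tendsto[OF L2_entry[OF wgrad_props(1)[OF s(1)]] L2_entry[OF G(1)] entry_lim \<phi>2]])
  moreover have "L2_inner \<Omega> (\<lambda>x. s n x $ i) (partial_deriv j \<phi>) = - L2_inner \<Omega> (\<lambda>x. wgrad \<Omega> (s n) x $ i $ j) \<phi>" for n
    using wgrad_props(2)[OF s(1)] \<phi> by (simp add: has_weak_grad_def)
  ultimately show "L2_inner \<Omega> (\<lambda>x. v x $ i) (partial_deriv j \<phi>) = - L2_inner \<Omega> (\<lambda>x. G x $ i $ j) \<phi>"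
    using LIMSEQ_unique by simp
qed

text \<open>Take limits of the functions and of their gradients separately; \<open>has_weak_grad_limit\<close> recognises
  the second limit as the gradient of the first.\<close>

lemma H1_complete:
  fixes s :: "nat \<Rightarrow> real^'n \<Rightarrow> real^'n"
  assumes \<Omega>: "open \<Omega>" and s: "\<And>n. s n \<in> H1_space \<Omega>"
    and c1: "\<And>e. e > 0 \<Longrightarrow> \<exists>N::nat. \<forall>m\<ge>N. \<forall>n\<ge>N. L2_norm \<Omega> (s m - s n) < e"
    and c2: "\<And>e. e > 0 \<Longrightarrow> \<exists>N::nat. \<forall>m\<ge>N. \<forall>n\<ge>N. L2_norm \<Omega> (wgrad \<Omega> (s m - s n)) < e"
  obtains v where "v \<in> H1_space \<Omega>" "(\<lambda>n. L2_norm \<Omega> (s n - v)) \<longlonglongrightarrow> 0"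
    "(\<lambda>n. L2_norm \<Omega> (wgrad \<Omega> (s n - v))) \<longlonglongrightarrow> 0"
proof -
  have norm_cong: "L2_norm \<Omega> g = L2_norm \<Omega> h"
    if "g \<in> L2_space \<Omega>" "h \<in> L2_space \<Omega>" "AE x in lebesgue_on \<Omega>. g x = h x" for g h :: "real^'n \<Rightarrow> real^'n^'n"
    unfolding L2_norm_def using that by (subst L2_inner_cong_AE[of g _ g h h]) auto
  have diff: "L2_norm \<Omega> (wgrad \<Omega> (v - w)) = L2_norm \<Omega> (wgrad \<Omega> v - wgrad \<Omega> w)"
    if "v \<in> H1_space \<Omega>" "w \<in> H1_space \<Omega>" for v w
    using wgrad_linear_AE(3)[OF \<Omega> that] wgrad_props(1)[OF that(1)] wgrad_props(1)[OF that(2)]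
      wgrad_props(1)[OF subspace_diff[OF subspace_H1_space[OF \<Omega>] that]]
    by (intro norm_cong) auto
  obtain v where v: "v \<in> L2_space \<Omega>" "(\<lambda>n. L2_norm \<Omega> (s n - v)) \<longlonglongrightarrow> 0"
    by (rule L2_complete[OF H1_space_L2[OF s] c1])
  have c2': "\<exists>N::nat. \<forall>m\<ge>N. \<forall>n\<ge>N. L2_norm \<Omega> (wgrad \<Omega> (s m) - wgrad \<Omega> (s n)) < e" if "e > 0" for e
    using c2[OF that] diff[OF s s] by simp
  obtain G where G: "G \<in> L2_space \<Omega>" "(\<lambda>n. L2_norm \<Omega> (wgrad \<Omega> (s n) - G)) \<longlonglongrightarrow> 0"
    by (rule L2_complete[OF wgrad_props(1)[OF s] c2'])
  note vG = wgrad_AE_eq[OF \<Omega> v(1) G(1) has_weak_grad_limit[OF \<Omega> s v G]]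
  have "L2_norm \<Omega> (wgrad \<Omega> (s n - v)) = L2_norm \<Omega> (wgrad \<Omega> (s n) - G)" for n
  proof -
    have "L2_norm \<Omega> (wgrad \<Omega> (s n) - wgrad \<Omega> v) = L2_norm \<Omega> (wgrad \<Omega> (s n) - G)"
      using wgrad_props(1)[OF s] wgrad_props(1)[OF vG(1)] G(1) vG(2)
      by (intro norm_cong) auto
    then show ?thesis using diff[OF s vG(1)] by simp
  qed
  then show ?thesis using that[OF vG(1) v(2)] G(2) by simp
qed

section \<open>Velocity fields and solenoidal fields\<close>

text \<open>Classical derivatives are weak derivatives, since the derivative of the product of two test
  functions integrates to \<open>0\<close>. By uniqueness they agree with the chosen weak gradient.\<close>

lemma test_field_H1:
  assumes \<Omega>: "open \<Omega>" and \<phi>: "\<phi> \<in> test_fields \<Omega>"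
  shows "\<phi> \<in> H1_space \<Omega>"
    and "AE x in lebesgue_on \<Omega>. \<forall>i j. wgrad \<Omega> \<phi> x $ i $ j = partial_deriv j (\<lambda>x. \<phi> x $ i) x"
proof -
  define G where "G x = (\<chi> i j. partial_deriv j (\<lambda>x. \<phi> x $ i) x)" for x
  have comp: "(\<lambda>x. \<phi> x $ i) \<in> test_functions \<Omega>" for i
    using \<phi> by (simp add: test_fields_def)
  note pd = test_function_partial_deriv[OF comp]
  have \<phi>2: "\<phi> \<in> L2_space \<Omega>"
    by (rule L2_space_vec) (rule test_function_L2[OF \<Omega> comp])
  have G2: "G \<in> L2_space \<Omega>"
    by (intro L2_space_vec) (simp add: G_def test_function_L2[OF \<Omega> pd])
  have "has_weak_grad \<Omega> \<phi> G"
    unfolding has_weak_grad_def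
  proof (intro ballI allI)
    fix \<psi> i j assume \<psi>: "\<psi> \<in> test_functions \<Omega>"
    define g where "g x = \<phi> x $ i" for x
    have g: "g \<in> test_functions \<Omega>" unfolding g_def by (rule comp)
    have prod: "(\<lambda>x. g x * \<psi> x) \<in> test_functions \<Omega>"
      by (rule test_function_mult[OF \<psi> test_function_C_k[OF g]])
    have parts: "partial_deriv j (\<lambda>x. g x * \<psi> x) x = g x * partial_deriv j \<psi> x + partial_deriv j g x * \<psi> x" for x
      by (rule partial_deriv_mult[OF test_function_differentiable[OF g] test_function_differentiable[OF \<psi>]])
    note L2 = test_function_L2[OF \<Omega>]
    note prod' = test_function_partial_deriv[OF prod, of j]
    have "integral\<^sup>L (lebesgue_on \<Omega>) (partial_deriv j (\<lambda>x. g x * \<psi> x)) = 0"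
      using lebesgue_on_supported(2)[OF \<Omega> test_function_borel[OF prod'] test_function_eq_0[OF prod']]
        integral_partial_deriv_eq_0[OF prod] by simp
    then have "(\<integral>x. g x * partial_deriv j \<psi> x + partial_deriv j g x * \<psi> x \<partial>lebesgue_on \<Omega>) = 0"
      by (simp add: parts[symmetric] cong: Bochner_Integration.integral_cong)
    moreover have "integrable (lebesgue_on \<Omega>) (\<lambda>x. g x * partial_deriv j \<psi> x)"
      using L2_inner_integrable[OF L2[OF g] L2[OF test_function_partial_deriv[OF \<psi>]]] by simp
    moreover have "integrable (lebesgue_on \<Omega>) (\<lambda>x. partial_deriv j g x * \<psi> x)"
      using L2_inner_integrable[OF L2[OF test_function_partial_deriv[OF g]] L2[OF \<psi>]] by simp
    ultimately have "L2_inner \<Omega> g (partial_deriv j \<psi>) + L2_inner \<Omega> (partial_deriv j g) \<psi> = 0"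
      by (simp add: L2_inner_def)
    moreover have "(\<lambda>x. G x $ i $ j) = partial_deriv j g" "(\<lambda>x. \<phi> x $ i) = g"
      by (simp_all add: G_def g_def[abs_def])
    ultimately show "L2_inner \<Omega> (\<lambda>x. \<phi> x $ i) (partial_deriv j \<psi>) = - L2_inner \<Omega> (\<lambda>x. G x $ i $ j) \<psi>"
      by simp
  qed
  from wgrad_AE_eq[OF \<Omega> \<phi>2 G2 this]
  show "\<phi> \<in> H1_space \<Omega>" "AE x in lebesgue_on \<Omega>. \<forall>i j. wgrad \<Omega> \<phi> x $ i $ j = partial_deriv j (\<lambda>x. \<phi> x $ i) x"
    by (auto simp: G_def elim!: eventually_mono)
qed

lemma test_field_combination:
  assumes "\<phi> \<in> test_fields \<Omega>" "\<psi> \<in> test_fields \<Omega>"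
  shows "a *\<^sub>R \<phi> + b *\<^sub>R \<psi> \<in> test_fields \<Omega>"
  using assms unfolding test_fields_def
  by (auto intro!: test_function_add test_function_mult C_k_const)

lemma zero_test_field: "0 \<in> test_fields \<Omega>"
  by (auto simp: test_fields_def intro!: test_functionI[of _ "{}"] C_k_const)

text \<open>An approximation property without sequences is easier to verify for sums and for limits.\<close>

lemma X_space_iff:
  assumes \<Omega>: "open \<Omega>"
  shows "v \<in> X_space \<Omega> \<longleftrightarrow> v \<in> H1_space \<Omega> \<and> (\<forall>e>0. \<exists>\<phi>\<in>test_fields \<Omega>. H1_norm \<Omega> (v - \<phi>) < e)"
proof (intro iffI conjI allI impI; (elim conjE)?)
  assume v: "v \<in> X_space \<Omega>"
  then show "v \<in> H1_space \<Omega>" by (simp add: X_space_def)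
  fix e :: real assume "e > 0"
  obtain \<phi> where "\<And>n. \<phi> n \<in> test_fields \<Omega>" "(\<lambda>n. H1_norm \<Omega> (v - \<phi> n)) \<longlonglongrightarrow> 0"
    using v by (auto simp: X_space_def fun_diff_def)
  moreover from this(2) \<open>e > 0\<close> have "\<forall>\<^sub>F n in sequentially. H1_norm \<Omega> (v - \<phi> n) < e"
    by (rule order_tendstoD(2))
  ultimately show "\<exists>\<phi>\<in>test_fields \<Omega>. H1_norm \<Omega> (v - \<phi>) < e"
    by (auto simp: eventually_sequentially)
next
  assume v: "v \<in> H1_space \<Omega>" and e: "\<forall>e>0. \<exists>\<phi>\<in>test_fields \<Omega>. H1_norm \<Omega> (v - \<phi>) < e"
  have "\<exists>\<phi>. \<phi> \<in> test_fields \<Omega> \<and> H1_norm \<Omega> (v - \<phi>) < 1 / real (Suc n)" for n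
    using e[rule_format, of "1 / real (Suc n)"] by auto
  then obtain \<phi> where \<phi>: "\<And>n. \<phi> n \<in> test_fields \<Omega>" "\<And>n. H1_norm \<Omega> (v - \<phi> n) < 1 / real (Suc n)"
    by metis
  have lim: "(\<lambda>n. 1 / real (Suc n)) \<longlonglongrightarrow> 0"
    using LIMSEQ_inverse_real_of_nat by (simp add: inverse_eq_divide)
  have nn: "0 \<le> H1_norm \<Omega> (v - \<phi> n)" for n by (simp add: H1_norm_def)
  have "(\<lambda>n. H1_norm \<Omega> (v - \<phi> n)) \<longlonglongrightarrow> 0"
  proof (rule Lim_null_comparison[OF always_eventually[OF allI] lim])
    show "norm (H1_norm \<Omega> (v - \<phi> n)) \<le> 1 / real (Suc n)" for n
      using nn[of n] \<phi>(2)[of n] by simp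
  qed
  then show "v \<in> X_space \<Omega>" using v \<phi>(1) by (auto simp: X_space_def fun_diff_def)
qed

lemma X_space_H1: "v \<in> X_space \<Omega> \<Longrightarrow> v \<in> H1_space \<Omega>"
  by (simp add: X_space_def)

lemma test_field_X: "open \<Omega> \<Longrightarrow> \<phi> \<in> test_fields \<Omega> \<Longrightarrow> \<phi> \<in> X_space \<Omega>"
proof -
  assume \<Omega>: "open \<Omega>" and \<phi>: "\<phi> \<in> test_fields \<Omega>"
  interpret H: semi_inner "H1_space \<Omega>" "H1_inner \<Omega>" by (rule semi_inner_H1[OF \<Omega>])
  have "H1_norm \<Omega> (\<phi> - \<phi>) = 0"
    using semi_inner_H1_nrm[OF \<Omega> H.zero_mem] H.nrm_zero by simp
  then show ?thesis
    using test_field_H1(1)[OF \<Omega> \<phi>] \<phi> unfolding X_space_iff[OF \<Omega>] by (metis (no_types))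
qed

lemma X_space_closed:
  assumes \<Omega>: "open \<Omega>" and v: "v \<in> H1_space \<Omega>"
    and e: "\<And>e. e > 0 \<Longrightarrow> \<exists>w\<in>X_space \<Omega>. H1_norm \<Omega> (v - w) < e"
  shows "v \<in> X_space \<Omega>"
  unfolding X_space_iff[OF \<Omega>]
proof (intro conjI allI impI v)
  interpret H: semi_inner "H1_space \<Omega>" "H1_inner \<Omega>" by (rule semi_inner_H1[OF \<Omega>])
  note nrm = semi_inner_H1_nrm[OF \<Omega>]
  fix e :: real assume "e > 0"
  then obtain w where w: "w \<in> X_space \<Omega>" "H1_norm \<Omega> (v - w) < e / 2" using e[of "e / 2"] by auto
  obtain \<phi> where \<phi>: "\<phi> \<in> test_fields \<Omega>" "H1_norm \<Omega> (w - \<phi>) < e / 2"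
    using w(1) \<open>e > 0\<close> by (auto simp: X_space_iff[OF \<Omega>] dest: spec[of _ "e / 2"])
  have mem: "w \<in> H1_space \<Omega>" "\<phi> \<in> H1_space \<Omega>"
    using X_space_H1[OF w(1)] test_field_H1(1)[OF \<Omega> \<phi>(1)] by auto
  have "H1_norm \<Omega> (v - \<phi>) \<le> H1_norm \<Omega> (v - w) + H1_norm \<Omega> (w - \<phi>)"
    using H.nrm_triangle_diff[OF v mem] mem v by (simp add: nrm)
  then have "H1_norm \<Omega> (v - \<phi>) < e" using w(2) \<phi>(2) by simp
  then show "\<exists>\<phi>\<in>test_fields \<Omega>. H1_norm \<Omega> (v - \<phi>) < e" using \<phi>(1) by blast
qed

lemma subspace_X_space:
  assumes \<Omega>: "open \<Omega>"
  shows "subspace (X_space \<Omega>)"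
proof (rule subspaceI)
  interpret H: semi_inner "H1_space \<Omega>" "H1_inner \<Omega>" by (rule semi_inner_H1[OF \<Omega>])
  note nrm = semi_inner_H1_nrm[OF \<Omega>]
  show "0 \<in> X_space \<Omega>" by (rule test_field_X[OF \<Omega> zero_test_field])
  show "v + w \<in> X_space \<Omega>" if v: "v \<in> X_space \<Omega>" and w: "w \<in> X_space \<Omega>" for v w
    unfolding X_space_iff[OF \<Omega>]
  proof (intro conjI allI impI)
    show "v + w \<in> H1_space \<Omega>" using v w by (intro H.add_mem X_space_H1)
    fix e :: real assume e: "e > 0"
    obtain \<phi> where \<phi>: "\<phi> \<in> test_fields \<Omega>" "H1_norm \<Omega> (v - \<phi>) < e / 2"
      using v e by (auto simp: X_space_iff[OF \<Omega>] dest: spec[of _ "e / 2"])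
    obtain \<psi> where \<psi>: "\<psi> \<in> test_fields \<Omega>" "H1_norm \<Omega> (w - \<psi>) < e / 2"
      using w e by (auto simp: X_space_iff[OF \<Omega>] dest: spec[of _ "e / 2"])
    note mem = X_space_H1[OF v] X_space_H1[OF w] test_field_H1(1)[OF \<Omega> \<phi>(1)] test_field_H1(1)[OF \<Omega> \<psi>(1)]
    have "H1_norm \<Omega> ((v - \<phi>) + (w - \<psi>)) \<le> H1_norm \<Omega> (v - \<phi>) + H1_norm \<Omega> (w - \<psi>)"
      using H.nrm_triangle[of "v - \<phi>" "w - \<psi>"] mem
      by (simp only: nrm H.add_mem H.diff_mem)
    moreover have "(v - \<phi>) + (w - \<psi>) = v + w - (\<phi> + \<psi>)" by simp
    ultimately have "H1_norm \<Omega> (v + w - (\<phi> + \<psi>)) < e" using \<phi>(2) \<psi>(2) by simp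
    moreover have "\<phi> + \<psi> \<in> test_fields \<Omega>"
      using test_field_combination[OF \<phi>(1) \<psi>(1), of 1 1] by simp
    ultimately show "\<exists>\<phi>\<in>test_fields \<Omega>. H1_norm \<Omega> (v + w - \<phi>) < e" by blast
  qed
  show "c *\<^sub>R v \<in> X_space \<Omega>" if v: "v \<in> X_space \<Omega>" for c v
    unfolding X_space_iff[OF \<Omega>]
  proof (intro conjI allI impI)
    show "c *\<^sub>R v \<in> H1_space \<Omega>" using v by (intro H.scale_mem X_space_H1)
    fix e :: real assume e: "e > 0"
    then have "e / (\<bar>c\<bar> + 1) > 0" by simp
    then obtain \<phi> where \<phi>: "\<phi> \<in> test_fields \<Omega>" "H1_norm \<Omega> (v - \<phi>) < e / (\<bar>c\<bar> + 1)"
      using v by (auto simp: X_space_iff[OF \<Omega>])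
    note mem = X_space_H1[OF v] test_field_H1(1)[OF \<Omega> \<phi>(1)]
    have "H1_norm \<Omega> (c *\<^sub>R v - c *\<^sub>R \<phi>) = \<bar>c\<bar> * H1_norm \<Omega> (v - \<phi>)"
      using H.nrm_scale[of "v - \<phi>" c] mem
      by (simp only: nrm H.scale_mem H.diff_mem scaleR_diff_right)
    also have "\<dots> \<le> (\<bar>c\<bar> + 1) * H1_norm \<Omega> (v - \<phi>)"
      by (intro mult_right_mono) (auto simp: H1_norm_def)
    also have "\<dots> < e" using \<phi>(2) by (simp add: field_simps)
    finally have "H1_norm \<Omega> (c *\<^sub>R v - c *\<^sub>R \<phi>) < e" .
    moreover have "c *\<^sub>R \<phi> \<in> test_fields \<Omega>"
      using test_field_combination[OF \<phi>(1) \<phi>(1), of c 0] by simp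
    ultimately show "\<exists>\<phi>\<in>test_fields \<Omega>. H1_norm \<Omega> (c *\<^sub>R v - \<phi>) < e" by blast
  qed
qed

lemma bounded_linear_trace: "bounded_linear (trace :: real^'n^'n \<Rightarrow> real)"
  by (intro linear_conv_bounded_linear[THEN iffD1] linearI)
     (auto simp: trace_def sum.distrib sum_distrib_left)

lemma wdiv_L2: "v \<in> H1_space \<Omega> \<Longrightarrow> wdiv \<Omega> v \<in> L2_space \<Omega>"
proof -
  assume v: "v \<in> H1_space \<Omega>"
  obtain K where "\<And>Y :: real^'a^'a. norm (trace Y) \<le> K * norm Y"
    using bounded_linear.bounded[OF bounded_linear_trace] by (metis mult.commute)
  from L2_bounded_linear(1)[OF wgrad_props(1)[OF v] bounded_linear_trace this]
  show ?thesis by (simp add: wdiv_def[abs_def])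
qed

lemma wdiv_linear_AE:
  assumes \<Omega>: "open \<Omega>" and v: "v \<in> H1_space \<Omega>" and w: "w \<in> H1_space \<Omega>"
  shows "AE x in lebesgue_on \<Omega>. wdiv \<Omega> (v + w) x = wdiv \<Omega> v x + wdiv \<Omega> w x"
    and "AE x in lebesgue_on \<Omega>. wdiv \<Omega> (c *\<^sub>R v) x = c * wdiv \<Omega> v x"
proof -
  note tr = linear_add[OF bounded_linear.linear[OF bounded_linear_trace]]
    linear_scale[OF bounded_linear.linear[OF bounded_linear_trace]]
  show "AE x in lebesgue_on \<Omega>. wdiv \<Omega> (v + w) x = wdiv \<Omega> v x + wdiv \<Omega> w x"
    using wgrad_linear_AE(1)[OF \<Omega> v w] by eventually_elim (simp add: wdiv_def tr)
  show "AE x in lebesgue_on \<Omega>. wdiv \<Omega> (c *\<^sub>R v) x = c * wdiv \<Omega> v x"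
    using wgrad_linear_AE(2)[OF \<Omega> v w, of c] by eventually_elim (simp add: wdiv_def tr)
qed

lemma AE_linear_wdiv: "open \<Omega> \<Longrightarrow> AE_linear \<Omega> (H1_space \<Omega>) (wdiv \<Omega>)"
  unfolding AE_linear_def real_scaleR_def
  by (intro conjI ballI allI subspace_H1_space wdiv_L2 wdiv_linear_AE; assumption)

lemmas wdiv_linear_form = linear_form_L2_inner[OF AE_linear_wdiv]

text \<open>Continuity of the constraints that define solenoidal fields.\<close>

lemma wdiv_bound:
  assumes q: "q \<in> L2_space \<Omega>"
  shows "\<exists>K. \<forall>v\<in>H1_space \<Omega>. \<bar>L2_inner \<Omega> (wdiv \<Omega> v) q\<bar> \<le> K * L2_norm \<Omega> (wgrad \<Omega> v)"
proof -
  obtain K where K: "\<And>Y :: real^'a^'a. norm (trace Y) \<le> K * norm Y"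
    using bounded_linear.bounded[OF bounded_linear_trace] by (metis mult.commute)
  have "\<bar>L2_inner \<Omega> (wdiv \<Omega> v) q\<bar> \<le> (K * L2_norm \<Omega> q) * L2_norm \<Omega> (wgrad \<Omega> v)" if v: "v \<in> H1_space \<Omega>" for v
  proof -
    have "L2_norm \<Omega> (wdiv \<Omega> v) \<le> K * L2_norm \<Omega> (wgrad \<Omega> v)"
      using L2_bounded_linear(2)[OF wgrad_props(1)[OF v] bounded_linear_trace K] by (simp add: wdiv_def[abs_def])
    then have "L2_norm \<Omega> (wdiv \<Omega> v) * L2_norm \<Omega> q \<le> (K * L2_norm \<Omega> (wgrad \<Omega> v)) * L2_norm \<Omega> q"
      using L2.nrm_nonneg[OF q] by (rule mult_right_mono)
    then show ?thesis using L2.Cauchy_Schwarz[OF wdiv_L2[OF v] q] by (simp add: mult_ac)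
  qed
  then show ?thesis by blast
qed

lemma subspace_V_space:
  assumes \<Omega>: "open \<Omega>"
  shows "subspace (V_space \<Omega>)"
proof -
  have lin: "linear_form (H1_space \<Omega>) (\<lambda>v. L2_inner \<Omega> (wdiv \<Omega> v) q)" if "q \<in> Q_space \<Omega>" for q
    using that wdiv_linear_form[OF \<Omega>] by (simp add: Q_space_def)
  note X = subspace_X_space[OF \<Omega>]
  show ?thesis
  proof (rule subspaceI)
    show zero: "0 \<in> V_space \<Omega>"
      using linear_form_scale[OF lin X_space_H1[OF subspace_0[OF X]], of _ 0] subspace_0[OF X]
      by (simp add: V_space_def)
    show "v + w \<in> V_space \<Omega>" if "v \<in> V_space \<Omega>" "w \<in> V_space \<Omega>" for v w
      using that subspace_add[OF X] linear_form_add[OF lin X_space_H1 X_space_H1]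
      by (simp add: V_space_def)
    show "c *\<^sub>R v \<in> V_space \<Omega>" if "v \<in> V_space \<Omega>" for c v
      using that subspace_scale[OF X] linear_form_scale[OF lin X_space_H1]
      by (simp add: V_space_def)
  qed
qed

lemma V_space_X: "v \<in> V_space \<Omega> \<Longrightarrow> v \<in> X_space \<Omega>"
  by (simp add: V_space_def)

text \<open>The Poincare inequality turns Cauchy sequences for the gradient norm into Cauchy sequences for the
  Sobolev norm. The limit inherits the boundary condition because \<open>X\<close> is closed by construction, and
  the divergence constraint by continuity. The constant \<open>C\<close> may be negative, hence the factor
  \<open>\<bar>C\<bar> + 1\<close>.\<close>

lemma semi_hilbert_V:
  assumes \<Omega>: "open \<Omega>"
    and poincare: "\<And>v. v \<in> X_space \<Omega> \<Longrightarrow> L2_norm \<Omega> v \<le> C * L2_norm \<Omega> (wgrad \<Omega> v)"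
  shows "semi_hilbert (V_space \<Omega>) (grad_inner \<Omega>)"
proof -
  note X = subspace_X_space[OF \<Omega>]
  have sub: "V_space \<Omega> \<subseteq> H1_space \<Omega>" using V_space_X X_space_H1 by blast
  have semi: "semi_inner (V_space \<Omega>) (grad_inner \<Omega>)"
    by (rule semi_inner_grad[OF \<Omega> subspace_V_space[OF \<Omega>] sub])
  interpret semi_inner "V_space \<Omega>" "grad_inner \<Omega>" by (rule semi)
  interpret H: semi_inner "H1_space \<Omega>" "grad_inner \<Omega>"
    by (rule semi_inner_grad[OF \<Omega> subspace_H1_space[OF \<Omega>] order_refl])
  note nrm = semi_inner_grad_nrm[OF semi]
  show ?thesis
  proof (rule semi_hilbert.intro[OF semi], unfold_locales)
    fix s :: "nat \<Rightarrow> real^'a \<Rightarrow> real^'a"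
    assume s: "\<And>n. s n \<in> V_space \<Omega>"
      and c: "\<And>e. e > 0 \<Longrightarrow> \<exists>N. \<forall>m\<ge>N. \<forall>n\<ge>N. nrm (s m - s n) < e"
    have sX: "s n \<in> X_space \<Omega>" and sH: "s n \<in> H1_space \<Omega>" for n
      using V_space_X[OF s] X_space_H1 by blast+
    have c2: "\<exists>N. \<forall>m\<ge>N. \<forall>n\<ge>N. L2_norm \<Omega> (wgrad \<Omega> (s m - s n)) < e" if "e > 0" for e
      using c[OF that] by (simp only: nrm)
    have c1: "\<exists>N. \<forall>m\<ge>N. \<forall>n\<ge>N. L2_norm \<Omega> (s m - s n) < e" if "e > 0" for e
    proof -
      have "0 < e / (\<bar>C\<bar> + 1)" using that by simp
      from c2[OF this] obtain N where N: "\<And>m n. m \<ge> N \<Longrightarrow> n \<ge> N \<Longrightarrow> L2_norm \<Omega> (wgrad \<Omega> (s m - s n)) < e / (\<bar>C\<bar> + 1)"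
        by blast
      have "L2_norm \<Omega> (s m - s n) < e" if "m \<ge> N" "n \<ge> N" for m n
      proof -
        have "L2_norm \<Omega> (s m - s n) \<le> C * L2_norm \<Omega> (wgrad \<Omega> (s m - s n))"
          by (intro poincare subspace_diff[OF X] sX)
        also have "\<dots> \<le> (\<bar>C\<bar> + 1) * L2_norm \<Omega> (wgrad \<Omega> (s m - s n))"
          using L2.nrm_nonneg[OF wgrad_props(1)[OF H.diff_mem[OF sH sH]]] by (intro mult_right_mono) auto
        also have "\<dots> < e" using N[OF that] by (simp add: field_simps)
        finally show ?thesis .
      qed
      then show ?thesis by blast
    qed
    obtain v where v: "v \<in> H1_space \<Omega>" "(\<lambda>n. L2_norm \<Omega> (s n - v)) \<longlonglongrightarrow> 0"
      "(\<lambda>n. L2_norm \<Omega> (wgrad \<Omega> (s n - v))) \<longlonglongrightarrow> 0"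
      by (rule H1_complete[OF \<Omega> sH c1 c2])
    have "v \<in> X_space \<Omega>"
    proof (rule X_space_closed[OF \<Omega> v(1)])
      interpret H1: semi_inner "H1_space \<Omega>" "H1_inner \<Omega>" by (rule semi_inner_H1[OF \<Omega>])
      fix e :: real assume "e > 0"
      have "(\<lambda>n. H1_norm \<Omega> (s n - v)) \<longlonglongrightarrow> 0"
        using v H1_norm_tendsto_0_iff[of "\<lambda>n. s n - v" \<Omega>] H.diff_mem[OF sH v(1)] by simp
      from order_tendstoD(2)[OF this \<open>e > 0\<close>] obtain n where "H1_norm \<Omega> (s n - v) < e"
        by (auto simp: eventually_sequentially)
      moreover have "H1_norm \<Omega> (s n - v) = H1_norm \<Omega> (v - s n)"
        using H1.nrm_minus_commute[OF sH v(1), of n] semi_inner_H1_nrm[OF \<Omega>] H.diff_mem[OF sH v(1)] H.diff_mem[OF v(1) sH]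
        by simp
      ultimately show "\<exists>w\<in>X_space \<Omega>. H1_norm \<Omega> (v - w) < e" using sX by auto
    qed
    moreover have "L2_inner \<Omega> (wdiv \<Omega> v) q = 0" if q: "q \<in> Q_space \<Omega>" for q
    proof -
      have q2: "q \<in> L2_space \<Omega>" using q by (simp add: Q_space_def)
      obtain K where K: "\<And>v. v \<in> H1_space \<Omega> \<Longrightarrow> \<bar>L2_inner \<Omega> (wdiv \<Omega> v) q\<bar> \<le> K * L2_norm \<Omega> (wgrad \<Omega> v)"
        using wdiv_bound[OF q2] by blast
      have "(\<lambda>n. L2_inner \<Omega> (wdiv \<Omega> (s n)) q) \<longlonglongrightarrow> L2_inner \<Omega> (wdiv \<Omega> v) q"
        by (rule H.linear_form_tendsto[OF wdiv_linear_form[OF \<Omega> q2] _ sH v(1)])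
           (use K v(3) in \<open>auto simp: semi_inner_grad_nrm[OF H.semi_inner_axioms]\<close>)
      moreover have "L2_inner \<Omega> (wdiv \<Omega> (s n)) q = 0" for n using s[of n] q by (simp add: V_space_def)
      ultimately show ?thesis by (simp add: LIMSEQ_const_iff)
    qed
    ultimately have "v \<in> V_space \<Omega>" by (simp add: V_space_def)
    then show "\<exists>l\<in>V_space \<Omega>. (\<lambda>n. nrm (s n - l)) \<longlonglongrightarrow> 0"
      using v(3) by (auto simp: nrm)
  qed
qed

section \<open>The Ladyzhenskaya inequality\<close>

text \<open>Coordinates with respect to the axes, indexed by the basis vectors themselves because that is how
  Lebesgue measure is presented as a product.\<close>

lemma nn_integral_lborel_axes:
  fixes F :: "real^'n \<Rightarrow> ennreal"
  assumes F [measurable]: "F \<in> borel_measurable borel"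
  shows "(\<integral>\<^sup>+x. F x \<partial>lborel) = (\<integral>\<^sup>+x. F (\<Sum>i\<in>UNIV. x (axis i 1 :: real^'n) *\<^sub>R axis i 1)
    \<partial>Pi\<^sub>M ((\<lambda>i. axis i 1) ` UNIV) (\<lambda>_. lborel))"
proof -
  have B: "(Basis :: (real^'n) set) = (\<lambda>i. axis i 1) ` UNIV" by (auto simp: Basis_vec_def)
  have inj: "inj_on (\<lambda>i::'n. axis i (1::real)) UNIV" by (auto simp: inj_on_def axis_eq_axis)
  have "(\<integral>\<^sup>+x. F x \<partial>lborel) = (\<integral>\<^sup>+x. F x \<partial>distr (\<Pi>\<^sub>M b\<in>Basis. lborel) borel (\<lambda>f. \<Sum>b\<in>Basis. f b *\<^sub>R b))"
    by (simp only: lborel_eq[symmetric])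
  also have "\<dots> = (\<integral>\<^sup>+x. F (\<Sum>b\<in>Basis. x b *\<^sub>R b) \<partial>(\<Pi>\<^sub>M b\<in>Basis. lborel))"
    by (intro nn_integral_distr) measurable
  finally show ?thesis unfolding B by (simp add: sum.reindex[OF inj] o_def)
qed

lemma nn_integral_lborel_2:
  fixes F :: "real^'n \<Rightarrow> ennreal"
  assumes F [measurable]: "F \<in> borel_measurable borel" and ij: "i \<noteq> j" "(UNIV :: 'n set) = {i, j}"
  shows "(\<integral>\<^sup>+x. F x \<partial>lborel) = (\<integral>\<^sup>+s. \<integral>\<^sup>+t. F (s *\<^sub>R axis i 1 + t *\<^sub>R axis j 1) \<partial>lborel \<partial>lborel)"
proof -
  interpret product_sigma_finite "\<lambda>_::real^'n. lborel :: real measure" by standard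
  define a b :: "real^'n" where "a = axis i 1" and "b = axis j 1"
  have ne: "a \<noteq> b" using ij by (simp add: a_def b_def axis_eq_axis)
  have "(\<integral>\<^sup>+x. F x \<partial>lborel) = (\<integral>\<^sup>+x. F (x a *\<^sub>R a + x b *\<^sub>R b) \<partial>Pi\<^sub>M {a, b} (\<lambda>_. lborel))"
    by (subst nn_integral_lborel_axes[OF F]) (simp add: a_def b_def ij)
  also have "\<dots> = (\<integral>\<^sup>+s. \<integral>\<^sup>+x. F (s *\<^sub>R a + x b *\<^sub>R b) \<partial>Pi\<^sub>M {b} (\<lambda>_. lborel) \<partial>lborel)"
    using ne by (subst product_nn_integral_insert_rev) auto
  also have "\<dots> = (\<integral>\<^sup>+s. \<integral>\<^sup>+t. F (s *\<^sub>R a + t *\<^sub>R b) \<partial>lborel \<partial>lborel)"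
    by (intro nn_integral_cong product_nn_integral_singleton) simp
  finally show ?thesis by (simp add: a_def b_def)
qed

lemma nn_integral_lborel_3:
  fixes F :: "real^'n \<Rightarrow> ennreal"
  assumes F [measurable]: "F \<in> borel_measurable borel"
    and ijk: "i \<noteq> j" "i \<noteq> k" "j \<noteq> k" "(UNIV :: 'n set) = {i, j, k}"
  shows "(\<integral>\<^sup>+x. F x \<partial>lborel)
    = (\<integral>\<^sup>+r. \<integral>\<^sup>+s. \<integral>\<^sup>+t. F (r *\<^sub>R axis i 1 + s *\<^sub>R axis j 1 + t *\<^sub>R axis k 1) \<partial>lborel \<partial>lborel \<partial>lborel)"
proof -
  interpret product_sigma_finite "\<lambda>_::real^'n. lborel :: real measure" by standard
  define a b c :: "real^'n" where "a = axis i 1" and "b = axis j 1" and "c = axis k 1"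
  have ne: "a \<noteq> b" "a \<noteq> c" "b \<noteq> c" using ijk by (simp_all add: a_def b_def c_def axis_eq_axis)
  have "(\<integral>\<^sup>+x. F x \<partial>lborel) = (\<integral>\<^sup>+x. F (x a *\<^sub>R a + x b *\<^sub>R b + x c *\<^sub>R c) \<partial>Pi\<^sub>M {a, b, c} (\<lambda>_. lborel))"
    by (subst nn_integral_lborel_axes[OF F]) (simp add: a_def b_def c_def ijk add.assoc)
  also have "\<dots> = (\<integral>\<^sup>+r. \<integral>\<^sup>+x. F (r *\<^sub>R a + x b *\<^sub>R b + x c *\<^sub>R c) \<partial>Pi\<^sub>M {b, c} (\<lambda>_. lborel) \<partial>lborel)"
    using ne by (subst product_nn_integral_insert_rev) auto
  also have "\<dots> = (\<integral>\<^sup>+r. \<integral>\<^sup>+s. \<integral>\<^sup>+x. F (r *\<^sub>R a + s *\<^sub>R b + x c *\<^sub>R c) \<partial>Pi\<^sub>M {c} (\<lambda>_. lborel) \<partial>lborel \<partial>lborel)"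
    using ne by (intro nn_integral_cong, subst product_nn_integral_insert_rev) auto
  also have "\<dots> = (\<integral>\<^sup>+r. \<integral>\<^sup>+s. \<integral>\<^sup>+t. F (r *\<^sub>R a + s *\<^sub>R b + t *\<^sub>R c) \<partial>lborel \<partial>lborel \<partial>lborel)"
    by (intro nn_integral_cong product_nn_integral_singleton) simp
  finally show ?thesis by (simp add: a_def b_def c_def)
qed

abbreviation plane_integral :: "(real \<Rightarrow> real \<Rightarrow> ennreal) \<Rightarrow> ennreal" where
  "plane_integral h \<equiv> (\<integral>\<^sup>+s. \<integral>\<^sup>+t. h s t \<partial>lborel \<partial>lborel)"

lemma ennreal_amgm: "2 * x * y \<le> x\<^sup>2 + y\<^sup>2" for x y :: ennreal
proof (cases "x = top \<or> y = top")
  case False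
  then obtain a b where ab: "x = ennreal a" "y = ennreal b" "0 \<le> a" "0 \<le> b"
    by (cases x; cases y) auto
  have "2 * x * y = ennreal (2 * a * b)" using ab by (simp add: ennreal_mult)
  also have "\<dots> \<le> ennreal (a\<^sup>2 + b\<^sup>2)" by (intro ennreal_leI sum_squares_bound)
  also have "\<dots> = x\<^sup>2 + y\<^sup>2" using ab by (simp add: ennreal_power)
  finally show ?thesis .
qed (auto simp: power2_eq_square)

text \<open>By the hypotheses \<open>f\<^sup>2\<close> is bounded by a function \<open>U\<close> of \<open>t\<close> alone and by a function \<open>W\<close> of \<open>s\<close>
  alone. So the integral of \<open>f\<^sup>4\<close> is at most the product of the integrals of \<open>U\<close> and \<open>W\<close>, to which
  the Cauchy-Schwarz inequality applies. Here \<open>p\<close> and \<open>q\<close> stand for the moduli of the two partial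
  derivatives.\<close>

lemma planar_Ladyzhenskaya:
  fixes f p q :: "real \<Rightarrow> real \<Rightarrow> ennreal"
  assumes f: "case_prod f \<in> borel_measurable borel"
    and pm: "case_prod p \<in> borel_measurable borel"
    and qm: "case_prod q \<in> borel_measurable borel"
    and p: "\<And>s t. (f s t)\<^sup>2 \<le> 2 * (\<integral>\<^sup>+s. f s t * p s t \<partial>lborel)"
    and q: "\<And>s t. (f s t)\<^sup>2 \<le> 2 * (\<integral>\<^sup>+t. f s t * q s t \<partial>lborel)"
  shows "(plane_integral (\<lambda>s t. (f s t)^4))
    \<le> 2 * (plane_integral (\<lambda>s t. (f s t)\<^sup>2)
         * (plane_integral (\<lambda>s t. (p s t)\<^sup>2) + plane_integral (\<lambda>s t. (q s t)\<^sup>2)))"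
    (is "?I \<le> 2 * (?A * (?P + ?Q))")
proof -
  have pair: "pair_sigma_finite (lborel :: real measure) (lborel :: real measure)" ..
  have cp: "case_prod h \<in> borel_measurable (lborel \<Otimes>\<^sub>M lborel)"
    if "case_prod h \<in> borel_measurable borel" for h :: "real \<Rightarrow> real \<Rightarrow> ennreal"
    using that by (simp add: lborel_prod)
  note [measurable] = cp[OF f] cp[OF pm] cp[OF qm]
  define U where "U t = 2 * (\<integral>\<^sup>+s. f s t * p s t \<partial>lborel)" for t
  define W where "W s = 2 * (\<integral>\<^sup>+t. f s t * q s t \<partial>lborel)" for s
  have [measurable]: "U \<in> borel_measurable borel" "W \<in> borel_measurable borel"
    unfolding U_def W_def by measurable
  have iter: "plane_integral h = (\<integral>\<^sup>+z. case_prod h z \<partial>(lborel \<Otimes>\<^sub>M lborel))"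
    if "case_prod h \<in> borel_measurable (lborel \<Otimes>\<^sub>M lborel)" for h :: "real \<Rightarrow> real \<Rightarrow> ennreal"
    using lborel.nn_integral_fst[OF that] by simp
  have CS: "(plane_integral (\<lambda>s t. f s t * h s t))\<^sup>2 \<le> ?A * plane_integral (\<lambda>s t. (h s t)\<^sup>2)"
    if [measurable]: "case_prod h \<in> borel_measurable (lborel \<Otimes>\<^sub>M lborel)" for h
    using Cauchy_Schwarz_nn_integral[of "case_prod f" "lborel \<Otimes>\<^sub>M lborel" "case_prod h"]
    by (subst (1 2 3) iter) (auto simp: split_beta')
  have "?I \<le> plane_integral (\<lambda>s t. W s * U t)"
  proof (intro nn_integral_mono)
    fix s t
    have "(f s t)^4 = (f s t)\<^sup>2 * (f s t)\<^sup>2" by (simp flip: power_add)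
    also have "\<dots> \<le> W s * U t" unfolding W_def U_def by (intro mult_mono p q) auto
    finally show "(f s t)^4 \<le> W s * U t" .
  qed
  also have "\<dots> = (\<integral>\<^sup>+s. W s \<partial>lborel) * (\<integral>\<^sup>+t. U t \<partial>lborel)"
    by (simp add: nn_integral_cmult nn_integral_multc)
  also have "(\<integral>\<^sup>+t. U t \<partial>lborel) = 2 * plane_integral (\<lambda>s t. f s t * p s t)"
  proof -
    have "(\<integral>\<^sup>+t. \<integral>\<^sup>+s. f s t * p s t \<partial>lborel \<partial>lborel) = plane_integral (\<lambda>s t. f s t * p s t)"
      by (rule pair_sigma_finite.Fubini'[OF pair]) measurable
    moreover have "(\<integral>\<^sup>+t. U t \<partial>lborel) = 2 * (\<integral>\<^sup>+t. \<integral>\<^sup>+s. f s t * p s t \<partial>lborel \<partial>lborel)"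
      unfolding U_def by (rule nn_integral_cmult) measurable
    ultimately show ?thesis by simp
  qed
  also have "(\<integral>\<^sup>+s. W s \<partial>lborel) = 2 * plane_integral (\<lambda>s t. f s t * q s t)"
    unfolding W_def by (rule nn_integral_cmult) measurable
  finally have "?I \<le> 2 * (2 * plane_integral (\<lambda>s t. f s t * q s t) * plane_integral (\<lambda>s t. f s t * p s t))"
    by (simp add: mult_ac)
  also have "\<dots> \<le> 2 * ((plane_integral (\<lambda>s t. f s t * q s t))\<^sup>2 + (plane_integral (\<lambda>s t. f s t * p s t))\<^sup>2)"
    by (intro mult_left_mono ennreal_amgm) simp
  also have "\<dots> \<le> 2 * (?A * ?Q + ?A * ?P)"
    by (intro mult_left_mono add_mono CS) auto
  finally show ?thesis by (simp add: distrib_left add.commute)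
qed

text \<open>Integrate the derivative \<open>2 \<psi> \<psi>'\<close> of \<open>\<psi>\<^sup>2\<close> along the line from a point \<open>- T\<close> outside the support.\<close>

lemma test_function_line_bound:
  fixes g :: "real^'n \<Rightarrow> real"
  assumes g: "g \<in> test_functions \<Omega>"
  shows "(ennreal \<bar>g (y + s *\<^sub>R axis i 1)\<bar>)\<^sup>2
    \<le> 2 * (\<integral>\<^sup>+t. ennreal \<bar>g (y + t *\<^sub>R axis i 1)\<bar> * ennreal \<bar>partial_deriv i g (y + t *\<^sub>R axis i 1)\<bar> \<partial>lborel)"
proof -
  define \<psi> where "\<psi> t = g (y + t *\<^sub>R axis i 1)" for t
  define d where "d t = partial_deriv i g (y + t *\<^sub>R axis i 1)" for t
  have \<psi>: "(\<psi> has_real_derivative d t) (at t)" for t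
    unfolding \<psi>_def d_def by (rule partial_deriv_line[OF test_function_differentiable[OF g]])
  have cont: "continuous_on UNIV \<psi>" "continuous_on UNIV d"
    unfolding \<psi>_def d_def
    by (intro continuous_on_compose2[OF test_function_continuous[OF g]]
      continuous_on_compose2[OF test_function_continuous[OF test_function_partial_deriv[OF g]]]
      continuous_intros; auto)+
  obtain R where R: "\<And>x. x \<in> closure {x. g x \<noteq> 0} \<Longrightarrow> norm x \<le> R"
    using compact_imp_bounded[OF test_function_support(1)[OF g]] by (auto simp: bounded_iff)
  define T where "T = \<bar>R\<bar> + norm y + \<bar>s\<bar> + 1"
  have Ts: "- T \<le> s" and T: "0 \<le> T" "\<bar>R\<bar> + norm y < T"
    using norm_ge_zero[of y] abs_ge_minus_self[of s] abs_ge_zero[of s] abs_ge_zero[of R]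
    unfolding T_def by linarith+
  have "\<psi> (- T) = 0"
  proof -
    have "norm ((- T) *\<^sub>R axis i 1 :: real^'n) \<le> norm (y + (- T) *\<^sub>R axis i 1) + norm y"
      using norm_triangle_ineq4[of "y + (- T) *\<^sub>R axis i 1" y] by simp
    moreover have "norm ((- T) *\<^sub>R axis i 1 :: real^'n) = T" using T by (simp add: norm_axis_1)
    ultimately have "\<not> norm (y + (- T) *\<^sub>R axis i 1) \<le> R" using T by linarith
    then have "y + (- T) *\<^sub>R axis i 1 \<notin> closure {x. g x \<noteq> 0}" using R[of "y + (- T) *\<^sub>R axis i 1"] by argo
    then show ?thesis unfolding \<psi>_def by (rule test_function_support(3)[OF g])
  qed
  have int: "integrable lborel (\<lambda>t. indicator {- T..s} t *\<^sub>R (2 * \<psi> t * d t))"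
    using cont by (intro borel_integrable_compact continuous_intros) (auto intro: continuous_on_subset)
  have "(\<integral>t. indicator {- T..s} t *\<^sub>R (2 * \<psi> t * d t) \<partial>lborel) = (\<psi> s)\<^sup>2 - (\<psi> (- T))\<^sup>2"
  proof (rule integral_FTC_Icc[OF Ts])
    show "((\<lambda>t. (\<psi> t)\<^sup>2) has_vector_derivative 2 * \<psi> t * d t) (at t within {- T..s})" for t
    proof -
      have "((\<lambda>t. (\<psi> t)\<^sup>2) has_real_derivative 2 * \<psi> t * d t) (at t)"
        using DERIV_power[OF \<psi>[of t], of 2] by (simp add: mult_ac)
      then show ?thesis
        by (simp add: has_real_derivative_iff_has_vector_derivative has_vector_derivative_at_within)
    qed
    show "continuous_on {- T..s} (\<lambda>t. 2 * \<psi> t * d t)"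
      using cont by (intro continuous_intros) (auto intro: continuous_on_subset)
  qed
  then have "ennreal ((\<psi> s)\<^sup>2) = ennreal (norm (\<integral>t. indicator {- T..s} t *\<^sub>R (2 * \<psi> t * d t) \<partial>lborel))"
    using \<open>\<psi> (- T) = 0\<close> by simp
  also have "\<dots> \<le> (\<integral>\<^sup>+t. norm (indicator {- T..s} t *\<^sub>R (2 * \<psi> t * d t)) \<partial>lborel)"
    by (rule integral_norm_bound_ennreal[OF int])
  also have "\<dots> \<le> (\<integral>\<^sup>+t. 2 * (ennreal \<bar>\<psi> t\<bar> * ennreal \<bar>d t\<bar>) \<partial>lborel)"
  proof (intro nn_integral_mono)
    fix t
    have "ennreal (norm (indicator {- T..s} t *\<^sub>R (2 * \<psi> t * d t))) \<le> ennreal (2 * (\<bar>\<psi> t\<bar> * \<bar>d t\<bar>))"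
      by (intro ennreal_leI) (auto simp: indicator_def abs_mult)
    also have "\<dots> = 2 * (ennreal \<bar>\<psi> t\<bar> * ennreal \<bar>d t\<bar>)" by (simp add: ennreal_mult)
    finally show "ennreal (norm (indicator {- T..s} t *\<^sub>R (2 * \<psi> t * d t))) \<le> 2 * (ennreal \<bar>\<psi> t\<bar> * ennreal \<bar>d t\<bar>)" .
  qed
  also have "\<dots> = 2 * (\<integral>\<^sup>+t. ennreal \<bar>\<psi> t\<bar> * ennreal \<bar>d t\<bar> \<partial>lborel)"
  proof (rule nn_integral_cmult)
    note [measurable] = cont[THEN borel_measurable_continuous_onI]
    show "(\<lambda>t. ennreal \<bar>\<psi> t\<bar> * ennreal \<bar>d t\<bar>) \<in> borel_measurable lborel" by measurable
  qed
  finally show ?thesis by (simp add: \<psi>_def d_def ennreal_power)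
qed

text \<open>In the plane this is the planar inequality. In space the planar inequality is applied on each
  slice orthogonal to the first axis. The integral of \<open>g\<^sup>2\<close> over a slice is bounded independently of the
  slice, by the line bound in the direction of the first axis, and the remaining factor is integrated
  over all slices.\<close>

lemma Ladyzhenskaya:
  fixes g :: "real^'n \<Rightarrow> real"
  assumes dim: "CARD('n) \<in> {2, 3}" and g: "g \<in> test_functions \<Omega>"
    and K: "(\<integral>\<^sup>+x. ennreal ((g x)\<^sup>2) \<partial>lborel) \<le> K" "\<And>i. (\<integral>\<^sup>+x. ennreal ((partial_deriv i g x)\<^sup>2) \<partial>lborel) \<le> K"
  shows "(\<integral>\<^sup>+x. ennreal ((g x)^4) \<partial>lborel) \<le> 8 * K\<^sup>2"
proof -
  define f where "f x = ennreal \<bar>g x\<bar>" for x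
  define p where "p i x = ennreal \<bar>partial_deriv i g x\<bar>" for i x
  note [measurable] = test_function_borel[OF g] test_function_borel[OF test_function_partial_deriv[OF g]]
  have fm [measurable]: "f \<in> borel_measurable borel" and pm [measurable]: "p i \<in> borel_measurable borel" for i
    unfolding f_def p_def by measurable
  have fK: "(\<integral>\<^sup>+x. (f x)\<^sup>2 \<partial>lborel) \<le> K" and pK: "(\<integral>\<^sup>+x. (p i x)\<^sup>2 \<partial>lborel) \<le> K" for i
    using K by (simp_all add: f_def p_def ennreal_power)
  have f4: "(\<integral>\<^sup>+x. ennreal ((g x)^4) \<partial>lborel) = (\<integral>\<^sup>+x. (f x)^4 \<partial>lborel)"
    by (simp add: f_def ennreal_power power_even_abs)
  have line: "(f (y + s *\<^sub>R axis i 1))\<^sup>2 \<le> 2 * (\<integral>\<^sup>+t. f (y + t *\<^sub>R axis i 1) * p i (y + t *\<^sub>R axis i 1) \<partial>lborel)"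
    for y s i unfolding f_def p_def by (rule test_function_line_bound[OF g])
  have plane: "(\<lambda>(s, t). h (y + s *\<^sub>R axis i 1 + t *\<^sub>R axis j 1)) \<in> borel_measurable borel"
    if h: "h \<in> borel_measurable borel" for h :: "real^'n \<Rightarrow> ennreal" and y i j
  proof -
    have "(\<lambda>z::real \<times> real. y + fst z *\<^sub>R axis i 1 + snd z *\<^sub>R axis j 1) \<in> borel_measurable borel"
      by (intro borel_measurable_continuous_onI continuous_intros)
    from measurable_compose[OF this h] show ?thesis by (simp add: split_beta')
  qed
  have slice: "(plane_integral (\<lambda>s t. (f (y + s *\<^sub>R axis i 1 + t *\<^sub>R axis j 1))^4))
    \<le> 2 * (plane_integral (\<lambda>s t. (f (y + s *\<^sub>R axis i 1 + t *\<^sub>R axis j 1))\<^sup>2)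
         * (plane_integral (\<lambda>s t. (p i (y + s *\<^sub>R axis i 1 + t *\<^sub>R axis j 1))\<^sup>2)
          + plane_integral (\<lambda>s t. (p j (y + s *\<^sub>R axis i 1 + t *\<^sub>R axis j 1))\<^sup>2)))" for y i j
  proof (rule planar_Ladyzhenskaya)
    show "(f (y + s *\<^sub>R axis i 1 + t *\<^sub>R axis j 1))\<^sup>2 \<le> 2 * (\<integral>\<^sup>+s. f (y + s *\<^sub>R axis i 1 + t *\<^sub>R axis j 1)
        * p i (y + s *\<^sub>R axis i 1 + t *\<^sub>R axis j 1) \<partial>lborel)" for s t
      using line[of "y + t *\<^sub>R axis j 1" s i] by (simp add: add_ac)
    show "(f (y + s *\<^sub>R axis i 1 + t *\<^sub>R axis j 1))\<^sup>2 \<le> 2 * (\<integral>\<^sup>+t. f (y + s *\<^sub>R axis i 1 + t *\<^sub>R axis j 1)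
        * p j (y + s *\<^sub>R axis i 1 + t *\<^sub>R axis j 1) \<partial>lborel)" for s t
      by (rule line)
  qed (rule plane[OF fm] plane[OF pm])+
  have double: "2 * ((K + K) * (K + K)) = 8 * K\<^sup>2"
    by (simp add: power2_eq_square mult_ac flip: mult_2)
  consider (two) i j :: 'n where "i \<noteq> j" "(UNIV :: 'n set) = {i, j}"
    | (three) i j k :: 'n where "i \<noteq> j" "i \<noteq> k" "j \<noteq> k" "(UNIV :: 'n set) = {i, j, k}"
    using dim by (auto simp: card_2_iff card_3_iff)
  then show ?thesis
  proof cases
    case two
    note coords = nn_integral_lborel_2[OF _ two]
    have "(\<integral>\<^sup>+x. (f x)^4 \<partial>lborel)
        \<le> 2 * ((\<integral>\<^sup>+x. (f x)\<^sup>2 \<partial>lborel) * ((\<integral>\<^sup>+x. (p i x)\<^sup>2 \<partial>lborel) + (\<integral>\<^sup>+x. (p j x)\<^sup>2 \<partial>lborel)))"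
      using slice[of 0 i j] by (simp add: coords)
    also have "\<dots> \<le> 2 * (K * (K + K))"
      by (intro mult_left_mono mult_mono add_mono fK pK) auto
    also have "\<dots> \<le> 2 * ((K + K) * (K + K))"
      by (intro mult_left_mono mult_right_mono) (simp_all add: add_increasing)
    finally show ?thesis using f4 double by simp
  next
    case three
    note coords = nn_integral_lborel_3[OF _ three]
    let ?x = "\<lambda>r s t. r *\<^sub>R axis i 1 + s *\<^sub>R axis j 1 + t *\<^sub>R axis k 1 :: real^'n"
    have A: "(plane_integral (\<lambda>s t. (f (?x r s t))\<^sup>2)) \<le> K + K" for r
    proof -
      have "(plane_integral (\<lambda>s t. (f (?x r s t))\<^sup>2))
          \<le> (\<integral>\<^sup>+s. \<integral>\<^sup>+t. \<integral>\<^sup>+r. 2 * (f (?x r s t) * p i (?x r s t)) \<partial>lborel \<partial>lborel \<partial>lborel)"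
      proof (intro nn_integral_mono)
        fix s t
        have "(f (?x r s t))\<^sup>2 \<le> 2 * (\<integral>\<^sup>+r. f (?x r s t) * p i (?x r s t) \<partial>lborel)"
          using line[of "s *\<^sub>R axis j 1 + t *\<^sub>R axis k 1" r i] by (simp add: add_ac)
        then show "(f (?x r s t))\<^sup>2 \<le> (\<integral>\<^sup>+r. 2 * (f (?x r s t) * p i (?x r s t)) \<partial>lborel)"
          by (simp add: nn_integral_cmult)
      qed
      also have "\<dots> = (\<integral>\<^sup>+x. 2 * (f x * p i x) \<partial>lborel)"
        using nn_integral_lborel_3[of "\<lambda>x. 2 * (f x * p i x)" j k i] three by (simp add: add_ac insert_commute)
      also have "\<dots> \<le> (\<integral>\<^sup>+x. (f x)\<^sup>2 + (p i x)\<^sup>2 \<partial>lborel)"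
        using ennreal_amgm by (intro nn_integral_mono) (simp add: mult.assoc)
      also have "\<dots> \<le> K + K"
        by (subst nn_integral_add) (auto intro!: add_mono fK pK)
      finally show ?thesis .
    qed
    have "(\<integral>\<^sup>+x. (f x)^4 \<partial>lborel) = (\<integral>\<^sup>+r. \<integral>\<^sup>+s. \<integral>\<^sup>+t. (f (?x r s t))^4 \<partial>lborel \<partial>lborel \<partial>lborel)"
      by (rule coords) measurable
    also have "\<dots> \<le> (\<integral>\<^sup>+r. 2 * ((K + K) * (plane_integral (\<lambda>s t. (p j (?x r s t))\<^sup>2)
        + plane_integral (\<lambda>s t. (p k (?x r s t))\<^sup>2))) \<partial>lborel)"
      by (intro nn_integral_mono order_trans[OF slice] mult_left_mono mult_right_mono A) auto
    also have "\<dots> = 2 * ((K + K) * ((\<integral>\<^sup>+x. (p j x)\<^sup>2 \<partial>lborel) + (\<integral>\<^sup>+x. (p k x)\<^sup>2 \<partial>lborel)))"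
      by (simp add: nn_integral_cmult nn_integral_add coords)
    also have "\<dots> \<le> 2 * ((K + K) * (K + K))"
      by (intro mult_left_mono add_mono pK) auto
    finally show ?thesis using f4 double by simp
  qed
qed

section \<open>Fourth powers of velocity fields are integrable\<close>

lemma sum_power4_bound:
  fixes y :: "real^'n"
  shows "norm y ^ 4 \<le> real CARD('n) * (\<Sum>i\<in>UNIV. (y $ i)^4)"
proof -
  have "norm y ^ 4 = ((norm y)\<^sup>2)\<^sup>2" by simp
  also have "\<dots> = (\<Sum>i\<in>UNIV. (y $ i)\<^sup>2)\<^sup>2"
    by (simp add: norm_vec_def L2_set_def sum_nonneg)
  also have "\<dots> \<le> (\<Sum>i\<in>UNIV. ((y $ i)\<^sup>2)\<^sup>2) * real CARD('n)"
    by (rule sum_squared_le_sum_of_squares)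
  finally show ?thesis by (simp add: mult.commute)
qed

text \<open>The constant depends on the test field only through its Sobolev norm, so that it is uniform along
  convergent sequences.\<close>

lemma test_field_L4_bound:
  fixes \<phi> :: "real^'n \<Rightarrow> real^'n"
  assumes dim: "CARD('n) \<in> {2, 3}" and \<Omega>: "open \<Omega>" and \<phi>: "\<phi> \<in> test_fields \<Omega>"
  shows "(\<integral>\<^sup>+x. ennreal ((\<phi> x $ i)^4) \<partial>lebesgue_on \<Omega>) \<le> ennreal (8 * (H1_norm \<Omega> \<phi>)^4)"
proof -
  define g where "g = (\<lambda>x. \<phi> x $ i)"
  have g: "g \<in> test_functions \<Omega>" using \<phi> by (simp add: test_fields_def g_def)
  note H1 = test_field_H1[OF \<Omega> \<phi>]
  have restrict: "(\<integral>\<^sup>+x. ennreal (h x ^ n) \<partial>lebesgue_on \<Omega>) = (\<integral>\<^sup>+x. ennreal (h x ^ n) \<partial>lborel)"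
    if h: "h \<in> test_functions \<Omega>" "n > 0" for h :: "real^'n \<Rightarrow> real" and n
    using test_function_borel[OF h(1)] test_function_eq_0[OF h(1)] h(2)
    by (intro lebesgue_on_supported(3)[OF \<Omega>]) auto
  have sq: "(H1_norm \<Omega> \<phi>)\<^sup>2 = (L2_norm \<Omega> \<phi>)\<^sup>2 + (L2_norm \<Omega> (wgrad \<Omega> \<phi>))\<^sup>2"
    by (simp add: H1_norm_def)
  have "(\<integral>\<^sup>+x. ennreal ((g x)\<^sup>2) \<partial>lborel) \<le> ennreal ((H1_norm \<Omega> \<phi>)\<^sup>2)"
  proof -
    have "(\<integral>\<^sup>+x. ennreal ((g x)\<^sup>2) \<partial>lborel) = (\<integral>\<^sup>+x. ennreal ((g x)\<^sup>2) \<partial>lebesgue_on \<Omega>)"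
      using restrict[OF g, of 2] by simp
    also have "\<dots> \<le> (\<integral>\<^sup>+x. ennreal ((norm (\<phi> x))\<^sup>2) \<partial>lebesgue_on \<Omega>)"
      using component_le_norm_cart by (intro nn_integral_mono ennreal_leI) (simp add: g_def abs_le_square_iff[symmetric])
    also have "\<dots> \<le> ennreal ((H1_norm \<Omega> \<phi>)\<^sup>2)"
      by (simp add: L2_norm_sq_nn_integral[OF H1_space_L2[OF H1(1)]] sq ennreal_leI)
    finally show ?thesis .
  qed
  moreover have "(\<integral>\<^sup>+x. ennreal ((partial_deriv j g x)\<^sup>2) \<partial>lborel) \<le> ennreal ((H1_norm \<Omega> \<phi>)\<^sup>2)" for j
  proof -
    have "(\<integral>\<^sup>+x. ennreal ((partial_deriv j g x)\<^sup>2) \<partial>lborel) = (\<integral>\<^sup>+x. ennreal ((partial_deriv j g x)\<^sup>2) \<partial>lebesgue_on \<Omega>)"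
      using restrict[OF test_function_partial_deriv[OF g], of 2] by simp
    also have "\<dots> \<le> (\<integral>\<^sup>+x. ennreal ((norm (wgrad \<Omega> \<phi> x))\<^sup>2) \<partial>lebesgue_on \<Omega>)"
    proof (intro nn_integral_mono_AE, use H1(2) in eventually_elim)
      fix x assume "\<forall>i j. wgrad \<Omega> \<phi> x $ i $ j = partial_deriv j (\<lambda>x. \<phi> x $ i) x"
      then have "partial_deriv j g x = wgrad \<Omega> \<phi> x $ i $ j" by (simp add: g_def)
      moreover have "norm (wgrad \<Omega> \<phi> x $ i $ j) \<le> norm (wgrad \<Omega> \<phi> x)"
        by (rule order_trans[OF vec_component_norm_le vec_component_norm_le])
      ultimately show "ennreal ((partial_deriv j g x)\<^sup>2) \<le> ennreal ((norm (wgrad \<Omega> \<phi> x))\<^sup>2)"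
        by (intro ennreal_leI) (simp add: abs_le_square_iff[symmetric])
    qed
    also have "\<dots> \<le> ennreal ((H1_norm \<Omega> \<phi>)\<^sup>2)"
      by (simp add: L2_norm_sq_nn_integral[OF wgrad_props(1)[OF H1(1)]] sq ennreal_leI)
    finally show ?thesis .
  qed
  ultimately have "(\<integral>\<^sup>+x. ennreal ((g x)^4) \<partial>lborel) \<le> 8 * (ennreal ((H1_norm \<Omega> \<phi>)\<^sup>2))\<^sup>2"
    by (rule Ladyzhenskaya[OF dim g])
  also have "\<dots> = ennreal (8 * (H1_norm \<Omega> \<phi>)^4)"
    by (simp add: ennreal_power ennreal_mult)
  finally show ?thesis using restrict[OF g, of 4] by (simp add: g_def)
qed

text \<open>Approximating test fields are bounded in the Sobolev norm and have an almost everywhere convergent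
  subsequence, so Fatou's lemma applies to the fourth powers of the components.\<close>

lemma X_space_L4:
  fixes v :: "real^'n \<Rightarrow> real^'n"
  assumes dim: "CARD('n) \<in> {2, 3}" and \<Omega>: "open \<Omega>" and v: "v \<in> X_space \<Omega>"
  shows "integrable (lebesgue_on \<Omega>) (\<lambda>x. norm (v x) ^ 4)"
proof -
  interpret H: semi_inner "H1_space \<Omega>" "H1_inner \<Omega>" by (rule semi_inner_H1[OF \<Omega>])
  note nrm = semi_inner_H1_nrm[OF \<Omega>]
  note vH = X_space_H1[OF v]
  note [measurable] = L2_space_measurable[OF H1_space_L2[OF vH]]
  obtain \<phi> where \<phi>: "\<And>n. \<phi> n \<in> test_fields \<Omega>" "(\<lambda>n. H1_norm \<Omega> (v - \<phi> n)) \<longlonglongrightarrow> 0"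
    using v by (auto simp: X_space_def fun_diff_def)
  note \<phi>H = test_field_H1(1)[OF \<Omega> \<phi>(1)]
  note [measurable] = L2_space_measurable[OF H1_space_L2[OF \<phi>H]]
  have "Bseq (\<lambda>n. H1_norm \<Omega> (v - \<phi> n))" using convergentI[OF \<phi>(2)] by (rule convergent_imp_Bseq)
  from BseqD[OF this] obtain B0 where B0: "\<And>n. norm (H1_norm \<Omega> (v - \<phi> n)) \<le> B0" by blast
  define B where "B = H1_norm \<Omega> v + B0"
  have B: "0 \<le> H1_norm \<Omega> (\<phi> n)" "H1_norm \<Omega> (\<phi> n) \<le> B" for n
  proof -
    have "\<bar>H1_norm \<Omega> v - H1_norm \<Omega> (\<phi> n)\<bar> \<le> H1_norm \<Omega> (v - \<phi> n)"
      using H.nrm_diff_le[OF vH \<phi>H] by (simp only: nrm[OF vH] nrm[OF \<phi>H] nrm[OF H.diff_mem[OF vH \<phi>H]])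
    then show "H1_norm \<Omega> (\<phi> n) \<le> B" using B0[of n] by (simp add: B_def)
    show "0 \<le> H1_norm \<Omega> (\<phi> n)" by (simp add: H1_norm_def)
  qed
  have "(\<lambda>n. L2_norm \<Omega> (v - \<phi> n)) \<longlonglongrightarrow> 0"
    using \<phi>(2) H1_norm_tendsto_0_iff[OF H.diff_mem[OF vH \<phi>H]] by simp
  then have "(\<lambda>n. L2_norm \<Omega> (\<phi> n - v)) \<longlonglongrightarrow> 0"
    using L2.nrm_minus_commute[OF H1_space_L2[OF vH] H1_space_L2[OF \<phi>H]] by simp
  then obtain r :: "nat \<Rightarrow> nat" where "strict_mono r"
    and r: "AE x in lebesgue_on \<Omega>. (\<lambda>n. \<phi> (r n) x) \<longlonglongrightarrow> v x"
    by (rule L2_AE_subseq[where s = \<phi> and l = v, OF H1_space_L2[OF \<phi>H] H1_space_L2[OF vH]])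
  have comp_meas: "(\<lambda>x. w x $ i) \<in> borel_measurable (lebesgue_on \<Omega>)" if "w \<in> H1_space \<Omega>" for w i
    by (rule L2_space_measurable[OF L2_component[OF H1_space_L2[OF that]]])
  have comp: "integrable (lebesgue_on \<Omega>) (\<lambda>x. (v x $ i)^4)" for i
  proof (rule integrableI_bounded)
    show "(\<lambda>x. (v x $ i)^4) \<in> borel_measurable (lebesgue_on \<Omega>)"
      using comp_meas[OF vH] by measurable
    have "(\<integral>\<^sup>+x. norm ((v x $ i)^4) \<partial>lebesgue_on \<Omega>)
        \<le> (\<integral>\<^sup>+x. liminf (\<lambda>n. ennreal ((\<phi> (r n) x $ i)^4)) \<partial>lebesgue_on \<Omega>)"
    proof (intro nn_integral_mono_AE, use r in eventually_elim)
      fix x assume "(\<lambda>n. \<phi> (r n) x) \<longlonglongrightarrow> v x"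
      then have "(\<lambda>n. ennreal ((\<phi> (r n) x $ i)^4)) \<longlonglongrightarrow> ennreal ((v x $ i)^4)"
        by (intro tendsto_intros)
      from lim_imp_Liminf[OF trivial_limit_sequentially this]
      show "ennreal (norm ((v x $ i)^4)) \<le> liminf (\<lambda>n. ennreal ((\<phi> (r n) x $ i)^4))"
        by simp
    qed
    also have "\<dots> \<le> liminf (\<lambda>n. \<integral>\<^sup>+x. ennreal ((\<phi> (r n) x $ i)^4) \<partial>lebesgue_on \<Omega>)"
    proof (rule nn_integral_liminf)
      show "(\<lambda>x. ennreal ((\<phi> (r n) x $ i)^4)) \<in> borel_measurable (lebesgue_on \<Omega>)" for n
        using comp_meas[OF \<phi>H, of "r n" i] by measurable
    qed
    also have "\<dots> \<le> liminf (\<lambda>n::nat. ennreal (8 * B^4))"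
    proof (rule Liminf_mono, rule always_eventually, rule allI)
      fix n
      have "(\<integral>\<^sup>+x. ennreal ((\<phi> (r n) x $ i)^4) \<partial>lebesgue_on \<Omega>) \<le> ennreal (8 * (H1_norm \<Omega> (\<phi> (r n)))^4)"
        by (rule test_field_L4_bound[OF dim \<Omega> \<phi>(1)])
      also have "\<dots> \<le> ennreal (8 * B^4)"
        by (intro ennreal_leI mult_left_mono power_mono B) auto
      finally show "(\<integral>\<^sup>+x. ennreal ((\<phi> (r n) x $ i)^4) \<partial>lebesgue_on \<Omega>) \<le> ennreal (8 * B^4)" .
    qed
    also have "\<dots> = ennreal (8 * B^4)" by (simp add: Liminf_const)
    finally show "(\<integral>\<^sup>+x. norm ((v x $ i)^4) \<partial>lebesgue_on \<Omega>) < \<infinity>"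
      using le_less_trans[OF _ ennreal_less_top] by (simp add: infinity_ennreal_def)
  qed
  show ?thesis
  proof (rule Bochner_Integration.integrable_bound)
    show "integrable (lebesgue_on \<Omega>) (\<lambda>x. real CARD('n) * (\<Sum>i\<in>UNIV. (v x $ i)^4))"
      using comp by (intro integrable_mult_right Bochner_Integration.integrable_sum) auto
    show "(\<lambda>x. norm (v x) ^ 4) \<in> borel_measurable (lebesgue_on \<Omega>)" by measurable
    show "AE x in lebesgue_on \<Omega>. norm (norm (v x) ^ 4) \<le> norm (real CARD('n) * (\<Sum>i\<in>UNIV. (v x $ i)^4))"
    proof (rule AE_I2)
      fix x
      show "norm (norm (v x) ^ 4) \<le> norm (real CARD('n) * (\<Sum>i\<in>UNIV. (v x $ i)^4))"
        using sum_power4_bound[of "v x"] by simp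
    qed
  qed
qed

section \<open>The convection form\<close>

text \<open>\<open>a b c \<le> a\<^sup>2 + b\<^sup>4 + c\<^sup>4\<close> for real numbers, so the product of a square integrable function with two
  velocity fields is integrable.\<close>

lemma triple_product_integrable:
  fixes v z :: "real^'n \<Rightarrow> real^'n" and B :: "'b::euclidean_space \<Rightarrow> real^'n \<Rightarrow> real^'n"
  assumes dim: "CARD('n) \<in> {2, 3}" and \<Omega>: "open \<Omega>" and B: "bounded_bilinear B"
    and g: "g \<in> L2_space \<Omega>" and v: "v \<in> X_space \<Omega>" and z: "z \<in> X_space \<Omega>"
  shows "integrable (lebesgue_on \<Omega>) (\<lambda>x. B (g x) (v x) \<bullet> z x)"
proof -
  obtain K where K: "0 \<le> K" "\<And>a b. norm (B a b) \<le> norm a * norm b * K"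
    using bounded_bilinear.nonneg_bounded[OF B] by blast
  note L2 = X_space_H1[THEN H1_space_L2]
  have meas: "(\<lambda>x. B (g x) (v x)) \<in> borel_measurable (lebesgue_on \<Omega>)"
    by (rule borel_measurable_continuous_Pair[OF L2_space_measurable[OF g] L2_space_measurable[OF L2[OF v]]])
       (intro bounded_bilinear.continuous_on[OF B] continuous_intros)
  show ?thesis
  proof (rule Bochner_Integration.integrable_bound)
    show "integrable (lebesgue_on \<Omega>) (\<lambda>x. K * ((norm (g x))\<^sup>2 + (norm (v x) ^ 4 + norm (z x) ^ 4)))"
      by (intro integrable_mult_right Bochner_Integration.integrable_add L2_space_integrable_sq[OF g]
          X_space_L4[OF dim \<Omega>] v z)
    show "(\<lambda>x. B (g x) (v x) \<bullet> z x) \<in> borel_measurable (lebesgue_on \<Omega>)"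
      by (rule borel_measurable_inner[OF meas L2_space_measurable[OF L2[OF z]]])
    have bound: "a * b * c \<le> a\<^sup>2 + (b^4 + c^4)" for a b c :: real
    proof -
      have "2 * a * (b * c) \<le> a\<^sup>2 + (b * c)\<^sup>2" by (rule sum_squares_bound)
      moreover have "2 * b\<^sup>2 * c\<^sup>2 \<le> (b\<^sup>2)\<^sup>2 + (c\<^sup>2)\<^sup>2" by (rule sum_squares_bound)
      moreover have "(b * c)\<^sup>2 = b\<^sup>2 * c\<^sup>2" "(b\<^sup>2)\<^sup>2 = b^4" "(c\<^sup>2)\<^sup>2 = c^4"
        by (simp_all add: power_mult_distrib)
      moreover have "0 \<le> a\<^sup>2" "0 \<le> b^4" "0 \<le> c^4" by simp_all
      ultimately show ?thesis unfolding mult.assoc by linarith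
    qed
    show "AE x in lebesgue_on \<Omega>. norm (B (g x) (v x) \<bullet> z x)
        \<le> norm (K * ((norm (g x))\<^sup>2 + (norm (v x) ^ 4 + norm (z x) ^ 4)))"
    proof (rule AE_I2)
      fix x
      have "norm (B (g x) (v x) \<bullet> z x) \<le> norm (B (g x) (v x)) * norm (z x)"
        by (simp add: Cauchy_Schwarz_ineq2)
      also have "\<dots> \<le> (norm (g x) * norm (v x) * K) * norm (z x)"
        by (intro mult_right_mono K) auto
      also have "\<dots> = K * (norm (g x) * norm (v x) * norm (z x))" by simp
      also have "\<dots> \<le> K * ((norm (g x))\<^sup>2 + (norm (v x) ^ 4 + norm (z x) ^ 4))"
        by (intro mult_left_mono bound K)
      also have "\<dots> \<le> norm (K * ((norm (g x))\<^sup>2 + (norm (v x) ^ 4 + norm (z x) ^ 4)))" by simp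
      finally show "norm (B (g x) (v x) \<bullet> z x)
        \<le> norm (K * ((norm (g x))\<^sup>2 + (norm (v x) ^ 4 + norm (z x) ^ 4)))" .
    qed
  qed
qed

text \<open>Both halves of the convection form have this shape: the product of a matrix with a vector for the
  gradient term, and of a scalar with a vector for the divergence term.\<close>

definition triple_product where
  "triple_product \<Omega> B g v z = L2_inner \<Omega> (\<lambda>x. B (g x) (v x)) z"

lemma triple_product_linear:
  fixes v z :: "real^'n \<Rightarrow> real^'n" and B :: "'b::euclidean_space \<Rightarrow> real^'n \<Rightarrow> real^'n"
  assumes dim: "CARD('n) \<in> {2, 3}" and \<Omega>: "open \<Omega>" and B: "bounded_bilinear B"
  shows "v \<in> X_space \<Omega> \<Longrightarrow> z \<in> X_space \<Omega> \<Longrightarrow> linear_form (L2_space \<Omega>) (\<lambda>g. triple_product \<Omega> B g v z)"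
    and "g \<in> L2_space \<Omega> \<Longrightarrow> z \<in> X_space \<Omega> \<Longrightarrow> linear_form (X_space \<Omega>) (\<lambda>v. triple_product \<Omega> B g v z)"
    and "g \<in> L2_space \<Omega> \<Longrightarrow> v \<in> X_space \<Omega> \<Longrightarrow> linear_form (X_space \<Omega>) (triple_product \<Omega> B g v)"
  using triple_product_integrable[OF dim \<Omega> B]
  by (auto simp: linear_form_def triple_product_def L2_inner_def inner_add_left inner_add_right
      bounded_bilinear.add_left[OF B] bounded_bilinear.add_right[OF B]
      bounded_bilinear.scaleR_left[OF B] bounded_bilinear.scaleR_right[OF B])

lemma triple_product_cong_AE:
  fixes v z :: "real^'n \<Rightarrow> real^'n" and B :: "'b::euclidean_space \<Rightarrow> real^'n \<Rightarrow> real^'n"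
  assumes dim: "CARD('n) \<in> {2, 3}" and \<Omega>: "open \<Omega>" and B: "bounded_bilinear B"
    and g: "g \<in> L2_space \<Omega>" "h \<in> L2_space \<Omega>" and v: "v \<in> X_space \<Omega>" and z: "z \<in> X_space \<Omega>"
    and eq: "AE x in lebesgue_on \<Omega>. g x = h x"
  shows "triple_product \<Omega> B g v z = triple_product \<Omega> B h v z"
  unfolding triple_product_def L2_inner_def
  using triple_product_integrable[OF dim \<Omega> B _ v z] g eq
  by (intro integral_cong_AE) (auto elim!: eventually_mono)

lemma bounded_bilinear_matrix_vector: "bounded_bilinear ((*v) :: real^'n^'m \<Rightarrow> real^'n \<Rightarrow> real^'m)"
  unfolding bilinear_conv_bounded_bilinear[symmetric] bilinear_def
  by (intro conjI allI linearI)
     (simp_all add: matrix_vector_mult_def vec_eq_iff sum.distrib sum_distrib_left distrib_left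
       distrib_right mult.assoc mult.left_commute)

lemma bstar_triple_product:
  "bstar \<Omega> v w z = triple_product \<Omega> (*v) (wgrad \<Omega> w) v z + 1/2 * triple_product \<Omega> (*\<^sub>R) (wdiv \<Omega> v) w z"
  by (simp add: bstar_def triple_product_def)

lemma bstar_linear:
  fixes v w z :: "real^'n \<Rightarrow> real^'n"
  assumes dim: "CARD('n) \<in> {2, 3}" and \<Omega>: "open \<Omega>"
  shows "w \<in> X_space \<Omega> \<Longrightarrow> z \<in> X_space \<Omega> \<Longrightarrow> linear_form (X_space \<Omega>) (\<lambda>v. bstar \<Omega> v w z)"
    and "v \<in> X_space \<Omega> \<Longrightarrow> z \<in> X_space \<Omega> \<Longrightarrow> linear_form (X_space \<Omega>) (\<lambda>w. bstar \<Omega> v w z)"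
    and "v \<in> X_space \<Omega> \<Longrightarrow> w \<in> X_space \<Omega> \<Longrightarrow> linear_form (X_space \<Omega>) (bstar \<Omega> v w)"
proof -
  note mv = bounded_bilinear_matrix_vector and sc = bounded_bilinear_scaleR
  note lin_mv = triple_product_linear[OF dim \<Omega> mv] and lin_sc = triple_product_linear[OF dim \<Omega> sc]
  have add: "linear_form S (\<lambda>u. p u + 1/2 * q u)" if "linear_form S p" "linear_form S q"
    for S and p q :: "(real^'n \<Rightarrow> real^'n) \<Rightarrow> real"
    using that by (auto simp: linear_form_def algebra_simps)
  have grad: "wgrad \<Omega> w \<in> L2_space \<Omega>" "wdiv \<Omega> w \<in> L2_space \<Omega>" if "w \<in> X_space \<Omega>" for w
    using X_space_H1[OF that] wgrad_props(1) wdiv_L2 by auto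
  have restr: "linear_form (X_space \<Omega>) g" if "linear_form (H1_space \<Omega>) g" for g
    using that X_space_H1 unfolding linear_form_def by blast
  have lin_grad: "linear_form (X_space \<Omega>) (\<lambda>w. triple_product \<Omega> (*v) (wgrad \<Omega> w) v z)"
    if v: "v \<in> X_space \<Omega>" and z: "z \<in> X_space \<Omega>" for v z
    by (intro restr linear_form_AE_linear[OF AE_linear_wgrad[OF \<Omega>] lin_mv(1)[OF v z]]
        triple_product_cong_AE[OF dim \<Omega> mv] v z)
  have lin_div: "linear_form (X_space \<Omega>) (\<lambda>w. triple_product \<Omega> (*\<^sub>R) (wdiv \<Omega> w) v z)"
    if v: "v \<in> X_space \<Omega>" and z: "z \<in> X_space \<Omega>" for v z
    by (intro restr linear_form_AE_linear[OF AE_linear_wdiv[OF \<Omega>] lin_sc(1)[OF v z]]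
        triple_product_cong_AE[OF dim \<Omega> sc] v z)
  show "w \<in> X_space \<Omega> \<Longrightarrow> z \<in> X_space \<Omega> \<Longrightarrow> linear_form (X_space \<Omega>) (\<lambda>v. bstar \<Omega> v w z)"
    unfolding bstar_triple_product by (intro add lin_mv(2) lin_div grad)
  show "v \<in> X_space \<Omega> \<Longrightarrow> z \<in> X_space \<Omega> \<Longrightarrow> linear_form (X_space \<Omega>) (\<lambda>w. bstar \<Omega> v w z)"
    unfolding bstar_triple_product by (intro add lin_sc(2) lin_grad grad)
  show "v \<in> X_space \<Omega> \<Longrightarrow> w \<in> X_space \<Omega> \<Longrightarrow> linear_form (X_space \<Omega>) (bstar \<Omega> v w)"
    unfolding bstar_triple_product[abs_def] by (intro add lin_mv(3) lin_sc(3) grad)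
qed

lemma matrix_vector_inner: "(A *v x) \<bullet> y = (\<Sum>i\<in>UNIV. \<Sum>j\<in>UNIV. A $ i $ j * (x $ j * y $ i))"
  for A :: "real^'n^'n"
  by (simp add: inner_vec_def matrix_vector_mult_def sum_distrib_right mult.assoc)

text \<open>Since \<open>\<partial>\<^sub>j (\<phi>\<^sub>i\<^sup>2) = 2 \<phi>\<^sub>i \<partial>\<^sub>j \<phi>\<^sub>i\<close>, testing the weak derivative \<open>\<partial>\<^sub>j u\<^sub>j\<close> with \<open>\<phi>\<^sub>i\<^sup>2\<close> and summing
  over \<open>i\<close> and \<open>j\<close> shows that twice the gradient term is minus the divergence term.\<close>

lemma bstar_test_field_eq_0:
  fixes u \<phi> :: "real^'n \<Rightarrow> real^'n"
  assumes \<Omega>: "open \<Omega>" and u: "u \<in> H1_space \<Omega>" and \<phi>: "\<phi> \<in> test_fields \<Omega>"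
  shows "bstar \<Omega> u \<phi> \<phi> = 0"
proof -
  define D where "D i j x = partial_deriv j (\<lambda>x. \<phi> x $ i) x" for i j x
  define G where "G = wgrad \<Omega> u"
  have comp: "(\<lambda>x. \<phi> x $ i) \<in> test_functions \<Omega>" for i
    using \<phi> by (simp add: test_fields_def)
  have D: "D i j \<in> test_functions \<Omega>" for i j
    unfolding D_def by (rule test_function_partial_deriv[OF comp])
  have D\<phi>: "(\<lambda>x. \<phi> x $ i * D i j x) \<in> test_functions \<Omega>" for i j
    by (rule test_function_mult[OF D test_function_C_k[OF comp]])
  have \<phi>\<phi>: "(\<lambda>x. \<phi> x $ i * \<phi> x $ i) \<in> test_functions \<Omega>" for i
    by (rule test_function_mult[OF comp test_function_C_k[OF comp]])
  note L2 = test_function_L2[OF \<Omega>]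
  note uj = L2_component[OF H1_space_L2[OF u]]
  have G2: "G \<in> L2_space \<Omega>" and Gw: "has_weak_grad \<Omega> u G"
    using wgrad_props[OF u] by (simp_all add: G_def)
  have int1: "integrable (lebesgue_on \<Omega>) (\<lambda>x. D i j x * (u x $ j * \<phi> x $ i))" for i j
    using L2_inner_integrable[OF uj L2[OF D\<phi>], of j i j] by (simp add: mult_ac)
  have int2: "integrable (lebesgue_on \<Omega>) (\<lambda>x. G x $ j $ j * (\<phi> x $ i * \<phi> x $ i))" for i j
    using L2_inner_integrable[OF L2_entry[OF G2] L2[OF \<phi>\<phi>], of j j i] by simp
  have weak: "2 * (\<integral>x. D i j x * (u x $ j * \<phi> x $ i) \<partial>lebesgue_on \<Omega>)
      = - (\<integral>x. G x $ j $ j * (\<phi> x $ i * \<phi> x $ i) \<partial>lebesgue_on \<Omega>)" for i j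
  proof -
    have pd: "partial_deriv j (\<lambda>x. \<phi> x $ i * \<phi> x $ i) x = 2 * (\<phi> x $ i * D i j x)" for x
    proof -
      have "partial_deriv j (\<lambda>x. \<phi> x $ i * \<phi> x $ i) x
          = \<phi> x $ i * partial_deriv j (\<lambda>x. \<phi> x $ i) x + partial_deriv j (\<lambda>x. \<phi> x $ i) x * \<phi> x $ i"
        by (rule partial_deriv_mult[OF test_function_differentiable[OF comp] test_function_differentiable[OF comp]])
      then show ?thesis by (simp add: D_def)
    qed
    have "L2_inner \<Omega> (\<lambda>x. u x $ j) (partial_deriv j (\<lambda>x. \<phi> x $ i * \<phi> x $ i))
        = 2 * (\<integral>x. D i j x * (u x $ j * \<phi> x $ i) \<partial>lebesgue_on \<Omega>)"
    proof -
      have "L2_inner \<Omega> (\<lambda>x. u x $ j) (partial_deriv j (\<lambda>x. \<phi> x $ i * \<phi> x $ i))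
          = (\<integral>x. 2 * (D i j x * (u x $ j * \<phi> x $ i)) \<partial>lebesgue_on \<Omega>)"
        unfolding L2_inner_def by (rule Bochner_Integration.integral_cong) (simp_all add: pd)
      then show ?thesis by simp
    qed
    moreover have "L2_inner \<Omega> (\<lambda>x. G x $ j $ j) (\<lambda>x. \<phi> x $ i * \<phi> x $ i)
        = (\<integral>x. G x $ j $ j * (\<phi> x $ i * \<phi> x $ i) \<partial>lebesgue_on \<Omega>)"
      by (simp add: L2_inner_def)
    moreover have "L2_inner \<Omega> (\<lambda>x. u x $ j) (partial_deriv j (\<lambda>x. \<phi> x $ i * \<phi> x $ i))
        = - L2_inner \<Omega> (\<lambda>x. G x $ j $ j) (\<lambda>x. \<phi> x $ i * \<phi> x $ i)"
      using Gw[unfolded has_weak_grad_def, rule_format, OF \<phi>\<phi>] .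
    ultimately show ?thesis by linarith
  qed
  have "L2_inner \<Omega> (\<lambda>x. wgrad \<Omega> \<phi> x *v u x) \<phi>
      = (\<integral>x. (\<Sum>i\<in>UNIV. \<Sum>j\<in>UNIV. D i j x * (u x $ j * \<phi> x $ i)) \<partial>lebesgue_on \<Omega>)"
    unfolding L2_inner_def
  proof (rule integral_cong_AE)
    note uL = L2_space_measurable[OF H1_space_L2[OF u]]
    note \<phi>H = test_field_H1(1)[OF \<Omega> \<phi>]
    have "(\<lambda>x. wgrad \<Omega> \<phi> x *v u x) \<in> borel_measurable (lebesgue_on \<Omega>)"
      by (rule borel_measurable_continuous_Pair[OF L2_space_measurable[OF wgrad_props(1)[OF \<phi>H]] uL])
         (intro bounded_bilinear.continuous_on[OF bounded_bilinear_matrix_vector] continuous_intros)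
    then show "(\<lambda>x. (wgrad \<Omega> \<phi> x *v u x) \<bullet> \<phi> x) \<in> borel_measurable (lebesgue_on \<Omega>)"
      by (rule borel_measurable_inner[OF _ L2_space_measurable[OF H1_space_L2[OF \<phi>H]]])
    show "(\<lambda>x. \<Sum>i\<in>UNIV. \<Sum>j\<in>UNIV. D i j x * (u x $ j * \<phi> x $ i)) \<in> borel_measurable (lebesgue_on \<Omega>)"
      by (intro borel_measurable_sum borel_measurable_integrable[OF int1])
    show "AE x in lebesgue_on \<Omega>. (wgrad \<Omega> \<phi> x *v u x) \<bullet> \<phi> x
        = (\<Sum>i\<in>UNIV. \<Sum>j\<in>UNIV. D i j x * (u x $ j * \<phi> x $ i))"
      using test_field_H1(2)[OF \<Omega> \<phi>] by eventually_elim (simp add: matrix_vector_inner D_def)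
  qed
  also have "\<dots> = (\<Sum>i\<in>UNIV. \<Sum>j\<in>UNIV. \<integral>x. D i j x * (u x $ j * \<phi> x $ i) \<partial>lebesgue_on \<Omega>)"
    by (simp add: Bochner_Integration.integral_sum int1)
  finally have T1: "L2_inner \<Omega> (\<lambda>x. wgrad \<Omega> \<phi> x *v u x) \<phi>
      = (\<Sum>i\<in>UNIV. \<Sum>j\<in>UNIV. \<integral>x. D i j x * (u x $ j * \<phi> x $ i) \<partial>lebesgue_on \<Omega>)" .
  have "(wdiv \<Omega> u x *\<^sub>R \<phi> x) \<bullet> \<phi> x = (\<Sum>i\<in>UNIV. \<Sum>j\<in>UNIV. G x $ j $ j * (\<phi> x $ i * \<phi> x $ i))" for x
    by (simp add: wdiv_def G_def trace_def inner_vec_def sum_distrib_left sum_distrib_right mult.assoc)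
  then have T2: "L2_inner \<Omega> (\<lambda>x. wdiv \<Omega> u x *\<^sub>R \<phi> x) \<phi>
      = (\<Sum>i\<in>UNIV. \<Sum>j\<in>UNIV. \<integral>x. G x $ j $ j * (\<phi> x $ i * \<phi> x $ i) \<partial>lebesgue_on \<Omega>)"
    by (simp add: L2_inner_def Bochner_Integration.integral_sum int2)
  have "2 * bstar \<Omega> u \<phi> \<phi> = (\<Sum>i\<in>UNIV. \<Sum>j\<in>UNIV.
      2 * (\<integral>x. D i j x * (u x $ j * \<phi> x $ i) \<partial>lebesgue_on \<Omega>)
        + (\<integral>x. G x $ j $ j * (\<phi> x $ i * \<phi> x $ i) \<partial>lebesgue_on \<Omega>))"
    unfolding bstar_def T1 T2 by (simp add: sum.distrib sum_distrib_left)
  also have "\<dots> = 0" unfolding weak by simp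
  finally show ?thesis by simp
qed

text \<open>For a test field \<open>\<phi>\<close>, \<open>b*(u, v, v) = b*(u, v - \<phi>, v) + b*(u, \<phi>, v - \<phi>)\<close>, and the bound on the form
  makes the right-hand side small.\<close>

lemma bstar_skew:
  fixes u v :: "real^'n \<Rightarrow> real^'n"
  assumes dim: "CARD('n) \<in> {2, 3}" and \<Omega>: "open \<Omega>"
    and bound: "\<And>x y z. x \<in> X_space \<Omega> \<Longrightarrow> y \<in> X_space \<Omega> \<Longrightarrow> z \<in> X_space \<Omega> \<Longrightarrow>
      \<bar>bstar \<Omega> x y z\<bar> \<le> M * L2_norm \<Omega> (wgrad \<Omega> x) * L2_norm \<Omega> (wgrad \<Omega> y) * L2_norm \<Omega> (wgrad \<Omega> z)"
    and M: "0 \<le> M" and u: "u \<in> X_space \<Omega>" and v: "v \<in> X_space \<Omega>"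
  shows "bstar \<Omega> u v v = 0"
proof -
  interpret g: semi_inner "X_space \<Omega>" "grad_inner \<Omega>"
    by (rule semi_inner_grad[OF \<Omega> subspace_X_space[OF \<Omega>]]) (auto intro: X_space_H1)
  have nrm: "L2_norm \<Omega> (wgrad \<Omega> w) = g.nrm w" for w
    by (simp add: semi_inner_grad_nrm[OF g.semi_inner_axioms])
  obtain \<phi> where \<phi>: "\<And>n. \<phi> n \<in> test_fields \<Omega>" "(\<lambda>n. H1_norm \<Omega> (v - \<phi> n)) \<longlonglongrightarrow> 0"
    using v by (auto simp: X_space_def fun_diff_def)
  note \<phi>X = test_field_X[OF \<Omega> \<phi>(1)]
  have d: "(\<lambda>n. g.nrm (v - \<phi> n)) \<longlonglongrightarrow> 0"
    using H1_norm_tendsto_0_iff[OF X_space_H1[OF g.diff_mem[OF v \<phi>X]]] \<phi>(2) by (simp add: nrm)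
  have est: "\<bar>bstar \<Omega> u v v\<bar> \<le> M * g.nrm u * (g.nrm (v - \<phi> n) * (2 * g.nrm v + g.nrm (v - \<phi> n)))" for n
  proof -
    let ?d = "v - \<phi> n"
    have dX: "?d \<in> X_space \<Omega>" by (rule g.diff_mem[OF v \<phi>X])
    have "bstar \<Omega> u v v = bstar \<Omega> u ?d v + bstar \<Omega> u (\<phi> n) v"
      using linear_form_diff[OF bstar_linear(2)[OF dim \<Omega> u v] g.subspace v \<phi>X, of n] by simp
    also have "bstar \<Omega> u (\<phi> n) v = bstar \<Omega> u (\<phi> n) ?d"
      using linear_form_diff[OF bstar_linear(3)[OF dim \<Omega> u \<phi>X] g.subspace v \<phi>X, of n n]
        bstar_test_field_eq_0[OF \<Omega> X_space_H1[OF u] \<phi>(1)[of n]] by simp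
    finally have "\<bar>bstar \<Omega> u v v\<bar> \<le> M * g.nrm u * g.nrm ?d * g.nrm v + M * g.nrm u * g.nrm (\<phi> n) * g.nrm ?d"
      using bound[OF u dX v] bound[OF u \<phi>X[of n] dX] unfolding nrm by linarith
    also have "\<dots> = M * g.nrm u * (g.nrm ?d * (g.nrm v + g.nrm (\<phi> n)))" by (simp add: algebra_simps)
    also have "\<dots> \<le> M * g.nrm u * (g.nrm ?d * (2 * g.nrm v + g.nrm ?d))"
    proof (intro mult_left_mono)
      show "g.nrm v + g.nrm (\<phi> n) \<le> 2 * g.nrm v + g.nrm ?d"
        using g.nrm_diff_le[OF v \<phi>X, of n] by linarith
      show "0 \<le> g.nrm ?d" by (rule g.nrm_nonneg[OF dX])
      show "0 \<le> M * g.nrm u" using M g.nrm_nonneg[OF u] by simp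
    qed
    finally show ?thesis .
  qed
  have "(\<lambda>n. M * g.nrm u * (g.nrm (v - \<phi> n) * (2 * g.nrm v + g.nrm (v - \<phi> n))))
      \<longlonglongrightarrow> M * g.nrm u * (0 * (2 * g.nrm v + 0))"
    by (intro tendsto_intros d)
  then have "\<bar>bstar \<Omega> u v v\<bar> \<le> M * g.nrm u * (0 * (2 * g.nrm v + 0))"
    by (rule LIMSEQ_le_const) (use est in blast)
  then show ?thesis by simp
qed

text \<open>Replacing \<open>z\<close> by \<open>- z\<close> bounds the modulus. A negative \<open>M\<close> forces all gradient norms to vanish, and
  \<open>max M 0\<close> is then an admissible constant as well.\<close>

lemma bstar_abs_bound:
  fixes v w z :: "real^'n \<Rightarrow> real^'n"
  assumes dim: "CARD('n) \<in> {2, 3}" and \<Omega>: "open \<Omega>"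
    and M: "\<And>v w z. v \<in> X_space \<Omega> \<Longrightarrow> w \<in> X_space \<Omega> \<Longrightarrow> z \<in> X_space \<Omega> \<Longrightarrow>
      bstar \<Omega> v w z \<le> M * L2_norm \<Omega> (wgrad \<Omega> v) * L2_norm \<Omega> (wgrad \<Omega> w) * L2_norm \<Omega> (wgrad \<Omega> z)"
    and v: "v \<in> X_space \<Omega>" and w: "w \<in> X_space \<Omega>" and z: "z \<in> X_space \<Omega>"
  shows "\<bar>bstar \<Omega> v w z\<bar> \<le> max M 0 * L2_norm \<Omega> (wgrad \<Omega> v) * L2_norm \<Omega> (wgrad \<Omega> w) * L2_norm \<Omega> (wgrad \<Omega> z)"
proof -
  interpret g: semi_inner "X_space \<Omega>" "grad_inner \<Omega>"
    by (rule semi_inner_grad[OF \<Omega> subspace_X_space[OF \<Omega>]]) (auto intro: X_space_H1)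
  have nrm: "L2_norm \<Omega> (wgrad \<Omega> w) = g.nrm w" for w
    by (simp add: semi_inner_grad_nrm[OF g.semi_inner_axioms])
  have mz: "- z \<in> X_space \<Omega>" using g.scale_mem[OF z, of "-1"] by simp
  have "g.nrm (- z) = g.nrm z" using g.nrm_scale[OF z, of "-1"] by simp
  moreover have "bstar \<Omega> v w (- z) = - bstar \<Omega> v w z"
    by (rule linear_form_minus[OF bstar_linear(3)[OF dim \<Omega> v w] z])
  ultimately have "\<bar>bstar \<Omega> v w z\<bar> \<le> M * g.nrm v * g.nrm w * g.nrm z"
    using M[OF v w z] M[OF v w mz] by (simp add: nrm)
  also have "\<dots> \<le> max M 0 * g.nrm v * g.nrm w * g.nrm z"
    using v w z by (intro mult_right_mono) auto
  finally show ?thesis by (simp add: nrm)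
qed

text \<open>The supremum is taken over a bounded set by the continuity of \<open>f\<close>. Fields with vanishing gradient
  cannot be normalised; there \<open>f\<close> vanishes, again by continuity.\<close>

lemma Hm1_props:
  assumes \<Omega>: "open \<Omega>" and f: "f \<in> Hm1_space \<Omega>"
  shows "linear_form (X_space \<Omega>) f" "0 \<le> Hm1_norm \<Omega> f"
    and "v \<in> X_space \<Omega> \<Longrightarrow> \<bar>f v\<bar> \<le> Hm1_norm \<Omega> f * L2_norm \<Omega> (wgrad \<Omega> v)"
proof -
  interpret g: semi_inner "X_space \<Omega>" "grad_inner \<Omega>"
    by (rule semi_inner_grad[OF \<Omega> subspace_X_space[OF \<Omega>]]) (auto intro: X_space_H1)
  have nrm: "L2_norm \<Omega> (wgrad \<Omega> w) = g.nrm w" for w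
    by (simp add: semi_inner_grad_nrm[OF g.semi_inner_axioms])
  have comb: "f (a *\<^sub>R v + b *\<^sub>R w) = a * f v + b * f w" if "v \<in> X_space \<Omega>" "w \<in> X_space \<Omega>" for v w a b
    using f that by (simp add: Hm1_space_def plus_fun_def scaleR_fun_def)
  show lin: "linear_form (X_space \<Omega>) f"
    unfolding linear_form_def
  proof (intro conjI ballI allI)
    fix v assume v: "v \<in> X_space \<Omega>"
    show "f (v + w) = f v + f w" if "w \<in> X_space \<Omega>" for w
      using comb[OF v that, of 1 1] by simp
    show "f (c *\<^sub>R v) = c * f v" for c
      using comb[OF v v, of c 0] by simp
  qed
  obtain K where K: "\<And>v. v \<in> X_space \<Omega> \<Longrightarrow> \<bar>f v\<bar> \<le> K * g.nrm v"
  proof -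
    have "\<exists>K. \<forall>v\<in>X_space \<Omega>. \<bar>f v\<bar> \<le> K * g.nrm v"
      using f unfolding Hm1_space_def nrm by blast
    then show ?thesis using that by blast
  qed
  let ?A = "{v \<in> X_space \<Omega>. g.nrm v \<le> 1}"
  have "\<bar>f v\<bar> \<le> \<bar>K\<bar>" if "v \<in> ?A" for v
  proof -
    have "\<bar>f v\<bar> \<le> K * g.nrm v" using K that by simp
    also have "\<dots> \<le> \<bar>K\<bar> * 1" using that by (intro mult_mono) auto
    finally show ?thesis by simp
  qed
  then have bdd: "bdd_above ((\<lambda>v. \<bar>f v\<bar>) ` ?A)" by (intro bdd_aboveI2)
  have norm_eq: "Hm1_norm \<Omega> f = (SUP v\<in>?A. \<bar>f v\<bar>)" by (simp add: Hm1_norm_def nrm)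
  have le: "\<bar>f v\<bar> \<le> Hm1_norm \<Omega> f" if "v \<in> ?A" for v
    unfolding norm_eq by (rule cSUP_upper[OF that bdd])
  show nonneg: "0 \<le> Hm1_norm \<Omega> f"
    using le[of 0] by simp
  show "\<bar>f v\<bar> \<le> Hm1_norm \<Omega> f * L2_norm \<Omega> (wgrad \<Omega> v)" if v: "v \<in> X_space \<Omega>"
    unfolding nrm
  proof (cases "g.nrm v = 0")
    case True
    then show "\<bar>f v\<bar> \<le> Hm1_norm \<Omega> f * g.nrm v" using K[OF v] by simp
  next
    case False
    then have pos: "0 < g.nrm v" using g.nrm_nonneg[OF v] by simp
    let ?w = "(1 / g.nrm v) *\<^sub>R v"
    have "?w \<in> ?A" using v pos by (simp add: g.nrm_scale)
    from le[OF this] have "\<bar>f v\<bar> / g.nrm v \<le> Hm1_norm \<Omega> f"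
      using pos by (simp add: linear_form_scale[OF lin v] abs_mult)
    then show "\<bar>f v\<bar> \<le> Hm1_norm \<Omega> f * g.nrm v" using pos by (simp add: field_simps)
  qed
qed

section \<open>Quadratic convergence\<close>

text \<open>An instance of \<open>Picard_Newton\<close> with the constant \<open>max M 0\<close>.\<close>

theorem theorem3p1:
  fixes \<Omega> :: "(real^'n) set" and M \<nu> :: real
    and f :: "(real^'n \<Rightarrow> real^'n) \<Rightarrow> real" and u :: "real^'n \<Rightarrow> real^'n"
  assumes dim: "CARD('n) \<in> {2, 3}"
    and domain: "open \<Omega>" "connected \<Omega>"
    and poincare: "\<exists>C\<^sub>P. \<forall>\<phi>\<in>X_space \<Omega>. L2_norm \<Omega> \<phi> \<le> C\<^sub>P * L2_norm \<Omega> (wgrad \<Omega> \<phi>)"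
    and M: "\<forall>v\<in>X_space \<Omega>. \<forall>w\<in>X_space \<Omega>. \<forall>z\<in>X_space \<Omega>.
      bstar \<Omega> v w z \<le> M * L2_norm \<Omega> (wgrad \<Omega> v) * L2_norm \<Omega> (wgrad \<Omega> w) * L2_norm \<Omega> (wgrad \<Omega> z)"
    and viscosity: "\<nu> > 0"
    and forcing: "f \<in> Hm1_space \<Omega>"
    and small_data: "M * \<nu> powi (-2) * Hm1_norm \<Omega> f < 1"
    and solution: "weak_NSE_solution \<Omega> \<nu> f u"
  shows "\<exists>r>0. \<exists>C\<ge>0. \<forall>u0\<in>V_space \<Omega>. L2_norm \<Omega> (wgrad \<Omega> (\<lambda>x. u x - u0 x)) < r \<longrightarrow>
    (\<exists>us. picard_newton_sequence \<Omega> \<nu> f u0 us) \<and>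
    (\<forall>us. picard_newton_sequence \<Omega> \<nu> f u0 us \<longrightarrow>
      (\<lambda>k. L2_norm \<Omega> (wgrad \<Omega> (\<lambda>x. u x - us k x))) \<longlonglongrightarrow> 0 \<and>
      (\<forall>k. L2_norm \<Omega> (wgrad \<Omega> (\<lambda>x. u x - us (Suc k) x))
        \<le> C * (L2_norm \<Omega> (wgrad \<Omega> (\<lambda>x. u x - us k x)))\<^sup>2))"
proof -
  obtain C where C: "\<And>v. v \<in> X_space \<Omega> \<Longrightarrow> L2_norm \<Omega> v \<le> C * L2_norm \<Omega> (wgrad \<Omega> v)"
    using poincare by blast
  interpret V: semi_hilbert "V_space \<Omega>" "grad_inner \<Omega>"
    by (rule semi_hilbert_V[OF domain(1) C])
  have nrm: "L2_norm \<Omega> (wgrad \<Omega> w) = V.nrm w" for w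
    by (simp add: semi_inner_grad_nrm[OF V.semi_inner_axioms])
  let ?M = "max M 0" and ?F = "Hm1_norm \<Omega> f"
  have restr: "linear_form (V_space \<Omega>) g" if "linear_form (X_space \<Omega>) g" for g
    using that V_space_X unfolding linear_form_def by blast
  have bound: "\<bar>bstar \<Omega> v w z\<bar> \<le> ?M * L2_norm \<Omega> (wgrad \<Omega> v) * L2_norm \<Omega> (wgrad \<Omega> w) * L2_norm \<Omega> (wgrad \<Omega> z)"
    if "v \<in> X_space \<Omega>" "w \<in> X_space \<Omega>" "z \<in> X_space \<Omega>" for v w z
    by (rule bstar_abs_bound[OF dim domain(1) _ that]) (use M in blast)
  note f = Hm1_props[OF domain(1) forcing]
  have small: "?M * ?F / \<nu>\<^sup>2 < 1"
  proof (cases "0 \<le> M")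
    case True
    then show ?thesis using small_data by (simp add: power_int_minus divide_inverse mult_ac)
  qed (simp add: max_def)
  have u: "u \<in> V_space \<Omega>" "\<And>v. v \<in> V_space \<Omega> \<Longrightarrow> \<nu> * grad_inner \<Omega> u v + bstar \<Omega> u u v = f v"
    using solution by (auto simp: weak_NSE_solution_def grad_inner_def)
  note lin = bstar_linear[OF dim domain(1) V_space_X V_space_X, THEN restr]
  have skew: "bstar \<Omega> v w w = 0" if "v \<in> V_space \<Omega>" "w \<in> V_space \<Omega>" for v w
    by (rule bstar_skew[OF dim domain(1) bound _ V_space_X V_space_X]) (use that in auto)
  have boundV: "\<bar>bstar \<Omega> v w z\<bar> \<le> ?M * V.nrm v * V.nrm w * V.nrm z"
    if "v \<in> V_space \<Omega>" "w \<in> V_space \<Omega>" "z \<in> V_space \<Omega>" for v w z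
    using bound[OF that[THEN V_space_X]] by (simp only: nrm)
  have fV: "\<bar>f v\<bar> \<le> ?F * V.nrm v" if "v \<in> V_space \<Omega>" for v
    using f(3)[OF V_space_X[OF that]] by (simp only: nrm)
  have diff: "(\<lambda>x. u x - w x) = u - w" for w by (simp add: fun_diff_def)
  have seq: "picard_newton_sequence \<Omega> \<nu> f u0 us \<longleftrightarrow> us 0 = u0 \<and> (\<forall>k. \<exists>uh.
      (uh \<in> V_space \<Omega> \<and> (\<forall>v\<in>V_space \<Omega>. \<nu> * grad_inner \<Omega> uh v + bstar \<Omega> (us k) uh v = f v)) \<and>
      (us (Suc k) \<in> V_space \<Omega> \<and> (\<forall>v\<in>V_space \<Omega>. \<nu> * grad_inner \<Omega> (us (Suc k)) v
        + bstar \<Omega> uh (us (Suc k)) v + bstar \<Omega> (us (Suc k)) uh v - bstar \<Omega> uh uh v = f v)))" for u0 us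
    by (simp only: picard_newton_sequence_def picard_step_def newton_step_def grad_inner_def)
  show ?thesis
    unfolding diff nrm seq
    by (rule V.Picard_Newton[OF lin(1) lin(2) lin(3) skew boundV _ restr[OF f(1)] fV f(2) viscosity small u])
       auto
qed

end
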